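(* Let the data and the discretization satisfy all assumptions listed in the context. Let $\nu\in\{1,\dots,N\}$ and $\tilde{\mathbf u}=(\tilde u_i)_{i\in I}\in(\mathbb R^+_0)^I$. Let $$B_{f,\nu}:=\max\Big\{\sum_{m\in\{\mathrm s,\mathrm g\}}f_{m,\nu,i}\,\frac{\lambda_3(\omega_{m,i})}{\lambda_3(\omega_i)}:\,i\in I\Big\},\qquad L_{V,\Gamma_\Omega}:=\sigma\max\Big\{\frac{\lambda_2(\partial\omega_{\mathrm s,i}\cap\Gamma_\Omega)}{\lambda_3(\omega_i)}:\,i\in I\Big\},$$ $$L_{V,\partial\Omega\setminus\Gamma_\Omega}:=\sigma\max\Big\{\frac{\lambda_2(\partial\omega_{\mathrm s,i}\cap(\partial\Omega\setminus\Gamma_\Omega))}{\lambda_3(\omega_i)}:\,i\in I\Big\},\qquad L_{V,\Sigma}:=\sigma\max\Big\{\frac{\lambda_2(\omega_i\cap\Sigma)}{\lambda_3(\omega_i)}:\,i\in I\Big\},$$ $$m(\tilde{\mathbf u}):=\min\{\theta_{\rm ext},\,\|\tilde{\mathbf u}\|_{\min}\},\qquad M_\nu(\tilde{\mathbf u}):=\max\Big\{\theta_{\rm ext},\,\|\tilde{\mathbf u}\|_{\max}+\frac{k_\nu}{C_\varepsilon}B_{f,\nu}\Big\}.$$ Then each solution $\mathbf u_\nu=(u_{\nu,i})_{i\in I}\in(\mathbb R^+_0)^I$ of $$\mathcal H_{\nu,i}(\tilde{\mathbf u},\mathbf u_\nu)=0\qquad\text{for all } i\in I \tag{$*$}$$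 lies in $[m(\tilde{\mathbf u}),M_\nu(\tilde{\mathbf u})]^I$. Furthermore, for $r\ge 0$ let $$l_g^1(r):=4\,\mathrm{var}^-\epsilon(r)\,r^3+L_{\epsilon,r}\,r^4,\qquad l_g^2(r):=4\,\epsilon_{\min,r}^{-1}\,r^3+\max\{r^4,\theta_{\rm ext}^4\}\,L_{\epsilon,r}\,\big(2\,\epsilon_{\min,r}^{-1}+1\big),\qquad l_g^3(r):=L_{\epsilon,r}\,\theta_{\rm ext}^4.$$ If $k_\nu$ is such that $$k_\nu\Big((L_{V,\Gamma_\Omega}+L_{V,\partial\Omega\setminus\Gamma_\Omega}+L_{V,\Sigma})\,l_g^1(M_\nu(\tilde{\mathbf u}))+(L_{V,\Gamma_\Omega}+L_{V,\Sigma})\,l_g^2(M_\nu(\tilde{\mathbf u}))+L_{V,\partial\Omega\setminus\Gamma_\Omega}\,l_g^3(M_\nu(\tilde{\mathbf u}))\Big)<C_\varepsilon,$$ then there is a unique $\mathbf u_\nu\in[m(\tilde{\mathbf u}),M_\nu(\tilde{\mathbf u})]^I$ satisfying $( * )$.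
   Context: Notation: $\mathbb R^+=(0,\infty)$, $\mathbb R^+_0=[0,\infty)$; $\lambda_d$ is $d$-dimensional (surface) measure; $\|\cdot\|_2$ is the Euclidean norm; for a finite vector $\mathbf u=(u_i)$, $\|\mathbf u\|_{\min}:=\min_i u_i$, $\|\mathbf u\|_{\max}:=\max_i u_i$. A partition of a polyhedral set consists of finitely many (relatively) open, pairwise disjoint pieces which cover it up to boundaries of the pieces. Domain: $T>0$, $\overline\Omega=\overline\Omega_{\mathrm s}\cup\overline\Omega_{\mathrm g}$, $\Omega_{\mathrm s}\cap\Omega_{\mathrm g}=\emptyset$, where $\Omega,\Omega_{\mathrm s},\Omega_{\mathrm g}$ are nonvoid, polyhedral, bounded, open subsets of $\mathbb R^3$; $\partial\Omega_{\mathrm s}$ is the disjoint union of $\partial\Omega$ and $\partial\Omega_{\mathrm g}$. Put $\Sigma:=\partial\Omega_{\mathrm g}=\overline\Omega_{\mathrm s}\cap\overline\Omega_{\mathrm g}$ (a Lipschitz interface), so $\partial\Omega=\partial\Omega_{\mathrm s}\setminus\Sigma$. Put $O:=\mathrm{int}(\mathrm{conv}(\overline\Omega))\setminus\overline\Omega$, $\Gamma:=\partial O$, $\Gamma_\Omega:=\overline\Omega\cap\overline O$, $\Gamma_{\rm ph}:=\partial\,\mathrm{conv}(\overline\Omega)\cap\partial O$; $\Gamma_\Omega,\Gamma_{\rm ph}$ partition $\Gamma$. Data: for $m\in\{\mathrm s,\mathrm g\}$, $\varepsilon_m:\mathbb R^+_0\to\mathbb R^+_0$ is continuous and there is $C_\varepsilon\in\mathbb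 R^+$ with $\varepsilon_m(\theta_2)\ge(\theta_2-\theta_1)C_\varepsilon+\varepsilon_m(\theta_1)$ for $\theta_2\ge\theta_1\ge0$; $\kappa_m\in\mathbb R^+_0$; $f_m\in L^\infty(]0,T[\times\Omega_m)$, $f_m\ge0$ a.e.; $\sigma\in\mathbb R^+$; $\theta_{\rm ext}\in\mathbb R^+$; $\theta_{\rm init}\in L^\infty(\Omega,\mathbb R^+)$. The emissivity $\epsilon:\mathbb R^+_0\to\,]0,1]$ is locally Lipschitz: for each $r\ge0$, $L_{\epsilon,r}:=\sup\{|\epsilon(\theta_1)-\epsilon(\theta_2)|/|\theta_1-\theta_2|:\theta_1,\theta_2\in[0,r],\theta_1\ne\theta_2\}<\infty$ ($L_{\epsilon,0}:=0$). Put $\epsilon_{\min,r}:=\min_{[0,r]}\epsilon>0$. The negative variation is $\mathrm{var}^-\epsilon(0):=0$ and, for $\lambda>0$, $\mathrm{var}^-\epsilon(\lambda):=\sup\sum_{l=1}^n\big(-\min\{0,\epsilon(s_l)-\epsilon(s_{l-1})\}\big)$ over all $0=s_0<\dots<s_n=\lambda$. Discretization: $0=t_0<\dots<t_N=T$, $N\in\mathbb N$, $k_\nu:=t_\nu-t_{\nu-1}$. $(\omega_i)_{i\in I}$ is a finite partition of $\Omega$ into nonvoid, polyhedral, connected, open subsets; $\omega_{m,i}:=\omega_i\cap\Omega_m$, $I_m:=\{j\in I:\omega_{m,j}\ne\emptyset\}$. For each $i\in I$, $\partial_{\rm reg}\omega_{\mathrm s,i}\cap\Sigma=\partial_{\rm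 reg}\omega_{\mathrm g,i}\cap\Sigma$, where $\partial_{\rm reg}$ is the part of the boundary where a unique outer unit normal exists ($\partial_{\rm reg}\emptyset=\emptyset$). Points $x_i\in\overline\omega_i$ are given such that: $x_i\in\overline\omega_{m,i}$ for $i\in I_m$; if $\lambda_2(\overline\omega_i\cap\Gamma_\Omega)\ne0$, then $x_i\in\overline\omega_i\cap\Gamma_\Omega$; if $\lambda_2(\overline\omega_i\cap(\partial\Omega\setminus\Gamma_\Omega))\ne0$, then $x_i\in\overline\omega_i\cap\overline{\partial\Omega\setminus\Gamma_\Omega}$. Put $\mathrm{nb}_m(i):=\{j\in I_m\setminus\{i\}:\lambda_2(\partial\omega_{m,i}\cap\partial\omega_{m,j})\ne0\}$, $\mathrm{nb}(i):=\{j\in I\setminus\{i\}:\lambda_2(\partial\omega_i\cap\partial\omega_j)\ne0\}$; for $i\in I$, $j\in\mathrm{nb}(i)$: $x_i\ne x_j$ and $(x_j-x_i)/\|x_i-x_j\|_2$ equals the outer unit normal of $\omega_i$ on $\partial\omega_i\cap\partial\omega_j$. Boundary elements: $(\zeta_\alpha)_{\alpha\in I_\Omega}$ and $(\zeta_\alpha)_{\alpha\in I_\Sigma}$ are finite partitions of $\Gamma_\Omega$ and $\Sigma$, respectively, into nonvoid, polyhedral, connected, relatively open sets, each lying in a plane; $I_\Omega\cap I_\Sigma=\emptyset$, $\mathrm{ph}\notin I_\Omega\cup I_\Sigma$; $\zeta_{\rm ph}:=\Gamma_{\rm ph}$, $I_\Gamma:=I_\Omega\cup\{\mathrm{ph}\}$.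 For each $\alpha\in I_\Omega$ (resp. $I_\Sigma$) there is a unique $i(\alpha)\in I$ with $\zeta_\alpha\subseteq\partial\omega_{i(\alpha)}\cap\Gamma_\Omega$ (resp. $\zeta_\alpha\subseteq\partial\omega_{\mathrm s,i(\alpha)}\cap\Sigma$); moreover $x_{i(\alpha)}\in\overline\zeta_\alpha$. Put $J_{\Omega,i}:=\{\alpha\in I_\Omega:\lambda_2(\zeta_\alpha\cap\partial\omega_i)\ne0\}$, $J_{\Sigma,i}:=\{\alpha\in I_\Sigma:\lambda_2(\zeta_\alpha\cap\partial\omega_{\mathrm s,i})\ne0\}$. View factors: for $(S,D)=(\Sigma,\Omega_{\mathrm g})$ or $(\Gamma,O)$ let $\vec n$ be the a.e. defined unit normal on $S=\partial D$ pointing into $D$, $\omega(x,y):=\dfrac{(\vec n(y)\cdot(x-y))\,(\vec n(x)\cdot(y-x))}{\pi\,((y-x)\cdot(y-x))^2}$, and $\Lambda(x,y):=1$ if $x,y\in S$ are mutually visible, i.e. the open segment $]x,y[$ is contained in $D$, and $\Lambda(x,y):=0$ otherwise. For $(\alpha,\beta)\in(I_\Sigma\times I_\Sigma)\cup(I_\Gamma\times I_\Gamma)$ put $\Lambda_{\alpha,\beta}:=\int_{\zeta_\alpha\times\zeta_\beta}\Lambda\,\omega$. These numbers are nonnegative and symmetric, with $\sum_{\beta\in I_\Sigma}\Lambda_{\alpha,\beta}=\lambda_2(\zeta_\alpha)$ for $\alpha\in I_\Sigma$ and $\sum_{\beta\in I_\Gamma}\Lambda_{\alpha,\beta}=\lambda_2(\zeta_\alpha)$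 for $\alpha\in I_\Gamma$. Discrete radiation operators: for $\mathbf u\in(\mathbb R^+_0)^{I_\Omega}$ (resp. $(\mathbb R^+_0)^{I_\Sigma}$) let $E_{\Gamma,\alpha}(\mathbf u)$ (resp. $E_{\Sigma,\alpha}(\mathbf u)$) $:=\sigma\epsilon(u_\alpha)u_\alpha^4\lambda_2(\zeta_\alpha)$; for $\alpha\in I_\Omega$, $E_{{\rm ph},\alpha}(\mathbf u):=\sigma(1-\epsilon(u_\alpha))\theta_{\rm ext}^4\Lambda_{\alpha,{\rm ph}}$; $G_{\Gamma,\alpha,\beta}(\mathbf u)$ (for $\alpha,\beta\in I_\Omega$), resp. $G_{\Sigma,\alpha,\beta}(\mathbf u)$ (for $\alpha,\beta\in I_\Sigma$), is $\delta_{\alpha\beta}\lambda_2(\zeta_\alpha)-(1-\epsilon(u_\alpha))\Lambda_{\alpha,\beta}$. The matrices $\mathbf G_\Gamma(\mathbf u),\mathbf G_\Sigma(\mathbf u)$ are strictly diagonally dominant, hence invertible. Put $\mathbf R_\Gamma(\mathbf u):=\mathbf G_\Gamma(\mathbf u)^{-1}(\mathbf E_\Gamma(\mathbf u)+\mathbf E_{\rm ph}(\mathbf u))$, $\mathbf R_\Sigma(\mathbf u):=\mathbf G_\Sigma(\mathbf u)^{-1}\mathbf E_\Sigma(\mathbf u)$, $V_{\Gamma,\alpha}(\mathbf u):=\epsilon(u_\alpha)\sum_{\beta\in I_\Omega}R_{\Gamma,\beta}(\mathbf u)\Lambda_{\alpha,\beta}+\sigma\epsilon(u_\alpha)\theta_{\rm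 ext}^4\Lambda_{\alpha,{\rm ph}}$ ($\alpha\in I_\Omega$), $V_{\Sigma,\alpha}(\mathbf u):=\epsilon(u_\alpha)\sum_{\beta\in I_\Sigma}R_{\Sigma,\beta}(\mathbf u)\Lambda_{\alpha,\beta}$ ($\alpha\in I_\Sigma$). For $\mathbf u\in(\mathbb R^+_0)^I$: $\mathbf u|_{I_\Omega}:=(u_{i(\alpha)})_{\alpha\in I_\Omega}$, $\mathbf u|_{I_\Sigma}:=(u_{i(\alpha)})_{\alpha\in I_\Sigma}$. Source and initial approximations: $f_{m,\nu,i}$ and $\theta_{{\rm init},i}$ are given real numbers with $0\le\operatorname{ess\,inf}(f_m|_{]t_{\nu-1},t_\nu[\times\omega_{m,i}})\le f_{m,\nu,i}\le\|f_m\|_{L^\infty(]t_{\nu-1},t_\nu[\times\omega_{m,i})}$ for $m\in\{\mathrm s,\mathrm g\}$, $\nu\in\{1,\dots,N\}$, $i\in I_m$ (terms with $\omega_{m,i}=\emptyset$ contribute $0$), and $0\le\operatorname{ess\,inf}(\theta_{\rm init}|_{\omega_i})\le\theta_{{\rm init},i}\le\|\theta_{\rm init}\|_{L^\infty(\omega_i)}$ for $i\in I$. Scheme operator: for $\nu\in\{1,\dots,N\}$, $i\in I$, $\mathcal H_{\nu,i}:(\mathbb R^+_0)^I\times(\mathbb R^+_0)^I\to\mathbb R$, $$\begin{aligned}\mathcal H_{\nu,i}(\tilde{\mathbf u},\mathbf u)=\;&k_\nu^{-1}\sum_{m\in\{\mathrm s,\mathrm g\}}(\varepsilon_m(u_i)-\varepsilon_m(\tilde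 u_i))\lambda_3(\omega_{m,i})-\sum_{m\in\{\mathrm s,\mathrm g\}}\kappa_m\sum_{j\in\mathrm{nb}_m(i)}\frac{u_j-u_i}{\|x_i-x_j\|_2}\lambda_2(\partial\omega_{m,i}\cap\partial\omega_{m,j})\\&+\sigma\epsilon(u_i)u_i^4\lambda_2(\partial\omega_{\mathrm s,i}\cap\Gamma_\Omega)-\sum_{\alpha\in J_{\Omega,i}}V_{\Gamma,\alpha}(\mathbf u|_{I_\Omega})\\&+\sigma\epsilon(u_i)(u_i^4-\theta_{\rm ext}^4)\lambda_2(\partial\omega_{\mathrm s,i}\cap(\partial\Omega\setminus\Gamma_\Omega))\\&+\sigma\epsilon(u_i)u_i^4\lambda_2(\omega_i\cap\Sigma)-\sum_{\alpha\in J_{\Sigma,i}}V_{\Sigma,\alpha}(\mathbf u|_{I_\Sigma})-\sum_{m\in\{\mathrm s,\mathrm g\}}f_{m,\nu,i}\lambda_3(\omega_{m,i}).\end{aligned}$$ *)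

theory Defs
  imports "HOL-Analysis.Analysis" "HOL-Probability.Essential_Supremum"
begin

type_synonym R3 = "real ^ 3"

section \<open>Surface measure and volume\<close>

definition planes :: "R3 set set" where
  "planes = {P. affine P \<and> aff_dim P = 2}"

definition plane_chart :: "R3 set \<Rightarrow> real ^ 2 \<Rightarrow> R3" where
  "plane_chart P = (SOME \<phi>. (\<forall>s t. dist (\<phi> s) (\<phi> t) = dist s t) \<and> range \<phi> = P)"

text \<open>Two-dimensional Lebesgue measure on a plane; by the invariance of Lebesgue measure under
  isometries it does not depend on the chosen chart.\<close>

definition plane_measure :: "R3 set \<Rightarrow> R3 measure" where
  "plane_measure P = distr lborel borel (plane_chart P)"

text \<open>The sum of the planar Lebesgue measures over all planes. Distinct planes meet in null sets,
  so a Borel subset of a plane gets its area, and a Borel subset of a polyhedral surface gets the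
  total area of its flat parts (which is its two-dimensional Hausdorff measure). All sets measured
  below are of this kind.\<close>

definition surface_measure :: "R3 measure" where
  "surface_measure = measure_of UNIV (sets borel)
     (\<lambda>A. \<integral>\<^sup>+ P. emeasure (plane_measure P) A \<partial>count_space planes)"

abbreviation area :: "R3 set \<Rightarrow> real" where
  "area A \<equiv> measure surface_measure A"

abbreviation vol :: "R3 set \<Rightarrow> real" where
  "vol A \<equiv> measure lborel A"


section \<open>Polyhedral sets, normals, interfaces, partitions\<close>

text \<open>A (relatively) open polyhedral subset of an affine space \<open>P\<close> is the interior, relative to
  \<open>P\<close>, of a finite union of compact convex polytopes. In particular it is bounded, and it lies on
  one side of almost all of its boundary (there are no slits).\<close>

definition polyhedral_in :: "R3 set \<Rightarrow> R3 set \<Rightarrow> bool" where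
  "polyhedral_in P S \<longleftrightarrow>
     (\<exists>\<C>. finite \<C> \<and> (\<forall>C\<in>\<C>. polytope C \<and> C \<subseteq> P) \<and> S = top_of_set P interior_of (\<Union>\<C>))"

text \<open>For a polyhedral set \<open>D\<close>, an outer unit normal exists at a boundary point precisely if \<open>D\<close>
  coincides with an open half space near that point.\<close>

definition outer_unit_normal :: "R3 set \<Rightarrow> R3 \<Rightarrow> R3 \<Rightarrow> bool" where
  "outer_unit_normal D x n \<longleftrightarrow>
     norm n = 1 \<and> (\<exists>r>0. D \<inter> ball x r = {y \<in> ball x r. n \<bullet> (y - x) < 0})"

definition reg_frontier :: "R3 set \<Rightarrow> R3 set" where
  "reg_frontier D = {x \<in> frontier D. \<exists>!n. outer_unit_normal D x n}"

text \<open>The value 0 is used on the null set where there is no normal.\<close>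

definition inner_normal :: "R3 set \<Rightarrow> R3 \<Rightarrow> R3" where
  "inner_normal D x =
     (if x \<in> reg_frontier D then - (THE n. outer_unit_normal D x n) else 0)"

text \<open>Near each of its points, \<open>S\<close> is the graph, in some direction \<open>e\<close>, of a Lipschitz function of
  the coordinates orthogonal to \<open>e\<close>, with \<open>D\<close> and \<open>D'\<close> on the two sides.\<close>

definition lipschitz_interface :: "R3 set \<Rightarrow> R3 set \<Rightarrow> R3 set \<Rightarrow> bool" where
  "lipschitz_interface D D' S \<longleftrightarrow>
     (\<forall>x\<in>S. \<exists>e r L (g :: R3 \<Rightarrow> real). norm e = 1 \<and> r > 0 \<and> L-lipschitz_on UNIV g \<and>
        (let h = (\<lambda>y. y \<bullet> e - g (y - (y \<bullet> e) *\<^sub>R e)) in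
           S \<inter> ball x r = {y \<in> ball x r. h y = 0} \<and>
           D \<inter> ball x r = {y \<in> ball x r. h y < 0} \<and>
           D' \<inter> ball x r = {y \<in> ball x r. h y > 0}))"

definition partition_up_to_frontiers :: "'k set \<Rightarrow> ('k \<Rightarrow> R3 set) \<Rightarrow> R3 set \<Rightarrow> bool" where
  "partition_up_to_frontiers K p S \<longleftrightarrow>
     finite K \<and> (\<forall>k\<in>K. p k \<subseteq> S) \<and> disjoint_family_on p K \<and> S \<subseteq> (\<Union>k\<in>K. closure (p k))"


section \<open>View factors\<close>

definition vf_kernel :: "R3 set \<Rightarrow> R3 \<Rightarrow> R3 \<Rightarrow> real" where
  "vf_kernel D x y =
     (inner_normal D y \<bullet> (x - y)) * (inner_normal D x \<bullet> (y - x))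
       / (pi * ((y - x) \<bullet> (y - x))\<^sup>2)"

definition visible :: "R3 set \<Rightarrow> R3 \<Rightarrow> R3 \<Rightarrow> real" where
  "visible D x y = (if open_segment x y \<subseteq> D then 1 else 0)"

text \<open>Restricting the surface measure to the two pieces makes the factors of the product measure
  finite; the surface measure itself is not sigma-finite.\<close>

definition view_factor :: "R3 set \<Rightarrow> R3 set \<Rightarrow> R3 set \<Rightarrow> real" where
  "view_factor D A B =
     (LINT z|(restrict_space surface_measure A \<Otimes>\<^sub>M restrict_space surface_measure B).
        visible D (fst z) (snd z) * vf_kernel D (fst z) (snd z))"


section \<open>Essential bounds, Lipschitz constants, negative variation\<close>

definition Linf_norm :: "'a measure \<Rightarrow> ('a \<Rightarrow> real) \<Rightarrow> ereal" where
  "Linf_norm M f = esssup M (\<lambda>x. ereal \<bar>f x\<bar>)"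

definition ess_inf :: "'a measure \<Rightarrow> ('a \<Rightarrow> real) \<Rightarrow> ereal" where
  "ess_inf M f = - esssup M (\<lambda>x. - ereal (f x))"

definition in_Linf :: "'a measure \<Rightarrow> ('a \<Rightarrow> real) \<Rightarrow> bool" where
  "in_Linf M f \<longleftrightarrow> f \<in> borel_measurable M \<and> Linf_norm M f < \<infinity>"

definition diff_quots :: "(real \<Rightarrow> real) \<Rightarrow> real \<Rightarrow> real set" where
  "diff_quots e r = {\<bar>e a - e b\<bar> / \<bar>a - b\<bar> | a b. a \<in> {0..r} \<and> b \<in> {0..r} \<and> a \<noteq> b}"

definition lip_const :: "(real \<Rightarrow> real) \<Rightarrow> real \<Rightarrow> real" where
  "lip_const e r = (if r = 0 then 0 else Sup (diff_quots e r))"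

definition neg_var :: "(real \<Rightarrow> real) \<Rightarrow> real \<Rightarrow> real" where
  "neg_var e r = (if r = 0 then 0 else
     Sup {(\<Sum>l=1..n. - min 0 (e (s l) - e (s (l - 1)))) | (n :: nat) (s :: nat \<Rightarrow> real).
            s 0 = 0 \<and> s n = r \<and> (\<forall>l<n. s l < s (Suc l))})"


section \<open>The continuous problem\<close>

datatype phase = Solid | Gas

record problem =
  final_time :: real
  dom :: "R3 set"
  phase_dom :: "phase \<Rightarrow> R3 set"
  energy :: "phase \<Rightarrow> real \<Rightarrow> real"
  energy_const :: real
  conductivity :: "phase \<Rightarrow> real"
  source :: "phase \<Rightarrow> real \<times> R3 \<Rightarrow> real"
  stefan_boltzmann :: real
  theta_ext :: real
  theta_init :: "R3 \<Rightarrow> real"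
  emissivity :: "real \<Rightarrow> real"

definition interface :: "'z problem_scheme \<Rightarrow> R3 set" where
  "interface p = frontier (phase_dom p Gas)"

definition open_cavity :: "'z problem_scheme \<Rightarrow> R3 set" where
  "open_cavity p = interior (convex hull (closure (dom p))) - closure (dom p)"

definition Gamma_Omega :: "'z problem_scheme \<Rightarrow> R3 set" where
  "Gamma_Omega p = closure (dom p) \<inter> closure (open_cavity p)"

definition Gamma_ph :: "'z problem_scheme \<Rightarrow> R3 set" where
  "Gamma_ph p = frontier (convex hull (closure (dom p))) \<inter> frontier (open_cavity p)"

definition outer_rest :: "'z problem_scheme \<Rightarrow> R3 set" where
  "outer_rest p = frontier (dom p) - Gamma_Omega p"

definition admissible_domain :: "'z problem_scheme \<Rightarrow> bool" where
  "admissible_domain p \<longleftrightarrow>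
     final_time p > 0 \<and>
     (\<forall>D \<in> {dom p, phase_dom p Solid, phase_dom p Gas}. D \<noteq> {} \<and> polyhedral_in UNIV D) \<and>
     closure (dom p) = closure (phase_dom p Solid) \<union> closure (phase_dom p Gas) \<and>
     phase_dom p Solid \<inter> phase_dom p Gas = {} \<and>
     frontier (phase_dom p Solid) = frontier (dom p) \<union> frontier (phase_dom p Gas) \<and>
     frontier (dom p) \<inter> frontier (phase_dom p Gas) = {} \<and>
     lipschitz_interface (phase_dom p Solid) (phase_dom p Gas) (interface p)"

definition admissible_data :: "'z problem_scheme \<Rightarrow> bool" where
  "admissible_data p \<longleftrightarrow>
     energy_const p > 0 \<and>
     (\<forall>m. continuous_on {0..} (energy p m) \<and> (\<forall>\<theta>\<ge>0. energy p m \<theta> \<ge> 0) \<and>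
        (\<forall>\<theta>1 \<theta>2. 0 \<le> \<theta>1 \<and> \<theta>1 \<le> \<theta>2 \<longrightarrow>
           energy p m \<theta>2 \<ge> (\<theta>2 - \<theta>1) * energy_const p + energy p m \<theta>1) \<and>
        conductivity p m \<ge> 0 \<and>
        in_Linf (lebesgue_on ({0<..<final_time p} \<times> phase_dom p m)) (source p m) \<and>
        (AE z in lebesgue_on ({0<..<final_time p} \<times> phase_dom p m). source p m z \<ge> 0)) \<and>
     stefan_boltzmann p > 0 \<and> theta_ext p > 0 \<and>
     in_Linf (lebesgue_on (dom p)) (theta_init p) \<and>
     (AE x in lebesgue_on (dom p). theta_init p x > 0) \<and>
     (\<forall>\<theta>\<ge>0. 0 < emissivity p \<theta> \<and> emissivity p \<theta> \<le> 1) \<and>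
     (\<forall>r\<ge>0. bdd_above (diff_quots (emissivity p) r))"


section \<open>The discretization\<close>

text \<open>Type \<open>'i\<close> indexes the control volumes and type \<open>'b\<close> the boundary elements; \<open>ph_index\<close> is the
  index of the phantom closure of the cavity.\<close>

record ('i, 'b) scheme = problem +
  time_steps :: nat
  time_pt :: "nat \<Rightarrow> real"
  cells :: "'i set"
  cell :: "'i \<Rightarrow> R3 set"
  node :: "'i \<Rightarrow> R3"
  I_Omega :: "'b set"
  I_Sigma :: "'b set"
  ph_index :: 'b
  face :: "'b \<Rightarrow> R3 set"
  source_val :: "phase \<Rightarrow> nat \<Rightarrow> 'i \<Rightarrow> real"
  init_val :: "'i \<Rightarrow> real"

definition time_len :: "('i, 'b) scheme \<Rightarrow> nat \<Rightarrow> real" where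
  "time_len d \<nu> = time_pt d \<nu> - time_pt d (\<nu> - 1)"

definition phase_cell :: "('i, 'b) scheme \<Rightarrow> phase \<Rightarrow> 'i \<Rightarrow> R3 set" where
  "phase_cell d m i = cell d i \<inter> phase_dom d m"

definition phase_cells :: "('i, 'b) scheme \<Rightarrow> phase \<Rightarrow> 'i set" where
  "phase_cells d m = {j \<in> cells d. phase_cell d m j \<noteq> {}}"

definition phase_nb :: "('i, 'b) scheme \<Rightarrow> phase \<Rightarrow> 'i \<Rightarrow> 'i set" where
  "phase_nb d m i = {j \<in> phase_cells d m - {i}.
     area (frontier (phase_cell d m i) \<inter> frontier (phase_cell d m j)) \<noteq> 0}"

definition nb :: "('i, 'b) scheme \<Rightarrow> 'i \<Rightarrow> 'i set" where
  "nb d i = {j \<in> cells d - {i}. area (frontier (cell d i) \<inter> frontier (cell d j)) \<noteq> 0}"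

definition attached_Omega :: "('i, 'b) scheme \<Rightarrow> 'b \<Rightarrow> 'i \<Rightarrow> bool" where
  "attached_Omega d \<alpha> i \<longleftrightarrow>
     i \<in> cells d \<and> face d \<alpha> \<subseteq> frontier (cell d i) \<inter> Gamma_Omega d"

definition attached_Sigma :: "('i, 'b) scheme \<Rightarrow> 'b \<Rightarrow> 'i \<Rightarrow> bool" where
  "attached_Sigma d \<alpha> i \<longleftrightarrow>
     i \<in> cells d \<and> face d \<alpha> \<subseteq> frontier (phase_cell d Solid i) \<inter> interface d"

definition cell_of_Omega :: "('i, 'b) scheme \<Rightarrow> 'b \<Rightarrow> 'i" where
  "cell_of_Omega d \<alpha> = (THE i. attached_Omega d \<alpha> i)"

definition cell_of_Sigma :: "('i, 'b) scheme \<Rightarrow> 'b \<Rightarrow> 'i" where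
  "cell_of_Sigma d \<alpha> = (THE i. attached_Sigma d \<alpha> i)"

definition J_Omega :: "('i, 'b) scheme \<Rightarrow> 'i \<Rightarrow> 'b set" where
  "J_Omega d i = {\<alpha> \<in> I_Omega d. area (face d \<alpha> \<inter> frontier (cell d i)) \<noteq> 0}"

definition J_Sigma :: "('i, 'b) scheme \<Rightarrow> 'i \<Rightarrow> 'b set" where
  "J_Sigma d i = {\<alpha> \<in> I_Sigma d. area (face d \<alpha> \<inter> frontier (phase_cell d Solid i)) \<noteq> 0}"

definition admissible_time :: "('i, 'b) scheme \<Rightarrow> bool" where
  "admissible_time d \<longleftrightarrow>
     time_pt d 0 = 0 \<and> time_pt d (time_steps d) = final_time d \<and>
     (\<forall>\<nu><time_steps d. time_pt d \<nu> < time_pt d (Suc \<nu>))"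

text \<open>The normal of \<open>cell d i\<close> on the common boundary of two neighbours exists only almost
  everywhere, so the condition on it is an almost-everywhere one.\<close>

definition admissible_cells :: "('i, 'b) scheme \<Rightarrow> bool" where
  "admissible_cells d \<longleftrightarrow>
     partition_up_to_frontiers (cells d) (cell d) (dom d) \<and>
     (\<forall>i\<in>cells d.
        cell d i \<noteq> {} \<and> polyhedral_in UNIV (cell d i) \<and> connected (cell d i) \<and>
        reg_frontier (phase_cell d Solid i) \<inter> interface d
          = reg_frontier (phase_cell d Gas i) \<inter> interface d \<and>
        node d i \<in> closure (cell d i) \<and>
        (\<forall>m. i \<in> phase_cells d m \<longrightarrow> node d i \<in> closure (phase_cell d m i)) \<and>
        (area (closure (cell d i) \<inter> Gamma_Omega d) \<noteq> 0 \<longrightarrow>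
           node d i \<in> closure (cell d i) \<inter> Gamma_Omega d) \<and>
        (area (closure (cell d i) \<inter> outer_rest d) \<noteq> 0 \<longrightarrow>
           node d i \<in> closure (cell d i) \<inter> closure (outer_rest d)) \<and>
        (\<forall>j\<in>nb d i. node d i \<noteq> node d j \<and>
           (AE x in surface_measure. x \<in> frontier (cell d i) \<inter> frontier (cell d j) \<longrightarrow>
              outer_unit_normal (cell d i) x
                ((node d j - node d i) /\<^sub>R norm (node d i - node d j)))))"

definition admissible_faces :: "('i, 'b) scheme \<Rightarrow> bool" where
  "admissible_faces d \<longleftrightarrow>
     partition_up_to_frontiers (I_Omega d) (face d) (Gamma_Omega d) \<and>
     partition_up_to_frontiers (I_Sigma d) (face d) (interface d) \<and>
     I_Omega d \<inter> I_Sigma d = {} \<and> ph_index d \<notin> I_Omega d \<union> I_Sigma d \<and>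
     (\<forall>\<alpha>\<in>I_Omega d \<union> I_Sigma d. face d \<alpha> \<noteq> {} \<and> connected (face d \<alpha>) \<and>
        (\<exists>P\<in>planes. polyhedral_in P (face d \<alpha>))) \<and>
     (\<forall>\<alpha>\<in>I_Omega d. (\<exists>!i. attached_Omega d \<alpha> i) \<and>
        node d (cell_of_Omega d \<alpha>) \<in> closure (face d \<alpha>)) \<and>
     (\<forall>\<alpha>\<in>I_Sigma d. (\<exists>!i. attached_Sigma d \<alpha> i) \<and>
        node d (cell_of_Sigma d \<alpha>) \<in> closure (face d \<alpha>))"

definition admissible_values :: "('i, 'b) scheme \<Rightarrow> bool" where
  "admissible_values d \<longleftrightarrow>
     (\<forall>m. \<forall>\<nu>\<in>{1..time_steps d}. \<forall>i\<in>phase_cells d m.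
        (let M = lebesgue_on ({time_pt d (\<nu> - 1)<..<time_pt d \<nu>} \<times> phase_cell d m i) in
           0 \<le> ess_inf M (source d m) \<and>
           ess_inf M (source d m) \<le> ereal (source_val d m \<nu> i) \<and>
           ereal (source_val d m \<nu> i) \<le> Linf_norm M (source d m))) \<and>
     (\<forall>i\<in>cells d.
        (let M = lebesgue_on (cell d i) in
           0 \<le> ess_inf M (theta_init d) \<and>
           ess_inf M (theta_init d) \<le> ereal (init_val d i) \<and>
           ereal (init_val d i) \<le> Linf_norm M (theta_init d)))"

definition admissible :: "('i, 'b) scheme \<Rightarrow> bool" where
  "admissible d \<longleftrightarrow>
     admissible_domain d \<and> admissible_data d \<and> admissible_time d \<and>
     admissible_cells d \<and> admissible_faces d \<and> admissible_values d"


section \<open>Discrete radiation operators\<close>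

definition element :: "('i, 'b) scheme \<Rightarrow> 'b \<Rightarrow> R3 set" where
  "element d \<alpha> = (if \<alpha> = ph_index d then Gamma_ph d else face d \<alpha>)"

text \<open>Only used for two indices from \<open>I_Sigma\<close>, or for two indices from \<open>I_Omega\<close> extended by
  \<open>ph_index\<close>.\<close>

definition view_coeff :: "('i, 'b) scheme \<Rightarrow> 'b \<Rightarrow> 'b \<Rightarrow> real" where
  "view_coeff d \<alpha> \<beta> =
     view_factor (if \<alpha> \<in> I_Sigma d then phase_dom d Gas else open_cavity d)
       (element d \<alpha>) (element d \<beta>)"

definition rad_E :: "('i, 'b) scheme \<Rightarrow> ('b \<Rightarrow> real) \<Rightarrow> 'b \<Rightarrow> real" where
  "rad_E d u \<alpha> = stefan_boltzmann d * emissivity d (u \<alpha>) * u \<alpha> ^ 4 * area (face d \<alpha>)"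

definition rad_E_ph :: "('i, 'b) scheme \<Rightarrow> ('b \<Rightarrow> real) \<Rightarrow> 'b \<Rightarrow> real" where
  "rad_E_ph d u \<alpha> = stefan_boltzmann d * (1 - emissivity d (u \<alpha>)) * theta_ext d ^ 4
     * view_coeff d \<alpha> (ph_index d)"

definition rad_G :: "('i, 'b) scheme \<Rightarrow> ('b \<Rightarrow> real) \<Rightarrow> 'b \<Rightarrow> 'b \<Rightarrow> real" where
  "rad_G d u \<alpha> \<beta> =
     (if \<alpha> = \<beta> then area (face d \<alpha>) else 0) - (1 - emissivity d (u \<alpha>)) * view_coeff d \<alpha> \<beta>"

text \<open>Inverse of a square matrix indexed by a finite set \<open>J\<close>, extended by 0.\<close>

definition matrix_inv_on :: "'b set \<Rightarrow> ('b \<Rightarrow> 'b \<Rightarrow> real) \<Rightarrow> 'b \<Rightarrow> 'b \<Rightarrow> real" where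
  "matrix_inv_on J A = (THE B.
     (\<forall>\<alpha> \<beta>. \<alpha> \<notin> J \<or> \<beta> \<notin> J \<longrightarrow> B \<alpha> \<beta> = 0) \<and>
     (\<forall>\<alpha>\<in>J. \<forall>\<beta>\<in>J. (\<Sum>\<gamma>\<in>J. A \<alpha> \<gamma> * B \<gamma> \<beta>) = (if \<alpha> = \<beta> then 1 else 0)) \<and>
     (\<forall>\<alpha>\<in>J. \<forall>\<beta>\<in>J. (\<Sum>\<gamma>\<in>J. B \<alpha> \<gamma> * A \<gamma> \<beta>) = (if \<alpha> = \<beta> then 1 else 0)))"

definition R_Gamma :: "('i, 'b) scheme \<Rightarrow> ('b \<Rightarrow> real) \<Rightarrow> 'b \<Rightarrow> real" where
  "R_Gamma d u \<alpha> =
     (\<Sum>\<beta>\<in>I_Omega d. matrix_inv_on (I_Omega d) (rad_G d u) \<alpha> \<beta> * (rad_E d u \<beta> + rad_E_ph d u \<beta>))"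

definition R_Sigma :: "('i, 'b) scheme \<Rightarrow> ('b \<Rightarrow> real) \<Rightarrow> 'b \<Rightarrow> real" where
  "R_Sigma d u \<alpha> =
     (\<Sum>\<beta>\<in>I_Sigma d. matrix_inv_on (I_Sigma d) (rad_G d u) \<alpha> \<beta> * rad_E d u \<beta>)"

definition V_Gamma :: "('i, 'b) scheme \<Rightarrow> ('b \<Rightarrow> real) \<Rightarrow> 'b \<Rightarrow> real" where
  "V_Gamma d u \<alpha> =
     emissivity d (u \<alpha>) * (\<Sum>\<beta>\<in>I_Omega d. R_Gamma d u \<beta> * view_coeff d \<alpha> \<beta>)
     + stefan_boltzmann d * emissivity d (u \<alpha>) * theta_ext d ^ 4 * view_coeff d \<alpha> (ph_index d)"

definition V_Sigma :: "('i, 'b) scheme \<Rightarrow> ('b \<Rightarrow> real) \<Rightarrow> 'b \<Rightarrow> real" where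
  "V_Sigma d u \<alpha> = emissivity d (u \<alpha>) * (\<Sum>\<beta>\<in>I_Sigma d. R_Sigma d u \<beta> * view_coeff d \<alpha> \<beta>)"


section \<open>The scheme operator\<close>

definition scheme_op ::
  "('i, 'b) scheme \<Rightarrow> nat \<Rightarrow> 'i \<Rightarrow> ('i \<Rightarrow> real) \<Rightarrow> ('i \<Rightarrow> real) \<Rightarrow> real" where
  "scheme_op d \<nu> i v u =
     inverse (time_len d \<nu>) *
       (\<Sum>m\<in>{Solid, Gas}. (energy d m (u i) - energy d m (v i)) * vol (phase_cell d m i))
     - (\<Sum>m\<in>{Solid, Gas}. conductivity d m *
          (\<Sum>j\<in>phase_nb d m i. (u j - u i) / norm (node d i - node d j) *
             area (frontier (phase_cell d m i) \<inter> frontier (phase_cell d m j))))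
     + stefan_boltzmann d * emissivity d (u i) * u i ^ 4 *
         area (frontier (phase_cell d Solid i) \<inter> Gamma_Omega d)
     - (\<Sum>\<alpha>\<in>J_Omega d i. V_Gamma d (\<lambda>\<beta>\<in>I_Omega d. u (cell_of_Omega d \<beta>)) \<alpha>)
     + stefan_boltzmann d * emissivity d (u i) * (u i ^ 4 - theta_ext d ^ 4) *
         area (frontier (phase_cell d Solid i) \<inter> outer_rest d)
     + stefan_boltzmann d * emissivity d (u i) * u i ^ 4 * area (cell d i \<inter> interface d)
     - (\<Sum>\<alpha>\<in>J_Sigma d i. V_Sigma d (\<lambda>\<beta>\<in>I_Sigma d. u (cell_of_Sigma d \<beta>)) \<alpha>)
     - (\<Sum>m\<in>{Solid, Gas}. source_val d m \<nu> i * vol (phase_cell d m i))"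


section \<open>Bounds and constants\<close>

definition B_f :: "('i, 'b) scheme \<Rightarrow> nat \<Rightarrow> real" where
  "B_f d \<nu> = Max ((\<lambda>i. \<Sum>m\<in>{Solid, Gas}.
     source_val d m \<nu> i * (vol (phase_cell d m i) / vol (cell d i))) ` cells d)"

definition L_V_Gamma_Omega :: "('i, 'b) scheme \<Rightarrow> real" where
  "L_V_Gamma_Omega d = stefan_boltzmann d *
     Max ((\<lambda>i. area (frontier (phase_cell d Solid i) \<inter> Gamma_Omega d) / vol (cell d i)) ` cells d)"

definition L_V_rest :: "('i, 'b) scheme \<Rightarrow> real" where
  "L_V_rest d = stefan_boltzmann d *
     Max ((\<lambda>i. area (frontier (phase_cell d Solid i) \<inter> outer_rest d) / vol (cell d i)) ` cells d)"

definition L_V_Sigma :: "('i, 'b) scheme \<Rightarrow> real" where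
  "L_V_Sigma d = stefan_boltzmann d *
     Max ((\<lambda>i. area (cell d i \<inter> interface d) / vol (cell d i)) ` cells d)"

definition lower_bound :: "('i, 'b) scheme \<Rightarrow> ('i \<Rightarrow> real) \<Rightarrow> real" where
  "lower_bound d v = min (theta_ext d) (Min (v ` cells d))"

definition upper_bound :: "('i, 'b) scheme \<Rightarrow> nat \<Rightarrow> ('i \<Rightarrow> real) \<Rightarrow> real" where
  "upper_bound d \<nu> v =
     max (theta_ext d) (Max (v ` cells d) + time_len d \<nu> / energy_const d * B_f d \<nu>)"

definition eps_min :: "'z problem_scheme \<Rightarrow> real \<Rightarrow> real" where
  "eps_min p r = Inf (emissivity p ` {0..r})"

definition l_g1 :: "'z problem_scheme \<Rightarrow> real \<Rightarrow> real" where
  "l_g1 p r = 4 * neg_var (emissivity p) r * r ^ 3 + lip_const (emissivity p) r * r ^ 4"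

definition l_g2 :: "'z problem_scheme \<Rightarrow> real \<Rightarrow> real" where
  "l_g2 p r = 4 * inverse (eps_min p r) * r ^ 3
     + max (r ^ 4) (theta_ext p ^ 4) * lip_const (emissivity p) r * (2 * inverse (eps_min p r) + 1)"

definition l_g3 :: "'z problem_scheme \<Rightarrow> real \<Rightarrow> real" where
  "l_g3 p r = lip_const (emissivity p) r * theta_ext p ^ 4"

end

theory Submission
  imports Defs
begin

text \<open>Let \<open>u\<close> be a solution. At an index where \<open>u\<close> is maximal the conduction terms have a sign, and the
  discrete maximum principle for the radiosity equation bounds the absorbed radiation by what the
  element would emit if all temperatures were equal to that maximum; what is left is the bound on the
  energy. The minimum is treated in the same way. If the time step is small, then the Lipschitz
  constants of the radiation terms are dominated by the growth of the energy, which gives uniqueness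
  by comparing two solutions where they differ most. Existence follows from Banach's theorem for a
  nonlinear Jacobi iteration, whose scalar equations are solved by the intermediate value theorem
  between the two bounds.

  The maximum principle needs that the view factors of each boundary element sum up to its area. At a
  regular boundary point the map that sends a visible boundary point to the orthogonal projection of
  its direction onto the tangent plane is a bijection onto the unit disc up to null sets, and its
  Jacobian is \<open>pi\<close> times the kernel of the view factors, so the integral of the kernel is 1.\<close>

section \<open>Planes and the surface measure\<close>

text \<open>Only two facts pass from the geometry to the discrete equations. The row sums of the
  view factors say that at a common temperature an element receives exactly what a black element of
  its area would emit. The areas of the elements attached to a cell add up to the areas in the
  emission terms. The latter is not built in: emission is weighted with
  \<open>frontier (phase_cell d Solid i) \<inter> Gamma_Omega d\<close> and
  \<open>cell d i \<inter> interface d\<close>, absorption is summed over \<open>J_Omega\<close> and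
  \<open>J_Sigma\<close>. Both agree because two disjoint regular open sets with flat boundary fill
  a neighbourhood of almost every common boundary point, which is then interior to any regular open
  set containing both. Hence the domains are treated as regular open sets.

  In the smallness condition \<open>l_g1\<close> dominates the loss of emission caused by a falling
  emissivity, \<open>l_g2\<close> the change of the absorbed radiation, through the irradiation and
  through the absorptivity, and \<open>l_g3\<close> the change of the external term.\<close>

lemma plane_chart:
  assumes "P \<in> planes"
  shows dist_plane_chart: "dist (plane_chart P s) (plane_chart P t) = dist s t"
    and range_plane_chart: "range (plane_chart P) = P"
proof -
  have P: "affine P" "aff_dim P = 2"
    using assms by (auto simp: planes_def)
  then obtain a where a: "a \<in> P"
    by (metis aff_dim_empty all_not_in_conv neg_0_le_iff_le not_one_le_zero zero_le_numeral)
  \<comment> \<open>The translate of \<open>P\<close> through 0 is a two-dimensional subspace. A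
    linear isometry of \<open>real ^ 2\<close> onto it, shifted back by \<open>a\<close>, is a
    witness for the \<open>SOME\<close> in \<open>plane_chart\<close>.\<close>
  define T where "T = (\<lambda>x. x - a) ` P"
  have T: "subspace T"
    unfolding T_def using affine_diffs_subspace_subtract[OF P(1) a] .
  have "aff_dim P = int (dim T)"
    unfolding T_def using a by (intro aff_dim_eq_dim_subtract) (simp add: hull_inc)
  then have "dim (UNIV :: (real ^ 2) set) = dim T"
    using P by simp
  then obtain f :: "real ^ 2 \<Rightarrow> R3" where f: "linear f" "f ` UNIV = T" "\<And>x. norm (f x) = norm x"
    using isometries_subspaces[OF subspace_UNIV T] by (metis UNIV_I)
  have "dist (a + f s) (a + f t) = dist s t" for s t
    using f(3)[of "s - t"] by (simp add: dist_norm linear_diff[OF f(1)])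
  moreover have "range (\<lambda>x. a + f x) = P"
    using f(2) by (auto simp: T_def image_iff) (metis (no_types, lifting) add.commute add_diff_cancel diff_add_cancel image_iff rangeI)+
  ultimately have "\<exists>\<phi> :: real ^ 2 \<Rightarrow> R3. (\<forall>s t. dist (\<phi> s) (\<phi> t) = dist s t) \<and> range \<phi> = P"
    by (intro exI[of _ "\<lambda>x. a + f x"]) simp
  from someI_ex[OF this] show "dist (plane_chart P s) (plane_chart P t) = dist s t" "range (plane_chart P) = P"
    unfolding plane_chart_def by auto
qed

text \<open>After subtraction of the value at 0 the isometry preserves norms, hence inner products
  by polarization, hence is linear; \<open>e1\<close> and \<open>e2\<close> are the images of the
  coordinate vectors.\<close>

lemma plane_chart_affine:
  assumes "P \<in> planes"
  obtains e1 e2 where "norm e1 = 1" "norm e2 = 1" "e1 \<bullet> e2 = 0"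
    "\<And>q. plane_chart P q = plane_chart P 0 + q $ 1 *\<^sub>R e1 + q $ 2 *\<^sub>R e2"
proof -
  define f where "f q = plane_chart P q - plane_chart P 0" for q
  have iso: "dist (f s) (f t) = dist s t" for s t
    using dist_plane_chart[OF assms, of s t] by (simp add: f_def dist_norm)
  have n: "norm (f q) = norm q" for q
    using iso[of q 0] by (simp add: f_def)
  have inner: "f s \<bullet> f t = s \<bullet> t" for s t
    using iso[of s t] unfolding dist_norm dot_norm_neg n by simp
  have lin: "linear f"
  proof
    fix x y :: "real ^ 2" and r :: real
    have "(f (x + y) - f x - f y) \<bullet> (f (x + y) - f x - f y) = 0"
      by (simp add: inner_diff_left inner_diff_right inner inner_add_left inner_add_right)
    then have "f (x + y) - f x - f y = 0"
      using inner_eq_zero_iff by blast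
    then show "f (x + y) = f x + f y"
      by (simp add: algebra_simps)
    have "(f (r *\<^sub>R x) - r *\<^sub>R f x) \<bullet> (f (r *\<^sub>R x) - r *\<^sub>R f x) = 0"
      by (simp add: inner_diff_left inner_diff_right inner)
    then have "f (r *\<^sub>R x) - r *\<^sub>R f x = 0"
      using inner_eq_zero_iff by blast
    then show "f (r *\<^sub>R x) = r *\<^sub>R f x"
      by simp
  qed
  define e1 e2 where "e1 = f (axis 1 1)" and "e2 = f (axis 2 1)"
  have q: "q = q $ 1 *\<^sub>R axis 1 1 + q $ 2 *\<^sub>R axis 2 (1::real)" for q :: "real ^ 2"
    by (simp add: vec_eq_iff forall_2 axis_def)
  have "f q = q $ 1 *\<^sub>R e1 + q $ 2 *\<^sub>R e2" for q
    unfolding e1_def e2_def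
    by (subst q) (simp add: linear_add[OF lin] linear_scale[OF lin])
  then have "plane_chart P q = plane_chart P 0 + q $ 1 *\<^sub>R e1 + q $ 2 *\<^sub>R e2" for q
    unfolding f_def by (metis add.assoc add_diff_cancel_left' diff_add_cancel add.commute)
  moreover have "norm e1 = 1" "norm e2 = 1" "e1 \<bullet> e2 = 0"
    unfolding e1_def e2_def n inner by (simp_all add: norm_eq_sqrt_inner inner_axis_axis)
  ultimately show ?thesis using that by blast
qed

lemma plane_chart_continuous:
  assumes "P \<in> planes"
  shows "continuous_on S (plane_chart P)"
proof -
  obtain e1 e2 where e: "\<And>q. plane_chart P q = plane_chart P 0 + q $ 1 *\<^sub>R e1 + q $ 2 *\<^sub>R e2"
    using plane_chart_affine[OF assms] by metis
  have "continuous_on S (\<lambda>q. plane_chart P 0 + q $ 1 *\<^sub>R e1 + q $ 2 *\<^sub>R e2)"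
    by (intro continuous_intros)
  then show ?thesis
    using e by (metis (no_types, lifting) continuous_on_cong)
qed

lemma plane_chart_measurable:
  "P \<in> planes \<Longrightarrow> plane_chart P \<in> borel_measurable borel"
  by (simp add: borel_measurable_continuous_onI plane_chart_continuous)

lemma inj_plane_chart: "P \<in> planes \<Longrightarrow> inj (plane_chart P)"
  by (metis dist_plane_chart dist_eq_0_iff injI)

lemma plane_chart_in: "P \<in> planes \<Longrightarrow> plane_chart P q \<in> P"
  using range_plane_chart by blast

lemma sets_plane_measure [simp]: "sets (plane_measure P) = sets borel"
  by (simp add: plane_measure_def)

lemma emeasure_plane_measure:
  assumes "P \<in> planes" "A \<in> sets borel"
  shows "emeasure (plane_measure P) A = emeasure lborel (plane_chart P -` A)"
  using assms plane_chart_measurable[OF assms(1)]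
  by (simp add: plane_measure_def emeasure_distr)

lemma sets_vimage_plane_chart:
  "P \<in> planes \<Longrightarrow> A \<in> sets borel \<Longrightarrow> plane_chart P -` A \<in> sets borel"
  using measurable_sets_borel[OF plane_chart_measurable] by simp

lemma planes_closed: "P \<in> planes \<Longrightarrow> closed P"
  by (simp add: planes_def affine_closed)

lemma planes_borel [measurable]: "P \<in> planes \<Longrightarrow> P \<in> sets borel"
  by (simp add: planes_closed)

lemma convex_vimage_plane_chart:
  assumes "P \<in> planes" "convex C"
  shows "convex (plane_chart P -` C)"
proof (rule convexI)
  fix x y u v assume *: "x \<in> plane_chart P -` C" "y \<in> plane_chart P -` C" "0 \<le> u" "0 \<le> v" "u + v = (1::real)"
  obtain e1 e2 where e: "\<And>q. plane_chart P q = plane_chart P 0 + q $ 1 *\<^sub>R e1 + q $ 2 *\<^sub>R e2"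
    using plane_chart_affine[OF assms(1)] by metis
  have "plane_chart P (u *\<^sub>R x + v *\<^sub>R y) =
      (u + v) *\<^sub>R plane_chart P 0 + (u *\<^sub>R x + v *\<^sub>R y) $ 1 *\<^sub>R e1 + (u *\<^sub>R x + v *\<^sub>R y) $ 2 *\<^sub>R e2"
    using e[of "u *\<^sub>R x + v *\<^sub>R y"] *(5) by simp
  also have "\<dots> = u *\<^sub>R (plane_chart P 0 + x $ 1 *\<^sub>R e1 + x $ 2 *\<^sub>R e2)
      + v *\<^sub>R (plane_chart P 0 + y $ 1 *\<^sub>R e1 + y $ 2 *\<^sub>R e2)"
    by (simp add: algebra_simps)
  also have "\<dots> = u *\<^sub>R plane_chart P x + v *\<^sub>R plane_chart P y"
    using e by metis
  finally show "u *\<^sub>R x + v *\<^sub>R y \<in> plane_chart P -` C"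
    using * convexD[OF assms(2)] by simp
qed

lemma emeasure_lborel_eq_0_if_negligible:
  assumes "negligible S" "S \<in> sets borel"
  shows "emeasure lborel S = 0"
  using assms negligible_iff_null_sets null_sets_completion_iff[of S lborel] by auto

text \<open>The preimage of \<open>Q\<close> in the chart is convex, so it is negligible unless it
  has interior. In that case a disc of \<open>P\<close>, hence all of \<open>P\<close>, lies in the
  affine set \<open>Q\<close>, and equal dimension forces \<open>P = Q\<close>.\<close>

lemma planes_Int_negligible:
  assumes P: "P \<in> planes" and Q: "Q \<in> planes" and "P \<noteq> Q"
  shows "negligible (plane_chart P -` Q)"
proof -
  have cvx: "convex (plane_chart P -` Q)"
    using Q by (intro convex_vimage_plane_chart P) (simp add: planes_def affine_imp_convex)
  have "interior (plane_chart P -` Q) = {}"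
  proof (rule ccontr)
    assume "interior (plane_chart P -` Q) \<noteq> {}"
    then obtain x r where xr: "r > 0" "ball x r \<subseteq> plane_chart P -` Q"
      by (metis ex_in_conv mem_interior)
    have "y \<in> plane_chart P -` Q" for y
    proof (cases "y = x")
      case True
      then show ?thesis using xr centre_in_ball by blast
    next
      case False
      \<comment> \<open>The point \<open>z\<close> on the way from \<open>x\<close> to
        \<open>y\<close> is still in the ball; \<open>y\<close> is an affine combination of
        \<open>x\<close> and \<open>z\<close>, and \<open>Q\<close> is affine.\<close>
      define t where "t = r / 2 / norm (y - x)"
      have t: "t \<noteq> 0" using False xr by (simp add: t_def)
      define z where "z = x + t *\<^sub>R (y - x)"
      have z: "z \<in> ball x r"
        using False xr by (simp add: z_def t_def dist_norm)
      obtain e1 e2 where e: "\<And>q. plane_chart P q = plane_chart P 0 + q $ 1 *\<^sub>R e1 + q $ 2 *\<^sub>R e2"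
        using plane_chart_affine[OF P] by metis
      have "plane_chart P z = plane_chart P x + t *\<^sub>R (plane_chart P y - plane_chart P x)"
        unfolding z_def e[of "x + t *\<^sub>R (y - x)"] e[of y] e[of x] by (simp add: algebra_simps)
      then have "(1/t) *\<^sub>R (plane_chart P z - plane_chart P x) = plane_chart P y - plane_chart P x"
        using t by simp
      then have "plane_chart P y = (1 - 1/t) *\<^sub>R plane_chart P x + (1/t) *\<^sub>R plane_chart P z"
        by (simp add: algebra_simps)
      moreover have "plane_chart P x \<in> Q" "plane_chart P z \<in> Q"
        using subsetD[OF xr(2), of x] subsetD[OF xr(2) z] xr(1) by auto
      moreover have "affine Q" "(1 - 1/t) + 1/t = 1"
        using Q by (auto simp: planes_def)
      ultimately have "plane_chart P y \<in> Q"
        using mem_affine[of Q "plane_chart P x" "plane_chart P z" "1 - 1/t" "1/t"] by simp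
      then show ?thesis by simp
    qed
    then have "range (plane_chart P) \<subseteq> Q"
      by blast
    then have "P \<subseteq> Q"
      using range_plane_chart[OF P] by simp
    moreover have "P \<noteq> {}"
      using plane_chart_in[OF P] by auto
    ultimately show False
      using affine_dim_equal[of P Q] P Q \<open>P \<noteq> Q\<close> by (auto simp: planes_def)
  qed
  then show ?thesis
    using negligible_convex_interior[OF cvx] by simp
qed

text \<open>Off-diagonal terms vanish, so for a set inside one plane the sum over all planes that
  defines \<open>surface_measure\<close> has a single term.\<close>

lemma plane_measure_other:
  assumes P: "P \<in> planes" and Q: "Q \<in> planes" and "P \<noteq> Q" "A \<subseteq> Q" "A \<in> sets borel"
  shows "emeasure (plane_measure P) A = 0"
proof -
  have "plane_chart P -` A \<subseteq> plane_chart P -` Q"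
    using assms by auto
  then have "negligible (plane_chart P -` A)"
    using planes_Int_negligible[OF P Q] assms(3) negligible_subset by blast
  then show ?thesis
    by (simp add: P assms(5) emeasure_lborel_eq_0_if_negligible emeasure_plane_measure
        sets_vimage_plane_chart)
qed

section \<open>The surface measure on sets lying in planes\<close>

lemma sets_surface_measure [simp, measurable_cong]: "sets surface_measure = sets borel"
  unfolding surface_measure_def using sets.sigma_sets_eq[of borel] by (simp add: sets_measure_of_conv)

lemma space_surface_measure [simp]: "space surface_measure = UNIV"
  unfolding surface_measure_def by (simp add: space_measure_of_conv)

text \<open>\<open>measure_of\<close> returns the given set function only if it is countably
  additive; this follows by exchanging the series with the integral over
  \<open>count_space planes\<close>.\<close>

lemma emeasure_surface_measure:
  assumes "A \<in> sets borel"
  shows "emeasure surface_measure A = (\<integral>\<^sup>+ P. emeasure (plane_measure P) A \<partial>count_space planes)"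
proof (rule emeasure_measure_of[OF surface_measure_def])
  show "countably_additive (sets surface_measure)
     (\<lambda>A. \<integral>\<^sup>+ P. emeasure (plane_measure P) A \<partial>count_space planes)"
  proof (rule countably_additiveI)
    fix A :: "nat \<Rightarrow> R3 set"
    assume A: "range A \<subseteq> sets surface_measure" "disjoint_family A"
    have "(\<Sum>i. \<integral>\<^sup>+ P. emeasure (plane_measure P) (A i) \<partial>count_space planes)
        = (\<integral>\<^sup>+ P. (\<Sum>i. emeasure (plane_measure P) (A i)) \<partial>count_space planes)"
      by (intro nn_integral_suminf[symmetric]) simp
    also have "\<dots> = (\<integral>\<^sup>+ P. emeasure (plane_measure P) (\<Union> (range A)) \<partial>count_space planes)"
      using A by (intro nn_integral_cong suminf_emeasure) auto
    finally show "(\<Sum>i. \<integral>\<^sup>+ P. emeasure (plane_measure P) (A i) \<partial>count_space planes)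
        = (\<integral>\<^sup>+ P. emeasure (plane_measure P) (\<Union> (range A)) \<partial>count_space planes)" .
  qed
qed (use assms in \<open>auto simp: positive_def\<close>)

lemma emeasure_surface_plane:
  assumes P: "P \<in> planes" and "A \<subseteq> P" "A \<in> sets borel"
  shows "emeasure surface_measure A = emeasure lborel (plane_chart P -` A)"
proof -
  have "emeasure surface_measure A = (\<integral>\<^sup>+ Q. emeasure (plane_measure P) A * indicator {P} Q \<partial>count_space planes)"
    unfolding emeasure_surface_measure[OF assms(3)] using plane_measure_other[OF _ P] assms(2,3)
    by (intro nn_integral_cong) (auto split: split_indicator)
  also have "\<dots> = emeasure (plane_measure P) A * emeasure (count_space planes) {P}"
    using P by (intro nn_integral_cmult_indicator) simp
  also have "\<dots> = emeasure lborel (plane_chart P -` A)"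
    using P assms by (simp add: emeasure_plane_measure)
  finally show ?thesis .
qed

lemma surface_null_if_negligible:
  assumes "P \<in> planes" "A \<subseteq> P" "A \<in> sets borel" "negligible (plane_chart P -` A)"
  shows "A \<in> null_sets surface_measure"
  using assms
  by (simp add: null_sets_def emeasure_surface_plane emeasure_lborel_eq_0_if_negligible sets_vimage_plane_chart)

lemma planes_Int_null:
  assumes "P \<in> planes" "Q \<in> planes" "P \<noteq> Q"
  shows "P \<inter> Q \<in> null_sets surface_measure"
proof (rule surface_null_if_negligible[OF assms(1)])
  show "negligible (plane_chart P -` (P \<inter> Q))"
    using planes_Int_negligible[OF assms] negligible_subset by (metis Int_lower2 vimage_mono)
qed (use assms planes_borel in auto)

text \<open>\<open>plane_measure P\<close> is the surface measure with the indicator of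
  \<open>P\<close> as density, so integrals over \<open>P\<close> become integrals over
  \<open>real ^ 2\<close> through the chart.\<close>

lemma nn_integral_surface_plane:
  assumes P: "P \<in> planes" and f: "f \<in> borel_measurable borel"
  shows "(\<integral>\<^sup>+ y. f y * indicator P y \<partial>surface_measure) = (\<integral>\<^sup>+ q. f (plane_chart P q) \<partial>lborel)"
proof -
  have eq: "plane_measure P = density surface_measure (indicator P)"
  proof (rule measure_eqI)
    fix A assume "A \<in> sets (plane_measure P)"
    then have A: "A \<in> sets borel" by simp
    have "emeasure (density surface_measure (indicator P)) A = emeasure surface_measure (P \<inter> A)"
      using A P by (subst emeasure_density) (auto simp: nn_integral_indicator[symmetric] indicator_inter_arith
        simp del: nn_integral_indicator)
    also have "\<dots> = emeasure lborel (plane_chart P -` (P \<inter> A))"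
      using A P by (intro emeasure_surface_plane) auto
    also have "plane_chart P -` (P \<inter> A) = plane_chart P -` A"
      using plane_chart_in[OF P] by auto
    finally show "emeasure (plane_measure P) A = emeasure (density surface_measure (indicator P)) A"
      using A P by (simp add: emeasure_plane_measure)
  qed simp
  have "(\<integral>\<^sup>+ q. f (plane_chart P q) \<partial>lborel) = (\<integral>\<^sup>+ y. f y \<partial>plane_measure P)"
    unfolding plane_measure_def using plane_chart_measurable[OF P] f
    by (intro nn_integral_distr[symmetric]) auto
  also have "\<dots> = (\<integral>\<^sup>+ y. f y * indicator P y \<partial>surface_measure)"
    unfolding eq using f P by (subst nn_integral_density) (auto simp: mult.commute)
  finally show ?thesis ..
qed

text \<open>Charts are isometries, so a bounded set has a bounded preimage in each of the finitely
  many planes. This finiteness is what later permits Tonelli's theorem on pieces of a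
  boundary.\<close>

lemma surface_bounded_finite:
  assumes "finite H" "H \<subseteq> planes" "A \<subseteq> \<Union>H" "bounded A" "A \<in> sets borel"
  shows "emeasure surface_measure A < \<infinity>"
proof -
  have fin: "emeasure surface_measure (A \<inter> P) < \<infinity>" if "P \<in> H" for P
  proof -
    have P: "P \<in> planes" using assms that by auto
    have "bounded (plane_chart P -` (A \<inter> P))"
    proof -
      obtain B where B: "\<And>x. x \<in> A \<Longrightarrow> dist (plane_chart P 0) x \<le> B"
        using \<open>bounded A\<close> bounded_any_center[of A] by blast
      have "dist 0 q \<le> B" if "q \<in> plane_chart P -` (A \<inter> P)" for q
        using B[of "plane_chart P q"] that dist_plane_chart[OF P, of 0 q] by auto
      then show ?thesis unfolding bounded_def by blast
    qed
    then have "emeasure lborel (plane_chart P -` (A \<inter> P)) < \<infinity>"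
      by (rule emeasure_bounded_finite)
    then show ?thesis
      using P assms emeasure_surface_plane[of P "A \<inter> P"] by auto
  qed
  have "A = (\<Union>P\<in>H. A \<inter> P)" using assms by auto
  then have "emeasure surface_measure A \<le> (\<Sum>P\<in>H. emeasure surface_measure (A \<inter> P))"
    using assms planes_borel
    by (metis (mono_tags) emeasure_subadditive_finite[of H "\<lambda>P. A \<inter> P" surface_measure]
        image_subsetI sets.Int sets_surface_measure subsetD)
  also have "\<dots> < \<infinity>"
    using fin assms(1) by simp
  finally show ?thesis .
qed

section \<open>Regular open sets with flat boundary\<close>

text \<open>Weaker than \<open>polyhedral_in UNIV\<close>, but stable under intersection and under
  forming the open cavity without any polytope decomposition of the result. The equation
  \<open>interior (closure D) = D\<close> excludes slits.\<close>

definition flat_domain :: "R3 set \<Rightarrow> bool" where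
  "flat_domain D \<longleftrightarrow> open D \<and> bounded D \<and> interior (closure D) = D \<and>
     (\<exists>H. finite H \<and> H \<subseteq> planes \<and> frontier D \<subseteq> \<Union>H)"

lemma hyperplane_in_planes:
  fixes a :: R3
  assumes "a \<noteq> 0"
  shows "{x. a \<bullet> x = b} \<in> planes"
  using assms by (simp add: planes_def affine_hyperplane aff_dim_hyperplane)

lemma plane_as_hyperplane:
  assumes "P \<in> planes" "x \<in> P"
  obtains n where "norm n = 1" "P = {y. n \<bullet> (y - x) = 0}"
proof -
  have hull: "affine hull P = P" and dim: "aff_dim P = int (DIM(R3) - 1)"
    using assms by (auto simp: planes_def affine_hull_eq)
  from dim have "\<exists>a b. a \<noteq> 0 \<and> affine hull P = {x. a \<bullet> x = b}"
    by (rule aff_dim_eq_hyperplane[THEN iffD1])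
  then have "\<exists>a b. a \<noteq> 0 \<and> P = {x. a \<bullet> x = b}"
    unfolding hull .
  then obtain a b where ab: "a \<noteq> 0" "P = {x. a \<bullet> x = b}"
    by metis
  have "P = {y. (a /\<^sub>R norm a) \<bullet> (y - x) = 0}"
    using ab assms(2) by (auto simp: inner_diff_right)
  moreover have "norm (a /\<^sub>R norm a) = 1"
    using ab by simp
  ultimately show ?thesis using that by blast
qed

text \<open>A point of a finite intersection of closed half spaces that is interior to all of them
  is interior to the intersection; a frontier point therefore lies on one of the bounding
  planes.\<close>

lemma polyhedron_frontier_planes:
  fixes S :: "R3 set"
  assumes "polyhedron S"
  shows "\<exists>H. finite H \<and> H \<subseteq> planes \<and> frontier S \<subseteq> \<Union>H"
proof -
  obtain F where F: "finite F" "S = \<Inter>F" "\<And>h. h \<in> F \<Longrightarrow> \<exists>a b. a \<noteq> 0 \<and> h = {x. a \<bullet> x \<le> b}"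
    using assms unfolding polyhedron_def by metis
  have fr: "frontier h \<in> planes \<and> closed h" if "h \<in> F" for h
    using F(3)[OF that] by (auto simp: frontier_halfspace_le hyperplane_in_planes closed_halfspace_le)
  have "frontier S \<subseteq> \<Union> (frontier ` F)"
  proof
    fix x assume x: "x \<in> frontier S"
    have "closed S" using fr F(2) by (metis closed_Inter)
    then have xS: "x \<in> h" if "h \<in> F" for h
      using x that F(2) frontier_subset_closed by blast
    have "x \<notin> \<Inter> (interior ` F)"
    proof
      assume "x \<in> \<Inter> (interior ` F)"
      moreover have "open (\<Inter> (interior ` F))" using F(1) by (intro open_INT) auto
      moreover have "\<Inter> (interior ` F) \<subseteq> S" unfolding F(2) using interior_subset by blast
      ultimately have "x \<in> interior S" by (meson interiorI)
      then show False using x by (simp add: frontier_def)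
    qed
    then obtain h where "h \<in> F" "x \<notin> interior h" by blast
    then have "x \<in> frontier h" using xS[of h] fr[of h] by (simp add: frontier_def)
    then show "x \<in> \<Union> (frontier ` F)" using \<open>h \<in> F\<close> by blast
  qed
  then show ?thesis using F(1) fr by (intro exI[of _ "frontier ` F"]) auto
qed

lemma frontier_Union_planes:
  fixes \<C> :: "R3 set set"
  assumes "finite \<C>" "\<And>C. C \<in> \<C> \<Longrightarrow> \<exists>H. finite H \<and> H \<subseteq> planes \<and> frontier C \<subseteq> \<Union>H"
  shows "\<exists>H. finite H \<and> H \<subseteq> planes \<and> frontier (\<Union>\<C>) \<subseteq> \<Union>H"
  using assms
proof (induction \<C>)
  case empty
  then show ?case by (intro exI[of _ "{}"]) simp
next
  case (insert C \<C>)
  obtain H1 where H1: "finite H1" "H1 \<subseteq> planes" "frontier C \<subseteq> \<Union>H1"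
    using insert.prems[OF insertI1] by (elim exE conjE)
  obtain H2 where H2: "finite H2" "H2 \<subseteq> planes" "frontier (\<Union>\<C>) \<subseteq> \<Union>H2"
  proof -
    have "\<exists>H. finite H \<and> H \<subseteq> planes \<and> frontier (\<Union>\<C>) \<subseteq> \<Union>H"
      by (rule insert.IH) (rule insert.prems, simp)
    then show thesis using that by (elim exE conjE)
  qed
  have "frontier (\<Union> (insert C \<C>)) \<subseteq> frontier C \<union> frontier (\<Union>\<C>)"
    using frontier_Un_subset[of C "\<Union>\<C>"] by simp
  also have "\<dots> \<subseteq> \<Union>(H1 \<union> H2)" using H1 H2 by blast
  finally show ?case using H1 H2 by (intro exI[of _ "H1 \<union> H2"]) simp
qed

lemma flat_domain_interior:
  assumes "closed K" "bounded K" "\<exists>H. finite H \<and> H \<subseteq> planes \<and> frontier K \<subseteq> \<Union>H"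
  shows "flat_domain (interior K)"
proof -
  have "closure (interior K) \<subseteq> K"
    using assms(1) closure_minimal interior_subset by blast
  then have "interior (closure (interior K)) = interior K"
    by (metis closure_subset interior_interior interior_mono subset_antisym)
  moreover have "frontier (interior K) \<subseteq> frontier K"
    by (rule frontier_interior_subset)
  ultimately show ?thesis
    using assms bounded_interior unfolding flat_domain_def by (meson open_interior subset_trans)
qed

lemma flat_domain_polyhedral:
  assumes "polyhedral_in UNIV D"
  shows "flat_domain D"
proof -
  obtain \<C> where C: "finite \<C>" "\<And>C. C \<in> \<C> \<Longrightarrow> polytope C" "D = interior (\<Union>\<C>)"
    using assms unfolding polyhedral_in_def by (auto simp: interior_of_def interior_def)
  show ?thesis unfolding C(3)
  proof (rule flat_domain_interior)
    show "closed (\<Union>\<C>)" using C by (simp add: closed_Union polytope_imp_closed)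
    show "bounded (\<Union>\<C>)" using C by (simp add: bounded_Union polytope_imp_bounded)
    show "\<exists>H. finite H \<and> H \<subseteq> planes \<and> frontier (\<Union>\<C>) \<subseteq> \<Union>H"
      using C by (intro frontier_Union_planes polyhedron_frontier_planes polytope_imp_polyhedron) auto
  qed
qed

lemma flat_domain_Int:
  assumes "flat_domain D" "flat_domain E"
  shows "flat_domain (D \<inter> E)"
proof -
  obtain H1 where H1: "finite H1" "H1 \<subseteq> planes" "frontier D \<subseteq> \<Union>H1"
    using assms unfolding flat_domain_def by blast
  obtain H2 where H2: "finite H2" "H2 \<subseteq> planes" "frontier E \<subseteq> \<Union>H2"
    using assms unfolding flat_domain_def by blast
  have "interior (closure (D \<inter> E)) \<subseteq> interior (closure D) \<inter> interior (closure E)"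
    by (simp add: closure_mono interior_mono)
  then have "interior (closure (D \<inter> E)) \<subseteq> D \<inter> E"
    using assms by (simp add: flat_domain_def)
  moreover have "open (D \<inter> E)" "bounded (D \<inter> E)"
    using assms by (auto simp: flat_domain_def)
  moreover have "D \<inter> E \<subseteq> interior (closure (D \<inter> E))"
    using \<open>open (D \<inter> E)\<close> by (simp add: closure_subset interior_maximal)
  moreover have "frontier (D \<inter> E) \<subseteq> \<Union>(H1 \<union> H2)"
    using frontier_Int_subset[of D E] H1 H2 by blast
  ultimately show ?thesis
    unfolding flat_domain_def using H1 H2 by (intro conjI exI[of _ "H1 \<union> H2"]) auto
qed

text \<open>Polytopes without interior are negligible and cannot cover an open set; a convex set
  with interior lies in the closure of its interior. Thus the closure of a polyhedral domain is
  again a finite union of polytopes, and its convex hull is a polytope.\<close>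

lemma closure_interior_Union_polytopes:
  fixes \<C> :: "'a::euclidean_space set set"
  assumes "finite \<C>" "\<And>C. C \<in> \<C> \<Longrightarrow> polytope C"
  shows "closure (interior (\<Union>\<C>)) = \<Union>{C \<in> \<C>. interior C \<noteq> {}}"
proof
  let ?U = "\<Union>{C \<in> \<C>. interior C \<noteq> {}}"
  have cl: "closed ?U" using assms by (intro closed_Union) (auto simp: polytope_imp_closed)
  have "interior (\<Union>\<C>) \<subseteq> ?U"
  proof (rule ccontr)
    assume "\<not> interior (\<Union>\<C>) \<subseteq> ?U"
    then have ne: "interior (\<Union>\<C>) - ?U \<noteq> {}" by (simp add: Diff_eq_empty_iff)
    have "open (interior (\<Union>\<C>) - ?U)" using cl by (intro open_Diff) auto
    from open_not_negligible[OF this ne] have "\<not> negligible (interior (\<Union>\<C>) - ?U)" .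
    moreover have "negligible (\<Union>{C \<in> \<C>. interior C = {}})"
      using assms by (intro negligible_Union) (auto simp: negligible_convex_interior polytope_imp_convex)
    moreover have "interior (\<Union>\<C>) - ?U \<subseteq> \<Union>{C \<in> \<C>. interior C = {}}"
      using interior_subset[of "\<Union>\<C>"] by blast
    ultimately show False by (meson negligible_subset)
  qed
  then show "closure (interior (\<Union>\<C>)) \<subseteq> ?U" using cl closure_minimal by blast
  show "?U \<subseteq> closure (interior (\<Union>\<C>))"
  proof
    fix x assume "x \<in> ?U"
    then obtain C where C: "C \<in> \<C>" "interior C \<noteq> {}" "x \<in> C" by blast
    then have "x \<in> closure (interior C)"
      using assms(2)[OF C(1)] convex_closure_interior[of C] closure_subset polytope_imp_convex by blast
    then show "x \<in> closure (interior (\<Union>\<C>))"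
      using C(1) by (meson Union_upper closure_mono interior_mono subsetD)
  qed
qed

lemma polytope_convex_hull_Union:
  assumes "finite \<C>" "\<And>C. C \<in> \<C> \<Longrightarrow> polytope C"
  shows "polytope (convex hull (\<Union>\<C>))"
proof -
  obtain V where V: "\<And>C. C \<in> \<C> \<Longrightarrow> finite (V C) \<and> C = convex hull (V C)"
    using assms(2) unfolding polytope_def by metis
  have "convex hull (\<Union>\<C>) = convex hull (\<Union> (V ` \<C>))"
  proof
    have "C \<subseteq> convex hull (\<Union> (V ` \<C>))" if "C \<in> \<C>" for C
      using V[OF that] that by (metis UN_upper hull_mono)
    then show "convex hull (\<Union>\<C>) \<subseteq> convex hull (\<Union> (V ` \<C>))"
      by (intro hull_minimal) auto
    have "V C \<subseteq> \<Union>\<C>" if "C \<in> \<C>" for C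
      using V[OF that] that hull_subset[of "V C" convex] by blast
    then show "convex hull (\<Union> (V ` \<C>)) \<subseteq> convex hull (\<Union>\<C>)"
      by (intro hull_mono) blast
  qed
  moreover have "finite (\<Union> (V ` \<C>))" using assms(1) V by blast
  ultimately show ?thesis unfolding polytope_def by blast
qed

lemma polyhedral_convex_hull_polytope:
  assumes "polyhedral_in UNIV D"
  shows "polytope (convex hull (closure D))"
proof -
  obtain \<C> where C: "finite \<C>" "\<And>C. C \<in> \<C> \<Longrightarrow> polytope C" "D = interior (\<Union>\<C>)"
    using assms unfolding polyhedral_in_def by (auto simp: interior_of_def interior_def)
  have "closure D = \<Union>{C \<in> \<C>. interior C \<noteq> {}}"
    unfolding C(3) using C(1,2) by (rule closure_interior_Union_polytopes)
  then show ?thesis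
    using C by (auto intro!: polytope_convex_hull_Union)
qed

text \<open>The case needed is the open cavity. Regularity of \<open>D\<close> gives
  \<open>closure (- closure D) = - D\<close>, whose interior is \<open>- closure D\<close>, so the
  exterior is regular too, and regularity passes to intersections.\<close>

lemma flat_domain_exterior_part:
  assumes D: "flat_domain D" and K: "polytope K"
  shows "flat_domain (interior K - closure D)"
proof -
  let ?O = "interior K - closure D"
  have "flat_domain (interior K)"
    using K polyhedron_frontier_planes polytope_imp_polyhedron
    by (intro flat_domain_interior) (auto simp: polytope_imp_closed polytope_imp_bounded)
  then obtain H1 where H1: "finite H1" "H1 \<subseteq> planes" "frontier (interior K) \<subseteq> \<Union>H1"
    and reg: "interior (closure (interior K)) = interior K"
    unfolding flat_domain_def by blast
  obtain H2 where H2: "finite H2" "H2 \<subseteq> planes" "frontier D \<subseteq> \<Union>H2"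
    using D unfolding flat_domain_def by blast
  have eq: "?O = interior K \<inter> - closure D" by blast
  have open_O: "open ?O" by (intro open_Diff) auto
  have "interior (closure ?O) \<subseteq> interior (closure (interior K)) \<inter> interior (closure (- closure D))"
    unfolding eq by (simp add: closure_mono interior_mono)
  also have "interior (closure (- closure D)) = - closure D"
    using D by (simp add: closure_complement interior_complement flat_domain_def)
  finally have "interior (closure ?O) \<subseteq> ?O" using reg by blast
  moreover have "?O \<subseteq> interior (closure ?O)"
    using open_O by (simp add: closure_subset interior_maximal)
  moreover have "bounded ?O"
    using K by (meson Diff_subset bounded_interior bounded_subset polytope_imp_bounded)
  moreover have "frontier ?O \<subseteq> \<Union>(H1 \<union> H2)"
  proof -
    have "frontier (closure D) \<subseteq> frontier D"
      unfolding frontier_def using interior_mono[OF closure_subset[of D]] by auto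
    then have "frontier (- closure D) \<subseteq> \<Union>H2"
      using H2(3) by simp
    moreover have "frontier ?O \<subseteq> frontier (interior K) \<union> frontier (- closure D)"
      unfolding eq by (rule frontier_Int_subset)
    ultimately show ?thesis using H1(3) by (simp only: Union_Un_distrib) (meson Un_mono subset_trans)
  qed
  ultimately show ?thesis
    unfolding flat_domain_def using H1 H2 open_O by (intro conjI exI[of _ "H1 \<union> H2"]) auto
qed

section \<open>Outer normals and half balls\<close>

lemma outer_unit_normal_unique:
  assumes "outer_unit_normal D x n" "outer_unit_normal D x n'"
  shows "n = n'"
proof (rule ccontr)
  assume ne: "n \<noteq> n'"
  obtain r where r: "norm n = 1" "r > 0" "D \<inter> ball x r = {y \<in> ball x r. n \<bullet> (y - x) < 0}"
    using assms unfolding outer_unit_normal_def by auto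
  obtain r' where r': "norm n' = 1" "r' > 0" "D \<inter> ball x r' = {y \<in> ball x r'. n' \<bullet> (y - x) < 0}"
    using assms unfolding outer_unit_normal_def by auto
  have "n \<bullet> n' < 1"
  proof -
    have "n \<bullet> n = 1" "n' \<bullet> n' = 1" using r r' by (simp_all add: norm_eq_1)
    moreover have "0 < (n - n') \<bullet> (n - n')" using ne by simp
    ultimately show ?thesis by (simp add: inner_diff_left inner_diff_right inner_commute)
  qed
  \<comment> \<open>A short step from \<open>x\<close> in the direction \<open>n' - n\<close> stays
    in both balls. Since \<open>n \<bullet> n' < 1\<close>, it enters \<open>D\<close> according to
    \<open>n\<close> and leaves it according to \<open>n'\<close>.\<close>
  define t where "t = min r r' / (2 * norm (n' - n))"
  have t: "t > 0" "t * norm (n' - n) < r" "t * norm (n' - n) < r'"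
    using ne r(2) r'(2) by (auto simp: t_def min_def divide_simps)
  define y where "y = x + t *\<^sub>R (n' - n)"
  have "y \<in> ball x r" "y \<in> ball x r'"
    using t by (simp_all add: y_def dist_norm)
  moreover have "n \<bullet> (y - x) < 0" "\<not> n' \<bullet> (y - x) < 0"
    using t \<open>n \<bullet> n' < 1\<close> r(1) r'(1)
    by (auto simp: y_def inner_diff_right norm_eq_1 inner_commute mult_less_0_iff)
  ultimately show False using r(3) r'(3) by blast
qed

lemma reg_frontierI:
  "x \<in> frontier D \<Longrightarrow> outer_unit_normal D x n \<Longrightarrow> x \<in> reg_frontier D"
  unfolding reg_frontier_def using outer_unit_normal_unique by blast

lemma reg_frontierE:
  assumes "x \<in> reg_frontier D"
  obtains n where "outer_unit_normal D x n" "inner_normal D x = - n" "norm n = 1"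
proof -
  obtain n where n: "outer_unit_normal D x n"
    using assms unfolding reg_frontier_def by blast
  then have "(THE n. outer_unit_normal D x n) = n"
    using outer_unit_normal_unique by blast
  with n assms that show ?thesis
    by (auto simp: inner_normal_def outer_unit_normal_def)
qed

text \<open>In a small ball the frontier lies in the single plane \<open>P\<close>, so each open
  half ball, being connected, is inside \<open>D\<close> or disjoint from it. If both were inside,
  \<open>x\<close> would be interior to \<open>closure D\<close>, hence in \<open>D\<close>; if
  neither, \<open>x\<close> would not be in \<open>closure D\<close>. So exactly one is
  inside.\<close>

lemma flat_domain_half_ball:
  assumes D: "flat_domain D" and H: "finite H" "H \<subseteq> planes" "frontier D \<subseteq> \<Union>H"
    and x: "x \<in> frontier D" "P \<in> H" "x \<in> P" "\<And>Q. Q \<in> H \<Longrightarrow> x \<in> Q \<Longrightarrow> Q = P"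
  obtains n where "outer_unit_normal D x n" "P = {y. n \<bullet> (y - x) = 0}"
proof -
  obtain n where n: "norm n = 1" "P = {y. n \<bullet> (y - x) = 0}"
    using plane_as_hyperplane x H by blast
  have nn: "n \<bullet> n = 1" using n by (simp add: norm_eq_1)
  have "closed (\<Union>(H - {P}))"
    using H planes_closed by (intro closed_Union) auto
  moreover have "x \<notin> \<Union>(H - {P})" using x by blast
  ultimately obtain r where r: "r > 0" "ball x r \<inter> \<Union>(H - {P}) = {}"
    by (metis open_Compl ComplI open_contains_ball disjoint_eq_subset_Compl)
  have frP: "frontier D \<inter> ball x r \<subseteq> P" using r H by blast
  define U where "U s = {y \<in> ball x r. s * (n \<bullet> (y - x)) < 0}" for s :: real
  have Useq: "U s = ball x r \<inter> {y. (s *\<^sub>R n) \<bullet> y < s * (n \<bullet> x)}" for s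
    by (auto simp: U_def inner_diff_right algebra_simps)
  have U_conn: "connected (U s)" for s
    unfolding Useq by (intro convex_connected convex_Int convex_ball convex_halfspace_lt)
  have U_dich: "U s \<subseteq> D \<or> U s \<inter> D = {}" for s
  proof -
    have "U s \<inter> frontier D = {}"
      using frP n by (auto simp: U_def)
    then show ?thesis using connected_Int_frontier[OF U_conn, of s D] by blast
  qed
  \<comment> \<open>Points of \<open>P\<close> in the ball are limits of both half balls; the sign
    of \<open>s\<close> selects the half.\<close>
  have near: "\<exists>y\<in>V. y \<in> U s" if "open V" "z \<in> V" "z \<in> ball x r" "n \<bullet> (z - x) = 0" "s \<noteq> 0" for V z s
  proof -
    have "open (V \<inter> ball x r)" "z \<in> V \<inter> ball x r" using that by auto
    then obtain e where e: "e > 0" "ball z e \<subseteq> V \<inter> ball x r"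
      using openE by metis
    define y where "y = z - (sgn s * e / 2) *\<^sub>R n"
    have "y \<in> ball z e" using e n that by (simp add: y_def dist_norm abs_mult abs_sgn_eq)
    moreover have "n \<bullet> (y - x) = - (sgn s * e / 2)"
      using that(4) nn by (simp add: y_def algebra_simps)
    then have "s * (n \<bullet> (y - x)) < 0"
      using e that(5) by (auto simp: sgn_if mult_less_0_iff)
    moreover have "y \<in> V" "y \<in> ball x r" using e(2) \<open>y \<in> ball z e\<close> by auto
    ultimately show ?thesis unfolding U_def by blast
  qed
  have opD: "open D" using D by (simp add: flat_domain_def)
  then have cl: "x \<in> closure D" and xD: "x \<notin> D"
    using x(1) by (simp_all add: frontier_def interior_open)
  have "\<not> (U 1 \<subseteq> D \<and> U (-1) \<subseteq> D)"
  proof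
    assume both: "U 1 \<subseteq> D \<and> U (-1) \<subseteq> D"
    have "ball x r \<subseteq> closure D"
    proof
      fix z assume z: "z \<in> ball x r"
      show "z \<in> closure D"
      proof (cases "n \<bullet> (z - x) = 0")
        case True
        then show ?thesis
          unfolding closure_iff_nhds_not_empty using near[OF _ _ z True, of _ 1] both
          by (metis (no_types, lifting) IntI empty_iff in_mono one_neq_zero)
      next
        case False
        then have "z \<in> U 1 \<union> U (-1)" using z by (auto simp: U_def)
        then show ?thesis using both closure_subset by blast
      qed
    qed
    then have "x \<in> interior (closure D)" using r(1) by (meson centre_in_ball interiorI open_ball)
    then show False using D xD by (simp add: flat_domain_def)
  qed
  moreover have "\<not> (U 1 \<inter> D = {} \<and> U (-1) \<inter> D = {})"
  proof
    assume none: "U 1 \<inter> D = {} \<and> U (-1) \<inter> D = {}"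
    obtain z where z: "z \<in> D" "z \<in> ball x r"
      using cl r(1) by (metis closure_approachable dist_commute mem_ball)
    have "z \<notin> U 1" "z \<notin> U (-1)"
      using none z by blast+
    then have "n \<bullet> (z - x) = 0"
      using z(2) by (simp add: U_def)
    then show False using near[OF opD z(1,2), of 1] none by auto
  qed
  ultimately obtain s where s: "s = 1 \<or> s = -1" "U s \<subseteq> D" "U (- s) \<inter> D = {}"
    using U_dich[of 1] U_dich[of "-1"] by (metis minus_minus)
  have "D \<inter> ball x r = {y \<in> ball x r. (s *\<^sub>R n) \<bullet> (y - x) < 0}"
  proof
    show "{y \<in> ball x r. (s *\<^sub>R n) \<bullet> (y - x) < 0} \<subseteq> D \<inter> ball x r"
      using s(2) by (auto simp: U_def)
    show "D \<inter> ball x r \<subseteq> {y \<in> ball x r. (s *\<^sub>R n) \<bullet> (y - x) < 0}"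
    proof
      fix z assume z: "z \<in> D \<inter> ball x r"
      have "n \<bullet> (z - x) \<noteq> 0"
        using near[OF opD, of z "- s"] z s by auto
      moreover have "z \<notin> U (- s)" using z s by blast
      ultimately show "z \<in> {y \<in> ball x r. (s *\<^sub>R n) \<bullet> (y - x) < 0}"
        using z s(1) by (auto simp: U_def)
    qed
  qed
  then have "outer_unit_normal D x (s *\<^sub>R n)"
    unfolding outer_unit_normal_def using r(1) n(1) s(1) by auto
  moreover have "P = {y. (s *\<^sub>R n) \<bullet> (y - x) = 0}"
    using n(2) s(1) by auto
  ultimately show ?thesis using that by blast
qed

text \<open>The exceptional set: off it a frontier point lies on exactly one plane of
  \<open>H\<close>, so it has a normal.\<close>

definition crossings :: "R3 set set \<Rightarrow> R3 set" where
  "crossings H = (\<Union>P\<in>H. \<Union>Q\<in>H - {P}. P \<inter> Q)"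

lemma crossings_null:
  assumes "finite H" "H \<subseteq> planes"
  shows "crossings H \<in> null_sets surface_measure"
  unfolding crossings_def using assms planes_Int_null
  by (intro null_sets_UN' countable_finite finite_Diff) auto

lemma flat_domain_crossings:
  assumes "flat_domain D" and H: "finite H" "H \<subseteq> planes" "frontier D \<subseteq> \<Union>H"
    and "x \<in> frontier D - crossings H"
  shows "\<exists>n. outer_unit_normal D x n"
proof -
  obtain P where P: "P \<in> H" "x \<in> P" using assms by blast
  have "Q = P" if "Q \<in> H" "x \<in> Q" for Q
    using that P assms(5) unfolding crossings_def by blast
  then show ?thesis
    using flat_domain_half_ball[OF assms(1) H, of x P] assms(5) P by (metis DiffD1)
qed

lemma AE_flat_domain_normal:
  assumes "flat_domain D"
  shows "AE x in surface_measure. x \<in> frontier D \<longrightarrow> (\<exists>n. outer_unit_normal D x n)"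
proof -
  obtain H where H: "finite H" "H \<subseteq> planes" "frontier D \<subseteq> \<Union>H"
    using assms unfolding flat_domain_def by blast
  show ?thesis
    by (rule AE_I'[OF crossings_null[OF H(1,2)]]) (use flat_domain_crossings[OF assms H] in auto)
qed

text \<open>Unless \<open>m = - n\<close>, a short step in the direction \<open>- (m + n)\<close>
  enters both half balls, which are disjoint. With opposite normals they fill the ball except for
  the tangent plane, whose points are limits of points of \<open>D\<close>.\<close>

lemma opposite_half_balls:
  assumes "outer_unit_normal D x n" "outer_unit_normal E x m" "D \<inter> E = {}"
  shows "x \<in> interior (closure (D \<union> E))"
proof -
  obtain r where r: "norm n = 1" "r > 0" "D \<inter> ball x r = {y \<in> ball x r. n \<bullet> (y - x) < 0}"
    using assms unfolding outer_unit_normal_def by auto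
  obtain s where s: "norm m = 1" "s > 0" "E \<inter> ball x s = {y \<in> ball x s. m \<bullet> (y - x) < 0}"
    using assms unfolding outer_unit_normal_def by auto
  have nn: "n \<bullet> n = 1" "m \<bullet> m = 1" using r s by (simp_all add: norm_eq_1)
  have mn: "m = - n"
  proof (rule ccontr)
    assume "m \<noteq> - n"
    then have "m + n \<noteq> 0" by (simp add: eq_neg_iff_add_eq_0)
    then have "0 < (m + n) \<bullet> (m + n)" by simp
    then have *: "- 1 < m \<bullet> n" using nn by (simp add: inner_add_left inner_add_right inner_commute)
    define t where "t = min r s / (2 * norm (m + n))"
    have t: "t > 0" "t * norm (m + n) < r" "t * norm (m + n) < s"
      using \<open>m + n \<noteq> 0\<close> r(2) s(2) by (auto simp: t_def min_def divide_simps)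
    define y where "y = x - t *\<^sub>R (m + n)"
    have "y \<in> ball x r" "y \<in> ball x s" using t by (simp_all add: y_def dist_norm)
    moreover have "n \<bullet> (y - x) < 0" "m \<bullet> (y - x) < 0"
      using t * nn by (auto simp: y_def inner_add_right inner_commute)
    ultimately show False using r(3) s(3) assms(3) by blast
  qed
  have "ball x (min r s) \<subseteq> closure (D \<union> E)"
  proof
    fix z assume z: "z \<in> ball x (min r s)"
    show "z \<in> closure (D \<union> E)"
    proof (cases "n \<bullet> (z - x) = 0")
      case True
      show ?thesis
        unfolding closure_approachable
      proof (intro allI impI)
        fix e :: real assume "e > 0"
        define d where "d = min e (min r s - dist x z) / 2"
        have "d > 0" "2 * d \<le> e" "2 * d \<le> min r s - dist x z"
          using \<open>e > 0\<close> z by (simp_all add: d_def)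
        then have d: "d > 0" "d < e" "dist x z + d < min r s" by linarith+
        define y where "y = z - d *\<^sub>R n"
        have "dist x y \<le> dist x z + d" 
          using dist_triangle[of x y z] d r(1) by (simp add: y_def dist_norm)
        then have "y \<in> ball x r" using d by auto
        moreover have "n \<bullet> (y - x) < 0"
          using True d nn by (simp add: y_def algebra_simps)
        ultimately have "y \<in> D" using r(3) by blast
        moreover have "dist y z < e" using d r(1) by (simp add: y_def dist_norm)
        ultimately show "\<exists>y\<in>D \<union> E. dist y z < e" by blast
      qed
    next
      case False
      then have "n \<bullet> (z - x) < 0 \<or> m \<bullet> (z - x) < 0" by (auto simp: mn)
      then have "z \<in> D \<union> E" using z r(3) s(3) by auto
      then show ?thesis using closure_subset by blast
    qed
  qed
  moreover have "x \<in> ball x (min r s)" using r(2) s(2) by simp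
  ultimately show ?thesis by (meson interiorI open_ball)
qed

unbundle cross3_syntax

section \<open>Projection of directions onto the tangent plane\<close>

text \<open>Lagrange's identity gives \<open>n \<times> (a \<times> b) = 0\<close>; both vectors are
  unit vectors, so they agree up to sign.\<close>

lemma cross_orthonormal:
  fixes a b n :: R3
  assumes "norm a = 1" "norm b = 1" "norm n = 1" "a \<bullet> b = 0" "a \<bullet> n = 0" "b \<bullet> n = 0"
  shows "a \<times> b = n \<or> a \<times> b = - n"
proof -
  let ?k = "a \<times> b"
  have kk: "?k \<bullet> ?k = 1"
    unfolding power2_norm_eq_inner[symmetric] using norm_cross_dot[of a b] assms by simp
  then have "norm ?k = 1" by (simp add: norm_eq_1)
  have nn: "n \<bullet> n = 1" using assms by (simp add: norm_eq_1)
  have "n \<times> ?k = 0"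
    unfolding Lagrange using assms by (simp add: inner_commute)
  then have "(n \<bullet> ?k)\<^sup>2 = 1"
    using norm_cross_dot[of n ?k] assms \<open>norm ?k = 1\<close> by simp
  then consider "n \<bullet> ?k = 1" | "n \<bullet> ?k = -1"
    using power2_eq_1_iff by blast
  then show ?thesis
  proof cases
    case 1
    then have "(?k - n) \<bullet> (?k - n) = 0"
      using kk nn by (simp add: inner_diff_left inner_diff_right inner_commute)
    then have "?k - n = 0" using inner_eq_zero_iff by blast
    then show ?thesis by simp
  next
    case 2
    then have "(?k + n) \<bullet> (?k + n) = 0"
      using kk nn by (simp add: inner_add_left inner_add_right inner_commute)
    then have "?k + n = 0" using inner_eq_zero_iff by blast
    then show ?thesis by (simp add: eq_neg_iff_add_eq_0)
  qed
qed

text \<open>The remainder \<open>w\<close> is orthogonal to all three vectors. By Lagrange's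
  identity it also has zero cross product with \<open>a \<times> b\<close>, that is with
  \<open>n\<close>, and only 0 is both orthogonal and parallel to \<open>n\<close>.\<close>

lemma orthonormal_expand:
  fixes a b n u :: R3
  assumes on: "norm a = 1" "norm b = 1" "norm n = 1" "a \<bullet> b = 0" "a \<bullet> n = 0" "b \<bullet> n = 0"
  shows "u = (u \<bullet> a) *\<^sub>R a + (u \<bullet> b) *\<^sub>R b + (u \<bullet> n) *\<^sub>R n"
proof -
  have sq: "a \<bullet> a = 1" "b \<bullet> b = 1" "n \<bullet> n = 1" using on by (simp_all add: norm_eq_1)
  define w where "w = u - (u \<bullet> a) *\<^sub>R a - (u \<bullet> b) *\<^sub>R b - (u \<bullet> n) *\<^sub>R n"
  have w: "w \<bullet> a = 0" "w \<bullet> b = 0" "w \<bullet> n = 0"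
    using on sq by (simp_all add: w_def inner_diff_left inner_diff_right inner_commute)
  have "w \<times> (a \<times> b) = 0" unfolding Lagrange using w by simp
  then have "w \<times> n = 0" using cross_orthonormal[OF on] by auto
  then have "w = 0" using w(3) norm_and_cross_eq_0[of w n] on(3) by auto
  then show ?thesis by (simp add: w_def algebra_simps)
qed

lemma orthonormal_norm:
  fixes a b n u :: R3
  assumes on: "norm a = 1" "norm b = 1" "norm n = 1" "a \<bullet> b = 0" "a \<bullet> n = 0" "b \<bullet> n = 0"
  shows "(norm u)\<^sup>2 = (u \<bullet> a)\<^sup>2 + (u \<bullet> b)\<^sup>2 + (u \<bullet> n)\<^sup>2"
proof -
  have "u \<bullet> u = u \<bullet> ((u \<bullet> a) *\<^sub>R a + (u \<bullet> b) *\<^sub>R b + (u \<bullet> n) *\<^sub>R n)"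
    using orthonormal_expand[OF on, of u] by simp
  then show ?thesis
    unfolding power2_norm_eq_inner by (simp add: inner_add_right power2_eq_square)
qed

lemma norm_real2: "(norm p)\<^sup>2 = (p $ 1)\<^sup>2 + (p $ 2)\<^sup>2" for p :: "real ^ 2"
  by (simp add: norm_vec_def L2_set_def sum_2)

text \<open>The foot of the direction \<open>u / norm u\<close> on the tangent plane, in coordinates
  with respect to \<open>a\<close> and \<open>b\<close>; as a combination of \<open>axis\<close>
  vectors it can be differentiated one coordinate at a time.\<close>

definition nusselt :: "R3 \<Rightarrow> R3 \<Rightarrow> R3 \<Rightarrow> real ^ 2" where
  "nusselt a b u = (u \<bullet> a / norm u) *\<^sub>R axis 1 1 + (u \<bullet> b / norm u) *\<^sub>R axis 2 1"

lemma nusselt_nth [simp]: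
  "nusselt a b u $ 1 = u \<bullet> a / norm u" "nusselt a b u $ 2 = u \<bullet> b / norm u"
  by (simp_all add: nusselt_def axis_def)

definition nusselt_deriv :: "R3 \<Rightarrow> R3 \<Rightarrow> R3 \<Rightarrow> R3 \<Rightarrow> real ^ 2" where
  "nusselt_deriv a b u h =
     (h \<bullet> a / norm u - (u \<bullet> a) * (u \<bullet> h) / norm u ^ 3) *\<^sub>R axis 1 1 +
     (h \<bullet> b / norm u - (u \<bullet> b) * (u \<bullet> h) / norm u ^ 3) *\<^sub>R axis 2 1"

lemma nusselt_deriv_nth:
  "nusselt_deriv a b u h $ 1 = h \<bullet> a / norm u - (u \<bullet> a) * (u \<bullet> h) / norm u ^ 3"
  "nusselt_deriv a b u h $ 2 = h \<bullet> b / norm u - (u \<bullet> b) * (u \<bullet> h) / norm u ^ 3"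
  by (simp_all add: nusselt_deriv_def axis_def)

lemma has_derivative_inner_div_norm:
  fixes c u :: R3
  assumes "u \<noteq> 0"
  shows "((\<lambda>u. u \<bullet> c / norm u) has_derivative (\<lambda>h. h \<bullet> c / norm u - (u \<bullet> c) * (u \<bullet> h) / norm u ^ 3)) (at u)"
proof -
  have "((\<lambda>u. u \<bullet> c) has_derivative (\<lambda>h. h \<bullet> c)) (at u)"
    by (intro bounded_linear_imp_has_derivative bounded_linear_inner_left)
  from has_derivative_divide'[OF this has_derivative_norm[OF assms]]
  have "((\<lambda>u. u \<bullet> c / norm u) has_derivative
      (\<lambda>h. (h \<bullet> c * norm u - u \<bullet> c * (h \<bullet> sgn u)) / (norm u * norm u))) (at u)"
    using assms by simp
  moreover have "(h \<bullet> c * norm u - u \<bullet> c * (h \<bullet> sgn u)) / (norm u * norm u)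
      = h \<bullet> c / norm u - (u \<bullet> c) * (u \<bullet> h) / norm u ^ 3" for h
  proof -
    have "h \<bullet> sgn u = (u \<bullet> h) / norm u"
      by (simp add: sgn_div_norm inner_commute divide_inverse mult.commute)
    then show ?thesis
      using assms by (simp add: diff_divide_distrib power3_eq_cube)
  qed
  ultimately show ?thesis by simp
qed

lemma has_derivative_nusselt:
  "u \<noteq> 0 \<Longrightarrow> (nusselt a b has_derivative nusselt_deriv a b u) (at u)"
  unfolding nusselt_def[abs_def] nusselt_deriv_def[abs_def]
  by (intro has_derivative_add has_derivative_scaleR_left has_derivative_inner_div_norm)

text \<open>The double product \<open>(u \<times> (e1 \<times> e2)) \<times> u\<close> is expanded
  in two ways by Lagrange's identity, and the result is paired with \<open>a \<times> b\<close>,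
  where \<open>dot_cross\<close> produces the 2 by 2 minors.\<close>

lemma nusselt_jacobian_identity:
  fixes a b e1 e2 u :: R3
  shows "(u \<bullet> u) * ((e1 \<bullet> a) * (e2 \<bullet> b) - (e1 \<bullet> b) * (e2 \<bullet> a))
     - (u \<bullet> e2) * ((e1 \<bullet> a) * (u \<bullet> b) - (e1 \<bullet> b) * (u \<bullet> a))
     - (u \<bullet> e1) * ((u \<bullet> a) * (e2 \<bullet> b) - (u \<bullet> b) * (e2 \<bullet> a))
     = (u \<bullet> (e1 \<times> e2)) * (u \<bullet> (a \<times> b))"
proof -
  have "(u \<bullet> u) *\<^sub>R (e1 \<times> e2) - (u \<bullet> e2) *\<^sub>R (e1 \<times> u) - (u \<bullet> e1) *\<^sub>R (u \<times> e2) = (u \<bullet> (e1 \<times> e2)) *\<^sub>R u"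
  proof -
    have "(u \<times> (e1 \<times> e2)) \<times> u = (u \<bullet> u) *\<^sub>R (e1 \<times> e2) - (u \<bullet> (e1 \<times> e2)) *\<^sub>R u"
      using Lagrange[of u u "e1 \<times> e2"] cross_skew[of "u \<times> (e1 \<times> e2)" u] by simp
    moreover have "(u \<times> (e1 \<times> e2)) \<times> u = (u \<bullet> e2) *\<^sub>R (e1 \<times> u) + (u \<bullet> e1) *\<^sub>R (u \<times> e2)"
      unfolding Lagrange[of u e1 e2] Cross3.left_diff_distrib cross_mult_left
      using cross_skew[of e2 u] by simp
    ultimately show ?thesis by (simp add: algebra_simps)
  qed
  then have "((u \<bullet> u) *\<^sub>R (e1 \<times> e2) - (u \<bullet> e2) *\<^sub>R (e1 \<times> u) - (u \<bullet> e1) *\<^sub>R (u \<times> e2)) \<bullet> (a \<times> b)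
      = (u \<bullet> (e1 \<times> e2)) * (u \<bullet> (a \<times> b))"
    by simp
  then show ?thesis
    by (simp only: inner_diff_left inner_scaleR_left dot_cross)
qed

lemma det_nusselt:
  fixes a b e1 e2 u :: R3
  assumes "u \<noteq> 0"
  shows "det (matrix (\<lambda>h :: real ^ 2. nusselt_deriv a b u (h $ 1 *\<^sub>R e1 + h $ 2 *\<^sub>R e2)))
    = (u \<bullet> (e1 \<times> e2)) * (u \<bullet> (a \<times> b)) / (u \<bullet> u)\<^sup>2"
proof -
  define s where "s = norm u"
  have s: "s \<noteq> 0" "u \<bullet> u = s\<^sup>2" using assms by (simp_all add: s_def power2_norm_eq_inner)
  have "det (matrix (\<lambda>h :: real ^ 2. nusselt_deriv a b u (h $ 1 *\<^sub>R e1 + h $ 2 *\<^sub>R e2)))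
      = (e1 \<bullet> a / s - (u \<bullet> a) * (u \<bullet> e1) / s ^ 3) * (e2 \<bullet> b / s - (u \<bullet> b) * (u \<bullet> e2) / s ^ 3)
        - (e2 \<bullet> a / s - (u \<bullet> a) * (u \<bullet> e2) / s ^ 3) * (e1 \<bullet> b / s - (u \<bullet> b) * (u \<bullet> e1) / s ^ 3)"
    by (simp add: det_2 matrix_def nusselt_deriv_nth s_def axis_def)
  \<comment> \<open>The two terms with denominator \<open>s ^ 6\<close> cancel, which leaves the
    common denominator \<open>s ^ 4\<close>.\<close>
  also have "\<dots> = (s\<^sup>2 * ((e1 \<bullet> a) * (e2 \<bullet> b) - (e1 \<bullet> b) * (e2 \<bullet> a))
     - (u \<bullet> e2) * ((e1 \<bullet> a) * (u \<bullet> b) - (e1 \<bullet> b) * (u \<bullet> a))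
     - (u \<bullet> e1) * ((u \<bullet> a) * (e2 \<bullet> b) - (u \<bullet> b) * (e2 \<bullet> a))) / (s\<^sup>2)\<^sup>2"
    using s(1) by (simp add: field_simps power2_eq_square power3_eq_cube)
  also have "\<dots> = (u \<bullet> (e1 \<times> e2)) * (u \<bullet> (a \<times> b)) / (u \<bullet> u)\<^sup>2"
    unfolding s(2)[symmetric] nusselt_jacobian_identity ..
  finally show ?thesis .
qed

lemma norm_nusselt_less_1:
  assumes on: "norm a = 1" "norm b = 1" "norm n = 1" "a \<bullet> b = 0" "a \<bullet> n = 0" "b \<bullet> n = 0"
    and "u \<bullet> n \<noteq> 0"
  shows "norm (nusselt a b u) < 1"
proof -
  have u: "norm u > 0" using assms(7) by auto
  have "(norm (nusselt a b u))\<^sup>2 = (u \<bullet> a / norm u)\<^sup>2 + (u \<bullet> b / norm u)\<^sup>2"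
    by (simp add: norm_real2)
  also have "\<dots> = ((u \<bullet> a)\<^sup>2 + (u \<bullet> b)\<^sup>2) / (norm u)\<^sup>2"
    by (simp add: power_divide add_divide_distrib)
  also have "\<dots> < 1"
  proof -
    have pos: "0 < (norm u)\<^sup>2" using u by simp
    show ?thesis
      unfolding pos_divide_less_eq[OF pos] using assms(7) orthonormal_norm[OF on, of u] by simp
  qed
  finally have "(norm (nusselt a b u))\<^sup>2 < 1\<^sup>2" by simp
  then show ?thesis by (rule power2_less_imp_less) simp
qed

text \<open>Two coordinates of a unit vector fix the third up to its sign, and here both third
  coordinates are negative.\<close>

lemma nusselt_inj_direction:
  assumes on: "norm a = 1" "norm b = 1" "norm n = 1" "a \<bullet> b = 0" "a \<bullet> n = 0" "b \<bullet> n = 0"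
    and "u \<bullet> n < 0" "w \<bullet> n < 0" "nusselt a b u = nusselt a b w"
  shows "u /\<^sub>R norm u = w /\<^sub>R norm w"
proof -
  define u' w' where "u' = u /\<^sub>R norm u" and "w' = w /\<^sub>R norm w"
  have pos: "norm u > 0" "norm w > 0" using assms by auto
  have ab: "u' \<bullet> a = w' \<bullet> a" "u' \<bullet> b = w' \<bullet> b"
    using arg_cong[OF assms(9), of "\<lambda>v. v $ 1"] arg_cong[OF assms(9), of "\<lambda>v. v $ 2"]
    by (simp_all add: u'_def w'_def divide_inverse mult.commute)
  have neg: "u' \<bullet> n < 0" "w' \<bullet> n < 0"
    using assms pos by (simp_all add: u'_def w'_def mult_pos_neg)
  have "norm u' = 1" "norm w' = 1" using pos by (simp_all add: u'_def w'_def)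
  then have "(u' \<bullet> n)\<^sup>2 = (w' \<bullet> n)\<^sup>2"
    using orthonormal_norm[OF on, of u'] orthonormal_norm[OF on, of w'] ab by simp
  then have "u' \<bullet> n = w' \<bullet> n"
    using neg by (simp add: power2_eq_iff)
  then have "u' = w'"
    using orthonormal_expand[OF on, of u'] orthonormal_expand[OF on, of w'] ab by simp
  then show ?thesis by (simp add: u'_def w'_def)
qed

lemma nusselt_surj:
  assumes on: "norm a = 1" "norm b = 1" "norm n = 1" "a \<bullet> b = 0" "a \<bullet> n = 0" "b \<bullet> n = 0"
    and "norm p < 1"
  shows "\<exists>v. norm v = 1 \<and> v \<bullet> n < 0 \<and> (\<forall>t>0. nusselt a b (t *\<^sub>R v) = p)"
proof -
  \<comment> \<open>\<open>p\<close> is lifted to the open hemisphere on the inner side of the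
    tangent plane; \<open>- c\<close> is the normal component of the lift.\<close>
  define c where "c = sqrt (1 - (norm p)\<^sup>2)"
  have p: "(norm p)\<^sup>2 = (p $ 1)\<^sup>2 + (p $ 2)\<^sup>2"
    by (rule norm_real2)
  have "(norm p)\<^sup>2 < 1" using assms(7) by (simp add: abs_square_less_1)
  then have c: "c > 0" "c\<^sup>2 = 1 - (norm p)\<^sup>2" by (simp_all add: c_def)
  define v where "v = p $ 1 *\<^sub>R a + p $ 2 *\<^sub>R b - c *\<^sub>R n"
  have sq: "a \<bullet> a = 1" "b \<bullet> b = 1" "n \<bullet> n = 1" using on by (simp_all add: norm_eq_1)
  have comp: "v \<bullet> a = p $ 1" "v \<bullet> b = p $ 2" "v \<bullet> n = - c"
    using on sq by (simp_all add: v_def inner_add_left inner_diff_left inner_add_right inner_diff_right inner_commute)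
  have "(norm v)\<^sup>2 = 1"
    using orthonormal_norm[OF on, of v] c p by (simp add: comp)
  then have v: "norm v = 1" by (simp add: power2_eq_1_iff) (metis norm_ge_zero not_one_le_zero neg_0_le_iff_le)
  have "nusselt a b (t *\<^sub>R v) = p" if "t > 0" for t
    using that v comp by (simp add: vec_eq_iff forall_2)
  with v comp c show ?thesis by (intro exI[of _ v]) simp
qed

section \<open>View factors of a closed surface\<close>

text \<open>The segment starts inside \<open>D\<close>, and near \<open>x\<close> the set
  \<open>D\<close> is the half ball below the tangent plane.\<close>

lemma visible_inner_neg:
  assumes "outer_unit_normal D x n" "open_segment x y \<subseteq> D" "x \<noteq> y"
  shows "(y - x) \<bullet> n < 0"
proof -
  obtain r where r: "r > 0" "D \<inter> ball x r = {y \<in> ball x r. n \<bullet> (y - x) < 0}"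
    using assms(1) unfolding outer_unit_normal_def by auto
  have pos: "norm (y - x) > 0" using assms(3) by simp
  \<comment> \<open>The halving makes both inequalities strict, so \<open>z\<close> lies in the open
    segment and in the ball of radius \<open>r\<close>.\<close>
  define t where "t = min 1 (r / norm (y - x)) / 2"
  have t: "0 < t" "t < 1" "t * norm (y - x) < r"
  proof -
    show "0 < t" using r pos by (simp add: t_def)
    have "t \<le> 1 / 2" "t \<le> r / norm (y - x) / 2" by (simp_all add: t_def)
    then show "t < 1" "t * norm (y - x) < r"
      using r(1) pos by (simp_all add: field_simps)
  qed
  define z where "z = x + t *\<^sub>R (y - x)"
  have "z \<in> open_segment x y"
    unfolding in_segment using t assms(3) by (intro conjI exI[of _ t]) (auto simp: z_def algebra_simps)
  moreover have "z \<in> ball x r"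
    using t by (simp add: z_def dist_norm)
  ultimately have "n \<bullet> (z - x) < 0" using assms(2) r(2) by blast
  then have "t * (n \<bullet> (y - x)) < 0" by (simp add: z_def)
  then show ?thesis using t(1) by (simp add: mult_less_0_iff inner_commute)
qed

text \<open>Of two different points on one ray, the nearer would lie on the open segment to the
  farther, hence in the open set \<open>D\<close> and not on its frontier. The auxiliary claim
  excludes one order of the distances and is applied both ways.\<close>

lemma visible_same_direction:
  fixes x y w :: R3
  assumes D: "open D" and y: "y \<in> frontier D" "open_segment x y \<subseteq> D" "x \<noteq> y"
    and w: "w \<in> frontier D" "open_segment x w \<subseteq> D" "x \<noteq> w"
    and eq: "(y - x) /\<^sub>R norm (y - x) = (w - x) /\<^sub>R norm (w - x)"
  shows "y = w"
proof -
  have *: "\<not> norm (y - x) < norm (w - x)"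
    if y: "y \<in> frontier D" "x \<noteq> y" and w: "open_segment x w \<subseteq> D" "x \<noteq> w"
      and eq: "(y - x) /\<^sub>R norm (y - x) = (w - x) /\<^sub>R norm (w - x)" for y w
  proof
    assume less: "norm (y - x) < norm (w - x)"
    define t where "t = norm (y - x) / norm (w - x)"
    have t: "0 < t" "t < 1" using less y(2) w(2) by (simp_all add: t_def)
    have "y - x = norm (y - x) *\<^sub>R ((y - x) /\<^sub>R norm (y - x))" using y(2) by simp
    also have "\<dots> = t *\<^sub>R (w - x)" unfolding eq by (simp add: t_def divide_inverse)
    finally have "y = (1 - t) *\<^sub>R x + t *\<^sub>R w" by (simp add: algebra_simps)
    then have "y \<in> open_segment x w" unfolding in_segment using t w(2) by auto
    then have "y \<in> D" using w(1) by blast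
    then show False using y(1) D by (simp add: frontier_def interior_open)
  qed
  have "norm (y - x) = norm (w - x)"
    using *[OF y(1,3) w(2,3) eq] *[OF w(1,3) y(2,3) eq[symmetric]] by simp
  then have "(y - x) = (w - x)"
    using eq y(3) w(3) by auto
  then show ?thesis by simp
qed

lemma vf_kernel_refl [simp]: "vf_kernel D x x = 0"
  by (simp add: vf_kernel_def)

lemma vf_kernel_irregular:
  "x \<notin> reg_frontier D \<or> y \<notin> reg_frontier D \<Longrightarrow> vf_kernel D x y = 0"
  by (auto simp: vf_kernel_def inner_normal_def)

lemma vf_kernel_regular:
  assumes "x \<in> reg_frontier D" "outer_unit_normal D x n" "y \<in> reg_frontier D" "outer_unit_normal D y m"
  shows "vf_kernel D x y = - ((y - x) \<bullet> m) * ((y - x) \<bullet> n) / (pi * ((y - x) \<bullet> (y - x))\<^sup>2)"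
proof -
  have "inner_normal D x = - n" "inner_normal D y = - m"
    using reg_frontierE[OF assms(1)] reg_frontierE[OF assms(3)] outer_unit_normal_unique assms(2,4)
    by metis+
  moreover have "(- m) \<bullet> (x - y) = (y - x) \<bullet> m" "(- n) \<bullet> (y - x) = - ((y - x) \<bullet> n)"
    by (simp_all add: inner_diff_left inner_diff_right inner_commute)
  ultimately show ?thesis
    unfolding vf_kernel_def by simp
qed

lemma visible_kernel_nonneg: "0 \<le> visible D x y * vf_kernel D x y"
proof (cases "x \<in> reg_frontier D \<and> y \<in> reg_frontier D \<and> x \<noteq> y \<and> open_segment x y \<subseteq> D")
  case True
  obtain n where n: "outer_unit_normal D x n" using reg_frontierE True by metis
  obtain m where m: "outer_unit_normal D y m" using reg_frontierE True by metis
  have "(y - x) \<bullet> n < 0" using visible_inner_neg[OF n] True by blast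
  moreover have "(x - y) \<bullet> m < 0"
    using visible_inner_neg[OF m, of x] True open_segment_commute[of x y] by auto
  then have "0 < (y - x) \<bullet> m" by (simp add: inner_diff_left)
  ultimately have "0 \<le> - ((y - x) \<bullet> m) * ((y - x) \<bullet> n)"
    by (simp add: mult_le_0_iff)
  moreover have "0 \<le> pi * ((y - x) \<bullet> (y - x))\<^sup>2" by simp
  ultimately have "0 \<le> vf_kernel D x y"
    unfolding vf_kernel_regular[OF _ n _ m, OF conjunct1[OF True] conjunct1[OF conjunct2[OF True]]]
    by (rule divide_nonneg_nonneg)
  then show ?thesis by (simp add: visible_def)
next
  case False
  then show ?thesis using vf_kernel_irregular[of x D y] by (auto simp: visible_def)
qed

section \<open>Measurability of the normal, of visibility and of the kernel\<close>

lemma reg_frontier_locally_const: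
  assumes "x \<in> reg_frontier D"
  shows "\<exists>r>0. \<forall>y\<in>frontier D \<inter> ball x r. y \<in> reg_frontier D \<and> inner_normal D y = inner_normal D x"
proof -
  obtain n where n: "outer_unit_normal D x n" "inner_normal D x = - n"
    using reg_frontierE[OF assms] by metis
  obtain r where r: "norm n = 1" "r > 0" "D \<inter> ball x r = {y \<in> ball x r. n \<bullet> (y - x) < 0}"
    using n(1) unfolding outer_unit_normal_def by auto
  have "outer_unit_normal D y n" if y: "y \<in> frontier D" "y \<in> ball x r" for y
  proof -
    have opn: "open {y. n \<bullet> (y - x) < 0}" "open {y. 0 < n \<bullet> (y - x)}"
      by (intro open_Collect_less continuous_intros)+
    \<comment> \<open>In the ball around \<open>x\<close> the frontier is the flat disc: points on
      one side are interior to \<open>D\<close>, points on the other are not limits of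
      \<open>D\<close>. So \<open>D\<close> is a half ball with the same \<open>n\<close> at
      \<open>y\<close>.\<close>
    have "n \<bullet> (y - x) = 0"
    proof (rule ccontr)
      assume "n \<bullet> (y - x) \<noteq> 0"
      then consider "n \<bullet> (y - x) < 0" | "0 < n \<bullet> (y - x)" by linarith
      then show False
      proof cases
        case 1
        have "open (D \<inter> ball x r)" unfolding r(3)
          using open_Int[OF open_ball[of x r] opn(1)] by (simp add: Int_def)
        moreover have "y \<in> D \<inter> ball x r" unfolding r(3) using 1 y by simp
        ultimately have "y \<in> interior D" by (meson inf_le1 interiorI)
        then show False using y by (simp add: frontier_def)
      next
        case 2
        have "open (ball x r \<inter> {y. 0 < n \<bullet> (y - x)})" using opn(2) by blast
        moreover have "y \<in> ball x r \<inter> {y. 0 < n \<bullet> (y - x)}" using 2 y by simp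
        moreover have "y \<in> closure D" using y by (simp add: frontier_def)
        ultimately obtain z where "z \<in> D" "z \<in> ball x r \<inter> {y. 0 < n \<bullet> (y - x)}"
          by (meson closure_iff_nhds_not_empty disjoint_iff order_refl)
        then have "z \<in> {y \<in> ball x r. n \<bullet> (y - x) < 0}" unfolding r(3)[symmetric] by blast
        then show False using \<open>z \<in> ball x r \<inter> {y. 0 < n \<bullet> (y - x)}\<close> by simp
      qed
    qed
    then have shift: "n \<bullet> (z - y) = n \<bullet> (z - x)" for z
      by (simp add: inner_diff_right)
    obtain s where s: "s > 0" "ball y s \<subseteq> ball x r"
      using y(2) openE[OF open_ball] by metis
    have "D \<inter> ball y s = (D \<inter> ball x r) \<inter> ball y s" using s by blast
    also have "\<dots> = {z \<in> ball y s. n \<bullet> (z - y) < 0}"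
      unfolding r(3) shift using s(2) by blast
    finally show ?thesis unfolding outer_unit_normal_def using r(1) s(1) by blast
  qed
  then have "y \<in> reg_frontier D \<and> inner_normal D y = - n" if "y \<in> frontier D \<inter> ball x r" for y
    using that reg_frontierI reg_frontierE outer_unit_normal_unique by (metis IntE)
  then show ?thesis using r(2) n(2) by auto
qed

lemma reg_frontier_borel [measurable]: "reg_frontier D \<in> sets borel"
proof -
  let ?B = "{ball x r | x r. r > 0 \<and> frontier D \<inter> ball x r \<subseteq> reg_frontier D}"
  have "reg_frontier D = frontier D \<inter> \<Union>?B"
  proof
    show "reg_frontier D \<subseteq> frontier D \<inter> \<Union>?B"
    proof
      fix x assume x: "x \<in> reg_frontier D"
      obtain r where r: "r > 0" "\<forall>y\<in>frontier D \<inter> ball x r. y \<in> reg_frontier D"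
        using reg_frontier_locally_const[OF x] by blast
      then have "ball x r \<in> ?B" by blast
      moreover have "x \<in> ball x r" using r by simp
      moreover have "x \<in> frontier D" using x by (simp add: reg_frontier_def)
      ultimately show "x \<in> frontier D \<inter> \<Union>?B" by blast
    qed
  qed blast
  moreover have "frontier D \<inter> \<Union>?B \<in> sets borel"
    by (intro sets.Int borel_open borel_closed open_Union frontier_closed) auto
  ultimately show ?thesis by simp
qed

lemma inner_normal_measurable [measurable]: "inner_normal D \<in> borel_measurable borel"
proof -
  have "continuous_on (reg_frontier D) (inner_normal D)"
    unfolding continuous_on_iff
  proof (intro ballI allI impI)
    fix x e assume x: "x \<in> reg_frontier D" and e: "(e :: real) > 0"
    obtain r where r: "r > 0" "\<forall>y\<in>frontier D \<inter> ball x r. inner_normal D y = inner_normal D x"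
      using reg_frontier_locally_const[OF x] by blast
    have "dist (inner_normal D y) (inner_normal D x) < e" if "y \<in> reg_frontier D" "dist y x < r" for y
    proof -
      have "y \<in> frontier D \<inter> ball x r" using that by (auto simp: reg_frontier_def dist_commute)
      then show ?thesis using r(2) e by simp
    qed
    then show "\<exists>d>0. \<forall>y\<in>reg_frontier D. dist y x < d \<longrightarrow> dist (inner_normal D y) (inner_normal D x) < e"
      using r(1) by blast
  qed
  then have "(\<lambda>x. if x \<in> reg_frontier D then inner_normal D x else 0) \<in> borel_measurable borel"
    by (intro borel_measurable_continuous_on_if reg_frontier_borel continuous_on_const)
  moreover have "(\<lambda>x. if x \<in> reg_frontier D then inner_normal D x else 0) = inner_normal D"
    by (auto simp: inner_normal_def fun_eq_iff)
  ultimately show ?thesis by simp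
qed

text \<open>For \<open>t\<close> in a compact subinterval the pairs with a blocked point form the
  projection of a closed set along a compact factor, which is closed. Visibility is the countable
  intersection of the open complements.\<close>

lemma visible_set_borel:
  assumes "open D"
  shows "{z :: R3 \<times> R3. \<forall>t. 0 < t \<and> t < 1 \<longrightarrow> (1 - t) *\<^sub>R fst z + t *\<^sub>R snd z \<in> D} \<in> sets borel" (is "?V \<in> _")
proof -
  define T :: "(real \<times> R3 \<times> R3) set" where
    "T = {w. (1 - fst w) *\<^sub>R fst (snd w) + fst w *\<^sub>R snd (snd w) \<in> - D}"
  have "T = (\<lambda>w. (1 - fst w) *\<^sub>R fst (snd w) + fst w *\<^sub>R snd (snd w)) -` (- D)"
    by (auto simp: T_def)
  moreover have "closed ((\<lambda>w :: real \<times> R3 \<times> R3. (1 - fst w) *\<^sub>R fst (snd w) + fst w *\<^sub>R snd (snd w)) -` (- D))"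
    using assms by (intro closed_vimage continuous_intros) auto
  ultimately have "closed T" by simp
  \<comment> \<open>With \<open>k + 2\<close> the intervals start with the single point 1/2 and
    increase to the open unit interval.\<close>
  define W where "W k = - {z. \<exists>t. t \<in> {1 / real (k + 2) .. 1 - 1 / real (k + 2)} \<and> (t, z) \<in> T}" for k :: nat
  have "open (W k)" for k
    unfolding W_def using closed_compact_projection[OF compact_Icc \<open>closed T\<close>] by (simp add: open_Compl)
  then have "(\<Inter>k. W k) \<in> sets borel" by (intro sets.countable_INT) auto
  moreover have "?V = (\<Inter>k. W k)"
  proof
    show "?V \<subseteq> (\<Inter>k. W k)"
    proof
      fix z assume z: "z \<in> ?V"
      have "z \<in> W k" for k
      proof -
        have "(t, z) \<notin> T" if "t \<in> {1 / real (k + 2) .. 1 - 1 / real (k + 2)}" for t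
        proof -
          have "0 < 1 / real (k + 2)" by simp
          then have "0 < t" "t < 1" using that by (simp_all only: atLeastAtMost_iff) linarith+
          then show ?thesis using z by (simp add: T_def)
        qed
        then show ?thesis unfolding W_def by blast
      qed
      then show "z \<in> (\<Inter>k. W k)" by blast
    qed
    show "(\<Inter>k. W k) \<subseteq> ?V"
    proof
      fix z assume z: "z \<in> (\<Inter>k. W k)"
      have "(1 - t) *\<^sub>R fst z + t *\<^sub>R snd z \<in> D" if t: "0 < t" "t < 1" for t
      proof -
        have "0 < min t (1 - t)" using t by simp
        then obtain k where k: "1 / real (Suc k) < min t (1 - t)"
          using nat_approx_posE by metis
        have "1 / real (k + 2) \<le> 1 / real (Suc k)" by (intro divide_left_mono) auto
        then have "t \<in> {1 / real (k + 2) .. 1 - 1 / real (k + 2)}" using k by auto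
        moreover have "z \<in> W k" using z by blast
        ultimately have "(t, z) \<notin> T" unfolding W_def by blast
        then show ?thesis by (simp add: T_def)
      qed
      then show "z \<in> ?V" by blast
    qed
  qed
  ultimately show ?thesis by simp
qed

lemma open_segment_subset_iff:
  fixes x y :: R3
  assumes "x \<noteq> y"
  shows "open_segment x y \<subseteq> D \<longleftrightarrow> (\<forall>t. 0 < t \<and> t < 1 \<longrightarrow> (1 - t) *\<^sub>R x + t *\<^sub>R y \<in> D)"
proof
  assume sub: "open_segment x y \<subseteq> D"
  show "\<forall>t. 0 < t \<and> t < 1 \<longrightarrow> (1 - t) *\<^sub>R x + t *\<^sub>R y \<in> D"
  proof (intro allI impI)
    fix t :: real assume "0 < t \<and> t < 1"
    then have "(1 - t) *\<^sub>R x + t *\<^sub>R y \<in> open_segment x y"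
      unfolding in_segment using assms by blast
    then show "(1 - t) *\<^sub>R x + t *\<^sub>R y \<in> D" using sub by blast
  qed
qed (auto simp: in_segment)

lemma visible_kernel_measurable:
  assumes "open D"
  shows "(\<lambda>z. visible D (fst z) (snd z) * vf_kernel D (fst z) (snd z)) \<in> borel_measurable (borel \<Otimes>\<^sub>M borel)"
proof -
  let ?V = "{z :: R3 \<times> R3. \<forall>t. 0 < t \<and> t < 1 \<longrightarrow> (1 - t) *\<^sub>R fst z + t *\<^sub>R snd z \<in> D}"
  \<comment> \<open>On the diagonal the two descriptions of visibility may differ, because
    \<open>open_segment x x\<close> is empty, but there the kernel is 0.\<close>
  have eq: "visible D (fst z) (snd z) * vf_kernel D (fst z) (snd z) = indicator ?V z * vf_kernel D (fst z) (snd z)" for z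
  proof (cases "fst z = snd z")
    case False
    then show ?thesis by (simp add: visible_def open_segment_subset_iff indicator_def)
  qed simp
  have V: "?V \<in> sets (borel \<Otimes>\<^sub>M borel)"
    using visible_set_borel[OF assms] by (simp only: borel_prod)
  show ?thesis
    unfolding eq unfolding vf_kernel_def using V by measurable
qed

lemma plane_chart_normal:
  assumes P: "P \<in> planes" "y \<in> P" and m: "norm m = 1" "P = {z. m \<bullet> (z - y) = 0}"
    and e: "norm e1 = 1" "norm e2 = 1" "e1 \<bullet> e2 = 0"
      "\<And>q. plane_chart P q = plane_chart P 0 + q $ 1 *\<^sub>R e1 + q $ 2 *\<^sub>R e2"
  shows "e1 \<bullet> m = 0" "e2 \<bullet> m = 0" "e1 \<times> e2 = m \<or> e1 \<times> e2 = - m"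
proof -
  have "m \<bullet> (plane_chart P q - y) = 0" for q
    using plane_chart_in[OF P(1), of q] m(2) by blast
  then have *: "m \<bullet> (plane_chart P q - plane_chart P 0) = 0" for q
    by (simp add: inner_diff_right)
  have "plane_chart P (axis 1 1) = plane_chart P 0 + e1" "plane_chart P (axis 2 1) = plane_chart P 0 + e2"
    using e(4)[of "axis 1 1"] e(4)[of "axis 2 1"] by (simp_all add: axis_def)
  then show "e1 \<bullet> m = 0" "e2 \<bullet> m = 0"
    using *[of "axis 1 1"] *[of "axis 2 1"] by (simp_all add: inner_commute)
  then show "e1 \<times> e2 = m \<or> e1 \<times> e2 = - m"
    using e m by (intro cross_orthonormal) auto
qed

text \<open>The two vectors are read off the chart of the plane through 0 with normal
  \<open>n\<close>.\<close>

lemma tangent_basis_exists: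
  fixes n :: R3
  assumes "norm n = 1"
  obtains a b where "norm a = 1" "norm b = 1" "a \<bullet> b = 0" "a \<bullet> n = 0" "b \<bullet> n = 0"
proof -
  define P where "P = {z. n \<bullet> (z - 0) = 0}"
  have "n \<noteq> 0" using assms by auto
  then have P: "P \<in> planes" using hyperplane_in_planes[of n 0] by (simp add: P_def)
  obtain a b where ab: "norm a = 1" "norm b = 1" "a \<bullet> b = 0"
      "\<And>q. plane_chart P q = plane_chart P 0 + q $ 1 *\<^sub>R a + q $ 2 *\<^sub>R b"
    using plane_chart_affine[OF P] by metis
  have "0 \<in> P" by (simp add: P_def)
  from plane_chart_normal[OF P this assms P_def ab] ab that show ?thesis by blast
qed

text \<open>The point \<open>x\<close> of the boundary is fixed, with outer normal \<open>n\<close> and an orthonormal basis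
  \<open>a, b\<close> of its tangent plane. The radial projection to the unit sphere followed by the orthogonal
  projection to the tangent plane (Nusselt's analogy) maps the visible part of the boundary
  bijectively, up to null sets, to the unit disc, and \<open>pi\<close> times the kernel is its Jacobian.\<close>

locale nusselt_view =
  fixes D :: "R3 set" and H :: "R3 set set" and x n a b :: R3
  assumes D: "flat_domain D" and H: "finite H" "H \<subseteq> planes" "frontier D \<subseteq> \<Union>H"
    and x: "x \<in> reg_frontier D" and n: "outer_unit_normal D x n"
    and on: "norm a = 1" "norm b = 1" "norm n = 1" "a \<bullet> b = 0" "a \<bullet> n = 0" "b \<bullet> n = 0"
begin

definition F :: "R3 set \<Rightarrow> real ^ 2 \<Rightarrow> real ^ 2" where
  "F P q = nusselt a b (plane_chart P q - x)"

text \<open>Crossings are removed, so every seen point lies in one plane of \<open>H\<close> only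
  and has a normal; this costs a null set.\<close>

definition seen :: "R3 set" where
  "seen = {y \<in> frontier D - crossings H. y \<noteq> x \<and> open_segment x y \<subseteq> D}"

definition A :: "R3 set \<Rightarrow> (real ^ 2) set" where
  "A P = plane_chart P -` seen"

lemma open_D: "open D" and bounded_D: "bounded D"
  using D by (auto simp: flat_domain_def)

lemma crossings_borel: "crossings H \<in> sets borel"
  using crossings_null[OF H(1,2)] by auto

lemma seen_borel: "seen \<in> sets borel"
proof -
  let ?V = "{z :: R3 \<times> R3. \<forall>t. 0 < t \<and> t < 1 \<longrightarrow> (1 - t) *\<^sub>R fst z + t *\<^sub>R snd z \<in> D}"
  have "Pair x \<in> borel_measurable borel"
    by (intro borel_measurable_continuous_onI continuous_intros)
  then have V: "Pair x -` ?V \<in> sets borel"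
    using visible_set_borel[OF open_D] measurable_sets_borel by blast
  have "seen = (frontier D - crossings H) \<inter> - {x} \<inter> Pair x -` ?V"
  proof (rule set_eqI)
    fix y show "y \<in> seen \<longleftrightarrow> y \<in> (frontier D - crossings H) \<inter> - {x} \<inter> Pair x -` ?V"
    proof (cases "x = y")
      case True
      then have "y \<notin> seen" "y \<in> {x}" unfolding seen_def by simp_all
      then show ?thesis by blast
    next
      case False
      then show ?thesis by (simp add: seen_def open_segment_subset_iff)
    qed
  qed
  moreover have "(frontier D - crossings H) \<inter> - {x} \<inter> Pair x -` ?V \<in> sets borel"
    by (intro sets.Int sets.Diff borel_closed[OF frontier_closed] crossings_borel V) auto
  ultimately show ?thesis by simp
qed

lemma A_borel: "P \<in> planes \<Longrightarrow> A P \<in> sets borel"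
  unfolding A_def using sets_vimage_plane_chart seen_borel by blast

lemma seen_neg: "y \<in> seen \<Longrightarrow> (y - x) \<bullet> n < 0"
  using visible_inner_neg[OF n] by (auto simp: seen_def)

lemma seen_eq:
  assumes "y \<in> seen" "w \<in> seen" "nusselt a b (y - x) = nusselt a b (w - x)"
  shows "y = w"
proof -
  have "(y - x) /\<^sub>R norm (y - x) = (w - x) /\<^sub>R norm (w - x)"
    using nusselt_inj_direction[OF on seen_neg[OF assms(1)] seen_neg[OF assms(2)] assms(3)] .
  then show ?thesis
    using assms visible_same_direction[OF open_D, of y x w] by (auto simp: seen_def)
qed

lemma F_inj: "P \<in> planes \<Longrightarrow> inj_on (F P) (A P)"
  unfolding inj_on_def F_def A_def using seen_eq inj_plane_chart by (metis injD vimageE)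

lemma F_disjoint:
  assumes "P \<in> H" "Q \<in> H" "P \<noteq> Q"
  shows "F P ` A P \<inter> F Q ` A Q = {}"
proof (rule ccontr)
  assume "F P ` A P \<inter> F Q ` A Q \<noteq> {}"
  then obtain q q' where q: "q \<in> A P" "q' \<in> A Q" "F P q = F Q q'" by blast
  then have "plane_chart P q = plane_chart Q q'"
    using seen_eq by (simp add: A_def F_def)
  moreover have "plane_chart P q \<in> P" "plane_chart Q q' \<in> Q"
    using assms H plane_chart_in by auto
  ultimately have "plane_chart P q \<in> crossings H"
    unfolding crossings_def using assms by auto
  then show False using q(1) by (simp add: A_def seen_def)
qed

lemma F_ball: "F P ` A P \<subseteq> ball 0 1"
proof
  fix p assume "p \<in> F P ` A P"
  then obtain q where q: "plane_chart P q \<in> seen" "p = F P q" by (auto simp: A_def)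
  then have "norm (nusselt a b (plane_chart P q - x)) < 1"
    using seen_neg[OF q(1)] by (intro norm_nusselt_less_1[OF on]) simp
  then show "p \<in> ball 0 1" using q(2) by (simp add: F_def)
qed

text \<open>The linear part of the chart is written as a difference of two of its values, which
  avoids a choice of \<open>e1\<close> and \<open>e2\<close>.\<close>

definition F' :: "R3 set \<Rightarrow> real ^ 2 \<Rightarrow> real ^ 2 \<Rightarrow> real ^ 2" where
  "F' P q h = nusselt_deriv a b (plane_chart P q - x) (plane_chart P h - plane_chart P 0)"

lemma F_deriv:
  assumes P: "P \<in> planes" and "plane_chart P q \<noteq> x"
  shows "(F P has_derivative F' P q) (at q within S)"
proof -
  obtain e1 e2 where e: "\<And>q. plane_chart P q = plane_chart P 0 + q $ 1 *\<^sub>R e1 + q $ 2 *\<^sub>R e2"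
    using plane_chart_affine[OF P] by metis
  have 1: "((\<lambda>q. plane_chart P 0 + q $ 1 *\<^sub>R e1 + q $ 2 *\<^sub>R e2 - x) has_derivative
      (\<lambda>h. h $ 1 *\<^sub>R e1 + h $ 2 *\<^sub>R e2)) (at q)"
    by (auto intro!: derivative_eq_intros bounded_linear_imp_has_derivative bounded_linear_vec_nth)
  have eq1: "(\<lambda>q. plane_chart P 0 + q $ 1 *\<^sub>R e1 + q $ 2 *\<^sub>R e2 - x) = (\<lambda>q. plane_chart P q - x)"
  proof
    fix q show "plane_chart P 0 + q $ 1 *\<^sub>R e1 + q $ 2 *\<^sub>R e2 - x = plane_chart P q - x"
      using e[of q] by simp
  qed
  have eq2: "(\<lambda>h. h $ 1 *\<^sub>R e1 + h $ 2 *\<^sub>R e2) = (\<lambda>h. plane_chart P h - plane_chart P 0)"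
  proof
    fix h show "h $ 1 *\<^sub>R e1 + h $ 2 *\<^sub>R e2 = plane_chart P h - plane_chart P 0"
      using e[of h] by simp
  qed
  have "((\<lambda>q. plane_chart P q - x) has_derivative (\<lambda>h. plane_chart P h - plane_chart P 0)) (at q)"
    using 1 unfolding eq1 eq2 .
  moreover have "(nusselt a b has_derivative nusselt_deriv a b (plane_chart P q - x)) (at (plane_chart P q - x))"
    using assms by (intro has_derivative_nusselt) simp
  ultimately have "((\<lambda>q. nusselt a b (plane_chart P q - x)) has_derivative
      (\<lambda>h. nusselt_deriv a b (plane_chart P q - x) (plane_chart P h - plane_chart P 0))) (at q)"
    by (rule has_derivative_compose)
  then show ?thesis
    unfolding F_def[abs_def] F'_def[abs_def] by (rule has_derivative_at_withinI)
qed

text \<open>The chart vectors have cross product \<open>m\<close> or \<open>- m\<close>, the tangent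
  basis \<open>n\<close> or \<open>- n\<close>; the absolute value removes the signs, and what
  remains is the kernel without its factor \<open>1 / pi\<close>.\<close>

lemma det_F:
  assumes P: "P \<in> H" and q: "q \<in> A P"
  shows "\<bar>det (matrix (F' P q))\<bar> = pi * (visible D x (plane_chart P q) * vf_kernel D x (plane_chart P q))"
proof -
  have PP: "P \<in> planes" using P H by auto
  define y where "y = plane_chart P q"
  have y: "y \<in> frontier D - crossings H" "y \<noteq> x" "open_segment x y \<subseteq> D"
    using q by (auto simp: A_def seen_def y_def)
  have "y \<in> P" using plane_chart_in[OF PP] by (simp add: y_def)
  have "Q = P" if "Q \<in> H" "y \<in> Q" for Q
    using that P \<open>y \<in> P\<close> y(1) unfolding crossings_def by blast
  then obtain m where m: "outer_unit_normal D y m" "P = {z. m \<bullet> (z - y) = 0}"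
    using flat_domain_half_ball[OF D H, of y P] y(1) P \<open>y \<in> P\<close> by (metis DiffD1)
  have nm: "norm m = 1" using m(1) by (simp add: outer_unit_normal_def)
  have yreg: "y \<in> reg_frontier D" using reg_frontierI[OF _ m(1)] y(1) by blast
  obtain e1 e2 where e: "norm e1 = 1" "norm e2 = 1" "e1 \<bullet> e2 = 0"
      "\<And>q. plane_chart P q = plane_chart P 0 + q $ 1 *\<^sub>R e1 + q $ 2 *\<^sub>R e2"
    using plane_chart_affine[OF PP] by metis
  define u where "u = y - x"
  have u: "u \<noteq> 0" using y by (simp add: u_def)
  have "plane_chart P h - plane_chart P 0 = h $ 1 *\<^sub>R e1 + h $ 2 *\<^sub>R e2" for h
    using e(4)[of h] by simp
  then have "F' P q = (\<lambda>h. nusselt_deriv a b u (h $ 1 *\<^sub>R e1 + h $ 2 *\<^sub>R e2))"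
    by (simp add: F'_def fun_eq_iff u_def y_def)
  then have "det (matrix (F' P q)) = (u \<bullet> (e1 \<times> e2)) * (u \<bullet> (a \<times> b)) / (u \<bullet> u)\<^sup>2"
    using det_nusselt[OF u] by simp
  moreover have "e1 \<times> e2 = m \<or> e1 \<times> e2 = - m"
    using plane_chart_normal(3)[OF PP \<open>y \<in> P\<close> nm m(2) e] .
  moreover have "a \<times> b = n \<or> a \<times> b = - n" using cross_orthonormal[OF on] .
  ultimately have "\<bar>det (matrix (F' P q))\<bar> = \<bar>(u \<bullet> m) * (u \<bullet> n) / (u \<bullet> u)\<^sup>2\<bar>"
    by auto
  moreover have "vf_kernel D x y = - (u \<bullet> m) * (u \<bullet> n) / (pi * (u \<bullet> u)\<^sup>2)"
    unfolding u_def by (rule vf_kernel_regular[OF x n yreg m(1)])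
  then have "\<bar>(u \<bullet> m) * (u \<bullet> n) / (u \<bullet> u)\<^sup>2\<bar> = pi * \<bar>vf_kernel D x y\<bar>"
    by (simp add: abs_mult abs_divide)
  moreover have "visible D x y = 1" using y by (simp add: visible_def)
  then have "\<bar>vf_kernel D x y\<bar> = visible D x y * vf_kernel D x y"
    using visible_kernel_nonneg[of D x y] by simp
  ultimately show ?thesis by (simp add: y_def)
qed

lemma F_image_measurable:
  assumes P: "P \<in> H"
  shows "F P ` A P \<in> lmeasurable"
proof (rule bounded_set_imp_lmeasurable)
  have PP: "P \<in> planes" using P H by auto
  show "bounded (F P ` A P)" using F_ball bounded_ball bounded_subset by blast
  have "F P differentiable_on A P"
    unfolding differentiable_on_def
  proof
    fix q assume "q \<in> A P"
    then have "plane_chart P q \<noteq> x" by (auto simp: A_def seen_def)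
    from F_deriv[OF PP this] show "F P differentiable at q within A P"
      unfolding differentiable_def by blast
  qed
  moreover have "A P \<in> sets lebesgue" using A_borel[OF PP] by auto
  ultimately show "F P ` A P \<in> sets lebesgue"
    by (intro differentiable_image_in_sets_lebesgue) auto
qed

text \<open>Change of variables for the injective differentiable map \<open>F P\<close> on
  \<open>A P\<close>, read from right to left: the integral of the Jacobian is the area of the image
  in the disc.\<close>

lemma integral_plane:
  assumes P: "P \<in> H"
  shows "(\<integral>\<^sup>+ y. ennreal (visible D x y * vf_kernel D x y) * indicator (frontier D - crossings H) y * indicator P y
      \<partial>surface_measure) = ennreal (measure lebesgue (F P ` A P) / pi)"
proof -
  have PP: "P \<in> planes" using P H by auto
  let ?k = "\<lambda>y. visible D x y * vf_kernel D x y"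
  have AL: "A P \<in> sets lebesgue" using A_borel[OF PP] by auto
  have "((\<lambda>q. \<bar>det (matrix (F' P q))\<bar>) has_integral measure lebesgue (F P ` A P)) (A P)"
  proof (rule has_measure_differentiable_image[THEN iffD1])
    show "A P \<in> sets lebesgue" by fact
    show "inj_on (F P) (A P)" using F_inj[OF PP] .
    show "F P ` A P \<in> lmeasurable \<and> measure lebesgue (F P ` A P) = measure lebesgue (F P ` A P)"
      using F_image_measurable[OF P] by simp
    fix q assume "q \<in> A P"
    then have "plane_chart P q \<noteq> x" by (auto simp: A_def seen_def)
    then show "(F P has_derivative F' P q) (at q within A P)" by (rule F_deriv[OF PP])
  qed
  then have "((\<lambda>q. pi * ?k (plane_chart P q)) has_integral measure lebesgue (F P ` A P)) (A P)"
    using det_F[OF P] by (rule has_integral_eq[rotated]) simp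
  then have "((\<lambda>q. pi * ?k (plane_chart P q) / pi) has_integral measure lebesgue (F P ` A P) / pi) (A P)"
    by (rule has_integral_divide)
  then have "((\<lambda>q. ?k (plane_chart P q)) has_integral measure lebesgue (F P ` A P) / pi) (A P)"
    by simp
  then have "(\<integral>\<^sup>+ q. ennreal (indicator (A P) q * ?k (plane_chart P q)) \<partial>lborel)
      = ennreal (measure lebesgue (F P ` A P) / pi)"
    by (rule nn_integral_has_integral_lebesgue[rotated]) (rule visible_kernel_nonneg)
  moreover have "(\<integral>\<^sup>+ y. ennreal (?k y) * indicator (frontier D - crossings H) y * indicator P y \<partial>surface_measure)
      = (\<integral>\<^sup>+ q. ennreal (?k (plane_chart P q)) * indicator (frontier D - crossings H) (plane_chart P q) \<partial>lborel)"
  proof (rule nn_integral_surface_plane[OF PP])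
    have "Pair x \<in> borel \<rightarrow>\<^sub>M borel \<Otimes>\<^sub>M borel" by measurable
    from measurable_compose[OF this visible_kernel_measurable[OF open_D]]
    have "?k \<in> borel_measurable borel" by simp
    then show "(\<lambda>y. ennreal (?k y) * indicator (frontier D - crossings H) y) \<in> borel_measurable borel"
      using crossings_borel by (intro borel_measurable_times_ennreal borel_measurable_indicator
          measurable_compose[OF _ measurable_ennreal] sets.Diff borel_closed[OF frontier_closed]) auto
  qed
  moreover have "ennreal (?k (plane_chart P q)) * indicator (frontier D - crossings H) (plane_chart P q)
      = ennreal (indicator (A P) q * ?k (plane_chart P q))" for q
    by (auto simp: A_def seen_def visible_def indicator_def)
  ultimately show ?thesis by simp
qed

text \<open>A point of the open disc is a direction into \<open>D\<close>; since \<open>D\<close> is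
  bounded, the ray meets the frontier in a first point, which is visible. If the disc point is
  missed by all images, this point must be a crossing.\<close>

lemma disc_covered:
  "ball 0 1 - (\<Union>P\<in>H. F P ` A P) \<subseteq> (\<Union>P\<in>H. \<Union>Q\<in>H - {P}. F P ` (plane_chart P -` Q - plane_chart P -` {x}))"
proof
  fix p assume p: "p \<in> ball 0 1 - (\<Union>P\<in>H. F P ` A P)"
  then have "norm p < 1" by simp
  then obtain v where v: "norm v = 1" "v \<bullet> n < 0" "\<And>t. t > 0 \<Longrightarrow> nusselt a b (t *\<^sub>R v) = p"
    using nusselt_surj[OF on] by metis
  obtain r where r: "r > 0" "D \<inter> ball x r = {y \<in> ball x r. n \<bullet> (y - x) < 0}"
    using n unfolding outer_unit_normal_def by auto
  have near: "x + t *\<^sub>R v \<in> D" if "0 < t" "t < r" for t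
  proof -
    have "x + t *\<^sub>R v \<in> ball x r" using that v(1) by (simp add: dist_norm)
    moreover have "n \<bullet> (x + t *\<^sub>R v - x) < 0"
      using that v(2) by (simp add: mult_pos_neg inner_commute)
    ultimately show ?thesis using r(2) by blast
  qed
  \<comment> \<open>\<open>x\<close> is not interior to \<open>D\<close>, so the search for the
    frontier starts at a point of the ray inside the half ball.\<close>
  define z where "z = x + (r / 2) *\<^sub>R v"
  have "z \<in> interior D" using near[of "r / 2"] r(1) open_D by (simp add: z_def interior_open)
  moreover have "v \<noteq> 0" using v(1) by auto
  ultimately obtain d where d: "d > 0" "z + d *\<^sub>R v \<in> frontier D"
      "\<And>e. 0 \<le> e \<Longrightarrow> e < d \<Longrightarrow> z + e *\<^sub>R v \<in> interior D"
    using ray_to_frontier[OF bounded_D] by metis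
  define T where "T = r / 2 + d"
  have T: "T > 0" using r(1) d(1) by (simp add: T_def)
  define y where "y = x + T *\<^sub>R v"
  have yz: "y = z + d *\<^sub>R v" by (simp add: y_def z_def T_def algebra_simps)
  have inside: "x + t *\<^sub>R v \<in> D" if "0 < t" "t < T" for t
  proof (cases "t < r")
    case True
    then show ?thesis using near that by blast
  next
    case False
    have "x + t *\<^sub>R v = z + (t - r / 2) *\<^sub>R v" by (simp add: z_def algebra_simps)
    moreover have "z + (t - r / 2) *\<^sub>R v \<in> interior D"
      using that False r(1) by (intro d(3)) (auto simp: T_def)
    ultimately show ?thesis using interior_subset by auto
  qed
  have yx: "y \<noteq> x" using T \<open>v \<noteq> 0\<close> by (simp add: y_def)
  have vis: "open_segment x y \<subseteq> D"
    unfolding open_segment_subset_iff[OF yx[symmetric]]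
  proof (intro allI impI)
    fix t :: real assume t: "0 < t \<and> t < 1"
    have "(1 - t) *\<^sub>R x + t *\<^sub>R y = x + (t * T) *\<^sub>R v" by (simp add: y_def algebra_simps)
    moreover have "0 < t * T" "t * T < T" using t T by simp_all
    ultimately show "(1 - t) *\<^sub>R x + t *\<^sub>R y \<in> D" using inside by simp
  qed
  have yfr: "y \<in> frontier D" using d(2) yz by simp
  then obtain P where P: "P \<in> H" "y \<in> P" using H by blast
  have PP: "P \<in> planes" using P H by auto
  obtain q where q: "y = plane_chart P q" using P(2) range_plane_chart[OF PP] by blast
  have pF: "p = F P q"
    unfolding F_def q[symmetric] using v(3)[OF T] by (simp add: y_def)
  have "y \<in> crossings H"
  proof (rule ccontr)
    assume "y \<notin> crossings H"
    then have "q \<in> A P" using yfr yx vis by (simp add: A_def seen_def q)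
    then show False using p P(1) pF by blast
  qed
  then obtain P' Q' where PQ: "P' \<in> H" "Q' \<in> H" "P' \<noteq> Q'" "y \<in> P'" "y \<in> Q'"
    unfolding crossings_def by blast
  obtain Q where Q: "Q \<in> H - {P}" "y \<in> Q"
  proof (cases "P' = P")
    case True
    then show thesis using that[of Q'] PQ by auto
  next
    case False
    then show thesis using that[of P'] PQ by auto
  qed
  have "q \<in> plane_chart P -` Q - plane_chart P -` {x}" using Q yx q by simp
  then show "p \<in> (\<Union>P\<in>H. \<Union>Q\<in>H - {P}. F P ` (plane_chart P -` Q - plane_chart P -` {x}))"
    using P(1) Q(1) pF by blast
qed

text \<open>Differentiable maps of \<open>real ^ 2\<close> into itself preserve negligible sets, and
  distinct planes have negligible intersection in the chart. The preimage of \<open>x\<close> is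
  removed because the radial projection is singular there.\<close>

lemma disc_rest_negligible: "negligible (ball 0 1 - (\<Union>P\<in>H. F P ` A P))"
proof (rule negligible_subset[OF _ disc_covered])
  have "negligible (F P ` (plane_chart P -` Q - plane_chart P -` {x}))" if "P \<in> H" "Q \<in> H - {P}" for P Q
  proof (rule negligible_differentiable_image_negligible)
    have PP: "P \<in> planes" "Q \<in> planes" using that H by auto
    have "negligible (plane_chart P -` Q)" using planes_Int_negligible PP that by blast
    then show "negligible (plane_chart P -` Q - plane_chart P -` {x})"
      using negligible_subset Diff_subset by metis
    show "F P differentiable_on (plane_chart P -` Q - plane_chart P -` {x})"
      unfolding differentiable_on_def
    proof
      fix q assume "q \<in> plane_chart P -` Q - plane_chart P -` {x}"
      then have "plane_chart P q \<noteq> x" by simp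
      from F_deriv[OF PP(1) this]
      show "F P differentiable at q within (plane_chart P -` Q - plane_chart P -` {x})"
        unfolding differentiable_def by blast
    qed
  qed simp
  then show "negligible (\<Union>P\<in>H. \<Union>Q\<in>H - {P}. F P ` (plane_chart P -` Q - plane_chart P -` {x}))"
    using H(1) by (auto intro!: negligible_Union)
qed

lemma sum_images: "(\<Sum>P\<in>H. measure lebesgue (F P ` A P)) = pi"
proof -
  let ?U = "\<Union>P\<in>H. F P ` A P"
  have "(\<Sum>P\<in>H. measure lebesgue (F P ` A P)) = measure lebesgue ?U"
  proof (rule measure_UNION'[symmetric])
    show "pairwise (\<lambda>P Q. disjnt (F P ` A P) (F Q ` A Q)) H"
      using F_disjoint by (simp add: pairwise_def disjnt_def)
  qed (use H(1) F_image_measurable in auto)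
  also have "\<dots> = measure lebesgue (ball 0 1 :: (real ^ 2) set)"
  proof (rule measure_negligible_symdiff[symmetric])
    show "?U \<in> lmeasurable"
      using H(1) F_image_measurable by (intro fmeasurable.finite_UN) auto
    have "?U - ball 0 1 = {}" using F_ball by blast
    then show "negligible (?U - ball 0 1 \<union> (ball 0 1 - ?U))" using disc_rest_negligible by simp
  qed
  also have "\<dots> = pi"
    using content_ball[of 1 "0 :: real ^ 2"] by (simp add: unit_ball_vol_2)
  finally show ?thesis .
qed

theorem total_view:
  "(\<integral>\<^sup>+ y. ennreal (visible D x y * vf_kernel D x y) * indicator (frontier D) y \<partial>surface_measure) = 1"
proof -
  let ?k = "\<lambda>y. ennreal (visible D x y * vf_kernel D x y)"
  let ?C = "frontier D - crossings H"
  have "Pair x \<in> borel \<rightarrow>\<^sub>M borel \<Otimes>\<^sub>M borel" by measurable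
  from measurable_compose[OF this visible_kernel_measurable[OF open_D]]
  have "(\<lambda>y. visible D x y * vf_kernel D x y) \<in> borel_measurable borel" by simp
  then have k: "?k \<in> borel_measurable borel" by measurable
  have C: "?C \<in> sets borel" using crossings_borel by (intro sets.Diff borel_closed[OF frontier_closed])
  \<comment> \<open>Off the crossings exactly one plane of \<open>H\<close> contains a given
    frontier point.\<close>
  have split: "(\<Sum>P\<in>H. ?k y * indicator ?C y * indicator P y) = ?k y * indicator (frontier D) y"
    if "y \<notin> crossings H" for y
  proof (cases "y \<in> frontier D")
    case True
    then obtain P where P: "P \<in> H" "y \<in> P" using H by blast
    have "Q \<notin> H \<or> y \<notin> Q" if "Q \<noteq> P" for Q
      using that P \<open>y \<notin> crossings H\<close> unfolding crossings_def by blast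
    then have "(\<Sum>Q\<in>H. ?k y * indicator ?C y * indicator Q y) = (\<Sum>Q\<in>H. if Q = P then ?k y else 0)"
      using P True that by (intro sum.cong) (auto simp: indicator_def)
    then show ?thesis using P(1) H(1) True by simp
  qed simp
  have "(\<integral>\<^sup>+ y. ?k y * indicator (frontier D) y \<partial>surface_measure)
      = (\<integral>\<^sup>+ y. (\<Sum>P\<in>H. ?k y * indicator ?C y * indicator P y) \<partial>surface_measure)"
    by (intro nn_integral_cong_AE AE_I'[OF crossings_null[OF H(1,2)]]) (use split in force)
  also have "\<dots> = (\<Sum>P\<in>H. \<integral>\<^sup>+ y. ?k y * indicator ?C y * indicator P y \<partial>surface_measure)"
    using k C H(2) planes_borel by (intro nn_integral_sum) (auto intro!: borel_measurable_times_ennreal borel_measurable_indicator)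
  also have "\<dots> = (\<Sum>P\<in>H. ennreal (measure lebesgue (F P ` A P) / pi))"
    by (intro sum.cong refl integral_plane)
  also have "\<dots> = ennreal (\<Sum>P\<in>H. measure lebesgue (F P ` A P) / pi)"
    by (simp add: sum_ennreal)
  also have "(\<Sum>P\<in>H. measure lebesgue (F P ` A P) / pi) = 1"
    using sum_images by (simp add: sum_divide_distrib[symmetric])
  finally show ?thesis by simp
qed

end

section \<open>Row sums of the view factors\<close>

lemma id_measurable_restrict_surface: "(\<lambda>x. x) \<in> restrict_space surface_measure A \<rightarrow>\<^sub>M borel"
  by (intro measurable_restrict_space1 measurable_ident_sets) simp

lemma kernel_measurable_restrict:
  assumes "open D"
  shows "(\<lambda>z. visible D (fst z) (snd z) * vf_kernel D (fst z) (snd z))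
    \<in> borel_measurable (restrict_space surface_measure A \<Otimes>\<^sub>M restrict_space surface_measure B)"
proof -
  let ?M = "restrict_space surface_measure A \<Otimes>\<^sub>M restrict_space surface_measure B"
  have "fst \<in> ?M \<rightarrow>\<^sub>M borel"
    by (rule measurable_compose[OF measurable_fst id_measurable_restrict_surface])
  moreover have "snd \<in> ?M \<rightarrow>\<^sub>M borel"
    by (rule measurable_compose[OF measurable_snd id_measurable_restrict_surface])
  ultimately have "(\<lambda>z. (fst z, snd z)) \<in> ?M \<rightarrow>\<^sub>M borel \<Otimes>\<^sub>M borel"
    by (rule measurable_Pair)
  from measurable_compose[OF this visible_kernel_measurable[OF assms]] show ?thesis by simp
qed

lemma restrict_surface_finite:
  assumes "flat_domain D" "A \<subseteq> frontier D" "A \<in> sets borel"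
  shows "emeasure surface_measure A < \<infinity>" "finite_measure (restrict_space surface_measure A)"
proof -
  obtain H where H: "finite H" "H \<subseteq> planes" "frontier D \<subseteq> \<Union>H"
    using assms unfolding flat_domain_def by blast
  have "bounded (frontier D)"
    using assms(1) unfolding flat_domain_def frontier_def by (meson Diff_subset bounded_closure bounded_subset)
  then have "bounded A" using assms(2) bounded_subset by blast
  moreover have "A \<subseteq> \<Union>H" using assms(2) H(3) by (rule subset_trans)
  ultimately show fin: "emeasure surface_measure A < \<infinity>"
    using assms(3) H by (intro surface_bounded_finite[of H])
  have "emeasure (restrict_space surface_measure A) (space (restrict_space surface_measure A)) = emeasure surface_measure A"
    using assms by (subst emeasure_restrict_space) (auto simp: space_restrict_space)
  then show "finite_measure (restrict_space surface_measure A)"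
    using fin by (intro finite_measureI) auto
qed

text \<open>The kernel is nonnegative where it is visible and the surface measure restricted to
  \<open>B\<close> is finite, so Tonelli's theorem turns the product integral into an iterated
  one.\<close>

lemma view_factor_eq_nn_integral:
  assumes D: "flat_domain D" and A: "A \<subseteq> frontier D" "A \<in> sets borel" and B: "B \<subseteq> frontier D" "B \<in> sets borel"
  shows "view_factor D A B = enn2real (\<integral>\<^sup>+ x. (\<integral>\<^sup>+ y. ennreal (visible D x y * vf_kernel D x y)
      \<partial>restrict_space surface_measure B) \<partial>restrict_space surface_measure A)"
    and "(\<lambda>x. \<integral>\<^sup>+ y. ennreal (visible D x y * vf_kernel D x y) \<partial>restrict_space surface_measure B)
      \<in> borel_measurable (restrict_space surface_measure A)"
proof -
  let ?A = "restrict_space surface_measure A" and ?B = "restrict_space surface_measure B"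
  let ?k = "\<lambda>z. visible D (fst z) (snd z) * vf_kernel D (fst z) (snd z)"
  have "open D" using D by (simp add: flat_domain_def)
  note meas = kernel_measurable_restrict[OF this, of A B]
  interpret B: finite_measure ?B using restrict_surface_finite[OF D B] by simp
  have meas': "(\<lambda>z. ennreal (?k z)) \<in> borel_measurable (?A \<Otimes>\<^sub>M ?B)" using meas by measurable
  have "view_factor D A B = enn2real (\<integral>\<^sup>+ z. ennreal (?k z) \<partial>(?A \<Otimes>\<^sub>M ?B))"
    unfolding view_factor_def using meas by (intro integral_eq_nn_integral) (auto simp: visible_kernel_nonneg)
  also have "(\<integral>\<^sup>+ z. ennreal (?k z) \<partial>(?A \<Otimes>\<^sub>M ?B)) = (\<integral>\<^sup>+ x. (\<integral>\<^sup>+ y. ennreal (?k (x, y)) \<partial>?B) \<partial>?A)"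
    by (rule B.nn_integral_fst[OF meas', symmetric])
  finally show "view_factor D A B = enn2real (\<integral>\<^sup>+ x. (\<integral>\<^sup>+ y. ennreal (visible D x y * vf_kernel D x y) \<partial>?B) \<partial>?A)"
    by simp
  show "(\<lambda>x. \<integral>\<^sup>+ y. ennreal (visible D x y * vf_kernel D x y) \<partial>?B) \<in> borel_measurable ?A"
    using B.borel_measurable_nn_integral_fst[OF meas'] by simp
qed

lemma view_factor_nonneg: "0 \<le> view_factor D A B"
  unfolding view_factor_def by (intro integral_nonneg_AE AE_I2 visible_kernel_nonneg)

lemma total_view_reg_frontier:
  assumes D: "flat_domain D" and x: "x \<in> reg_frontier D"
  shows "(\<integral>\<^sup>+ y. ennreal (visible D x y * vf_kernel D x y) * indicator (frontier D) y \<partial>surface_measure) = 1"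
proof -
  obtain H where H: "finite H" "H \<subseteq> planes" "frontier D \<subseteq> \<Union>H"
    using D unfolding flat_domain_def by blast
  obtain n where n: "outer_unit_normal D x n" "norm n = 1"
    using reg_frontierE[OF x] by metis
  obtain a b where "norm a = 1" "norm b = 1" "a \<bullet> b = 0" "a \<bullet> n = 0" "b \<bullet> n = 0"
    using tangent_basis_exists[OF n(2)] by metis
  then have "nusselt_view D H x n a b"
    unfolding nusselt_view_def using D H x n by simp
  then show ?thesis by (rule nusselt_view.total_view)
qed

text \<open>The pieces cover the frontier once almost everywhere, so for almost every
  \<open>x\<close> the inner integrals add up to the total view 1; integration over
  \<open>E \<alpha>\<close> then gives its area.\<close>

theorem view_factor_sum:
  assumes D: "flat_domain D" and K: "finite K" "\<alpha> \<in> K"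
    and E: "\<And>\<beta>. \<beta> \<in> K \<Longrightarrow> E \<beta> \<subseteq> frontier D" "\<And>\<beta>. \<beta> \<in> K \<Longrightarrow> E \<beta> \<in> sets borel"
    and ae: "AE y in surface_measure. y \<in> frontier D \<longrightarrow> (\<exists>!\<beta>. \<beta> \<in> K \<and> y \<in> E \<beta>)"
  shows "(\<Sum>\<beta>\<in>K. view_factor D (E \<alpha>) (E \<beta>)) = area (E \<alpha>)"
proof -
  let ?k = "\<lambda>x y. ennreal (visible D x y * vf_kernel D x y)"
  let ?R = "\<lambda>\<beta>. restrict_space surface_measure (E \<beta>)"
  have opn: "open D" using D by (simp add: flat_domain_def)
  have meas: "?k x \<in> borel_measurable borel" for x
  proof -
    have "Pair x \<in> borel \<rightarrow>\<^sub>M borel \<Otimes>\<^sub>M borel" by measurable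
    from measurable_compose[OF this visible_kernel_measurable[OF opn]]
    have "(\<lambda>y. visible D x y * vf_kernel D x y) \<in> borel_measurable borel" by simp
    then show ?thesis by measurable
  qed
  have ind: "(\<Sum>\<beta>\<in>K. c * indicator (E \<beta>) y) = c * indicator (frontier D) y"
    if y: "y \<in> frontier D \<longrightarrow> (\<exists>!\<beta>. \<beta> \<in> K \<and> y \<in> E \<beta>)" for y and c :: ennreal
  proof (cases "y \<in> frontier D")
    case True
    then have ex1: "\<exists>!\<beta>. \<beta> \<in> K \<and> y \<in> E \<beta>" using y by simp
    then obtain \<beta> where \<beta>: "\<beta> \<in> K" "y \<in> E \<beta>" by blast
    have uniq: "\<gamma> = \<beta>" if "\<gamma> \<in> K" "y \<in> E \<gamma>" for \<gamma> using ex1 \<beta> that by blast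
    have "(\<Sum>\<gamma>\<in>K. c * indicator (E \<gamma>) y) = (\<Sum>\<gamma>\<in>K. if \<gamma> = \<beta> then c else 0)"
    proof (intro sum.cong refl)
      fix \<gamma> assume "\<gamma> \<in> K"
      then have "y \<in> E \<gamma> \<longleftrightarrow> \<gamma> = \<beta>" using uniq \<beta>(2) by blast
      then show "c * indicator (E \<gamma>) y = (if \<gamma> = \<beta> then c else 0)" by (simp add: indicator_def)
    qed
    then show ?thesis using \<beta>(1) K(1) True by simp
  next
    case False
    then have "y \<notin> E \<beta>" if "\<beta> \<in> K" for \<beta> using E(1) that by blast
    then show ?thesis using False by simp
  qed
  have restr: "(\<integral>\<^sup>+ y. ?k x y \<partial>?R \<beta>) = (\<integral>\<^sup>+ y. ?k x y * indicator (E \<beta>) y \<partial>surface_measure)" if "\<beta> \<in> K" for x \<beta>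
    using E(2)[OF that] by (intro nn_integral_restrict_space) simp
  have inner: "(\<Sum>\<beta>\<in>K. \<integral>\<^sup>+ y. ?k x y \<partial>?R \<beta>) = 1" if x: "x \<in> reg_frontier D" for x
  proof -
    have "(\<Sum>\<beta>\<in>K. \<integral>\<^sup>+ y. ?k x y \<partial>?R \<beta>) = (\<Sum>\<beta>\<in>K. \<integral>\<^sup>+ y. ?k x y * indicator (E \<beta>) y \<partial>surface_measure)"
      by (intro sum.cong refl restr)
    also have "\<dots> = (\<integral>\<^sup>+ y. (\<Sum>\<beta>\<in>K. ?k x y * indicator (E \<beta>) y) \<partial>surface_measure)"
    proof (rule nn_integral_sum[symmetric])
      fix \<beta> assume "\<beta> \<in> K"
      then show "(\<lambda>y. ?k x y * indicator (E \<beta>) y) \<in> borel_measurable surface_measure"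
        using meas[of x] E(2) by (intro borel_measurable_times_ennreal borel_measurable_indicator) auto
    qed
    also have "\<dots> = (\<integral>\<^sup>+ y. ?k x y * indicator (frontier D) y \<partial>surface_measure)"
    proof (rule nn_integral_cong_AE)
      show "AE y in surface_measure. (\<Sum>\<beta>\<in>K. ?k x y * indicator (E \<beta>) y) = ?k x y * indicator (frontier D) y"
        using ae by eventually_elim (rule ind)
    qed
    also have "\<dots> = 1" by (rule total_view_reg_frontier[OF D x])
    finally show ?thesis .
  qed
  have fin: "(\<Sum>\<beta>\<in>K. \<integral>\<^sup>+ x. (\<integral>\<^sup>+ y. ?k x y \<partial>?R \<beta>) \<partial>?R \<alpha>) = emeasure surface_measure (E \<alpha>)"
  proof -
    have "(\<Sum>\<beta>\<in>K. \<integral>\<^sup>+ x. (\<integral>\<^sup>+ y. ?k x y \<partial>?R \<beta>) \<partial>?R \<alpha>)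
        = (\<integral>\<^sup>+ x. (\<Sum>\<beta>\<in>K. \<integral>\<^sup>+ y. ?k x y \<partial>?R \<beta>) \<partial>?R \<alpha>)"
      using view_factor_eq_nn_integral(2)[OF D E(1)[OF K(2)] E(2)[OF K(2)]] E
      by (intro nn_integral_sum[symmetric]) simp
    also have "\<dots> = (\<integral>\<^sup>+ x. 1 \<partial>?R \<alpha>)"
    proof (rule nn_integral_cong_AE)
      have "AE x in surface_measure. x \<in> frontier D \<longrightarrow> x \<in> reg_frontier D"
        using AE_flat_domain_normal[OF D] by eventually_elim (use reg_frontierI in blast)
      then have "AE x in surface_measure. x \<in> E \<alpha> \<longrightarrow> x \<in> reg_frontier D"
        by eventually_elim (use E(1)[OF K(2)] in blast)
      then have "AE x in ?R \<alpha>. x \<in> reg_frontier D"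
        using E(2)[OF K(2)] by (subst AE_restrict_space_iff) auto
      then show "AE x in ?R \<alpha>. (\<Sum>\<beta>\<in>K. \<integral>\<^sup>+ y. ?k x y \<partial>?R \<beta>) = 1"
        by eventually_elim (rule inner)
    qed
    also have "\<dots> = emeasure surface_measure (E \<alpha>)"
      using E(2)[OF K(2)] by (simp add: space_restrict_space emeasure_restrict_space)
    finally show ?thesis .
  qed
  have "emeasure surface_measure (E \<alpha>) < \<infinity>"
    using restrict_surface_finite(1)[OF D E(1)[OF K(2)] E(2)[OF K(2)]] .
  \<comment> \<open>\<open>enn2real\<close> is additive only on finite values; each summand is
    bounded by the whole sum, which is a finite area.\<close>
  then have less: "(\<integral>\<^sup>+ x. (\<integral>\<^sup>+ y. ?k x y \<partial>?R \<beta>) \<partial>?R \<alpha>) < top" if "\<beta> \<in> K" for \<beta>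
  proof -
    have "(\<integral>\<^sup>+ x. (\<integral>\<^sup>+ y. ?k x y \<partial>?R \<beta>) \<partial>?R \<alpha>) \<le> (\<Sum>\<beta>\<in>K. \<integral>\<^sup>+ x. (\<integral>\<^sup>+ y. ?k x y \<partial>?R \<beta>) \<partial>?R \<alpha>)"
      using that K(1) by (intro member_le_sum) auto
    also have "\<dots> < top" unfolding fin using \<open>emeasure surface_measure (E \<alpha>) < \<infinity>\<close> by simp
    finally show ?thesis .
  qed
  have "(\<Sum>\<beta>\<in>K. view_factor D (E \<alpha>) (E \<beta>)) = (\<Sum>\<beta>\<in>K. enn2real (\<integral>\<^sup>+ x. (\<integral>\<^sup>+ y. ?k x y \<partial>?R \<beta>) \<partial>?R \<alpha>))"
    using E K by (intro sum.cong refl view_factor_eq_nn_integral(1) D) auto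
  also have "\<dots> = enn2real (\<Sum>\<beta>\<in>K. \<integral>\<^sup>+ x. (\<integral>\<^sup>+ y. ?k x y \<partial>?R \<beta>) \<partial>?R \<alpha>)"
    by (subst enn2real_sum) (simp_all add: less comp_def)
  also have "\<dots> = area (E \<alpha>)" unfolding fin measure_def ..
  finally show ?thesis .
qed

section \<open>Boundary elements\<close>

lemma plane_chart_ball:
  assumes P: "P \<in> planes"
  shows "plane_chart P ` ball q r = P \<inter> ball (plane_chart P q) r"
proof
  show "plane_chart P ` ball q r \<subseteq> P \<inter> ball (plane_chart P q) r"
    using plane_chart_in[OF P] by (auto simp: dist_plane_chart[OF P])
  show "P \<inter> ball (plane_chart P q) r \<subseteq> plane_chart P ` ball q r"
  proof
    fix y assume y: "y \<in> P \<inter> ball (plane_chart P q) r"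
    then obtain p where "y = plane_chart P p" using range_plane_chart[OF P] by blast
    with y show "y \<in> plane_chart P ` ball q r" by (auto simp: dist_plane_chart[OF P])
  qed
qed

text \<open>For the null boundary: a point of \<open>closure S - S\<close> lies in some polytope
  \<open>C\<close> of the union. If it were interior to \<open>C\<close> within \<open>P\<close>, it
  would belong to \<open>S\<close>. In the chart it is thus a frontier point of a convex set, and
  such frontiers are negligible.\<close>

lemma polyhedral_in_plane:
  assumes P: "P \<in> planes" and S: "polyhedral_in P S"
  shows "S \<subseteq> P" "S \<in> sets borel" "bounded S" "closure S - S \<in> null_sets surface_measure"
    "S \<noteq> {} \<Longrightarrow> 0 < area S"
proof -
  obtain \<C> where C: "finite \<C>" "\<And>C. C \<in> \<C> \<Longrightarrow> polytope C \<and> C \<subseteq> P"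
    and S_eq: "S = top_of_set P interior_of (\<Union>\<C>)"
    using S unfolding polyhedral_in_def by blast
  have op: "openin (top_of_set P) S" unfolding S_eq by (rule openin_interior_of)
  then obtain T where T: "open T" "S = P \<inter> T" by (auto simp: openin_open)
  have sub: "S \<subseteq> \<Union>\<C>" unfolding S_eq by (rule interior_of_subset)
  have closed: "closed (\<Union>\<C>)" using C by (intro closed_Union) (auto simp: polytope_imp_closed)
  show SP: "S \<subseteq> P" using T by blast
  show Sb: "S \<in> sets borel" unfolding T(2) by (intro sets.Int planes_borel P borel_open T(1))
  have "bounded (\<Union>\<C>)" using C by (intro bounded_Union) (auto simp: polytope_imp_bounded)
  then show bS: "bounded S" using sub bounded_subset by blast
  have clP: "closure S - S \<subseteq> P" using closure_minimal[OF SP planes_closed[OF P]] by blast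
  show "closure S - S \<in> null_sets surface_measure"
  proof (rule surface_null_if_negligible[OF P clP])
    show "closure S - S \<in> sets borel" using Sb by auto
    have "plane_chart P -` (closure S - S) \<subseteq> (\<Union>C\<in>\<C>. frontier (plane_chart P -` C))"
    proof
      fix q assume q: "q \<in> plane_chart P -` (closure S - S)"
      then have "plane_chart P q \<in> \<Union>\<C>" using closure_minimal[OF sub closed] by auto
      then obtain C where C': "C \<in> \<C>" "plane_chart P q \<in> C" by blast
      have "q \<notin> interior (plane_chart P -` C)"
      proof
        assume "q \<in> interior (plane_chart P -` C)"
        then obtain r where r: "r > 0" "ball q r \<subseteq> plane_chart P -` C" by (auto simp: mem_interior)
        then have "P \<inter> ball (plane_chart P q) r \<subseteq> \<Union>\<C>"
          unfolding plane_chart_ball[OF P, symmetric] using C'(1) by blast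
        moreover have "openin (top_of_set P) (P \<inter> ball (plane_chart P q) r)" by (intro openin_open_Int) simp
        ultimately have "P \<inter> ball (plane_chart P q) r \<subseteq> S"
          unfolding S_eq by (rule interior_of_maximal)
        moreover have "plane_chart P q \<in> P \<inter> ball (plane_chart P q) r" using plane_chart_in[OF P] r(1) by simp
        ultimately show False using q by blast
      qed
      moreover have "q \<in> closure (plane_chart P -` C)" using C'(2) closure_subset[of "plane_chart P -` C"] by blast
      ultimately show "q \<in> (\<Union>C\<in>\<C>. frontier (plane_chart P -` C))"
        using C'(1) by (auto simp: frontier_def)
    qed
    moreover have "negligible (\<Union>C\<in>\<C>. frontier (plane_chart P -` C))"
    proof (rule negligible_Union)
      show "finite ((\<lambda>C. frontier (plane_chart P -` C)) ` \<C>)" using C(1) by simp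
      fix X assume "X \<in> (\<lambda>C. frontier (plane_chart P -` C)) ` \<C>"
      then obtain C' where C': "C' \<in> \<C>" "X = frontier (plane_chart P -` C')" by blast
      then have "convex C'" using C(2) polytope_imp_convex by blast
      then show "negligible X"
        unfolding C'(2) by (intro negligible_convex_frontier convex_vimage_plane_chart P)
    qed
    ultimately show "negligible (plane_chart P -` (closure S - S))" by (rule negligible_subset[rotated])
  qed
  assume "S \<noteq> {}"
  then obtain y where y: "y \<in> S" by blast
  then obtain q where q: "y = plane_chart P q" using SP range_plane_chart[OF P] by blast
  obtain r where r: "r > 0" "ball y r \<subseteq> T" using T y openE by (metis IntD2)
  have "plane_chart P ` ball q r \<subseteq> S"
    unfolding plane_chart_ball[OF P] T(2) using r(2) q by blast
  then have "ball q r \<subseteq> plane_chart P -` S" by blast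
  moreover have "plane_chart P -` S \<in> sets borel" using sets_vimage_plane_chart[OF P Sb] .
  ultimately have "emeasure lborel (ball q r) \<le> emeasure lborel (plane_chart P -` S)"
    by (intro emeasure_mono) auto
  moreover have "0 < emeasure lborel (ball q r)"
    using emeasure_ball[of r q] r(1) by simp
  ultimately have "0 < emeasure surface_measure S"
    unfolding emeasure_surface_plane[OF P SP Sb] by simp
  moreover have "emeasure surface_measure S < \<infinity>"
    using P SP bS Sb by (intro surface_bounded_finite[of "{P}"]) auto
  ultimately show "0 < area S" by (simp add: measure_def enn2real_positive_iff)
qed

section \<open>Combinatorics of an admissible scheme\<close>

lemma area_eq_0_if_AE:
  assumes "N \<in> sets borel" "AE x in surface_measure. x \<notin> N"
  shows "area N = 0"
  using assms AE_iff_null_sets[of N surface_measure] by (simp add: measure_eq_0_null_sets)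

lemma sum_area_AE:
  assumes J: "finite J" and f: "\<And>\<alpha>. \<alpha> \<in> J \<Longrightarrow> f \<alpha> \<in> sets borel"
    "\<And>\<alpha>. \<alpha> \<in> J \<Longrightarrow> emeasure surface_measure (f \<alpha>) < \<infinity>" "disjoint_family_on f J"
    and B: "B \<in> sets borel" "AE x in surface_measure. x \<in> B \<longleftrightarrow> (\<exists>\<alpha>\<in>J. x \<in> f \<alpha>)"
  shows "(\<Sum>\<alpha>\<in>J. area (f \<alpha>)) = area B"
proof -
  have "area (\<Union>\<alpha>\<in>J. f \<alpha>) = (\<Sum>\<alpha>\<in>J. area (f \<alpha>))"
  proof (rule measure_finite_Union[OF J])
    show "f ` J \<subseteq> sets surface_measure" using f(1) by auto
    show "emeasure surface_measure (f \<alpha>) \<noteq> \<infinity>" if "\<alpha> \<in> J" for \<alpha>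
      using f(2)[OF that] by simp
  qed (rule f(3))
  moreover have "area (\<Union>\<alpha>\<in>J. f \<alpha>) = area B"
  proof (rule measure_eq_AE)
    show "AE x in surface_measure. (x \<in> (\<Union>\<alpha>\<in>J. f \<alpha>)) = (x \<in> B)"
      using B(2) by eventually_elim auto
    show "(\<Union>\<alpha>\<in>J. f \<alpha>) \<in> sets surface_measure"
      using J f(1) by (intro sets.finite_UN) auto
  qed (use B in simp)
  ultimately show ?thesis by simp
qed

lemma flat_domain_negligible_frontier:
  assumes "flat_domain D"
  shows "frontier D \<in> null_sets lborel"
proof -
  obtain H where H: "finite H" "H \<subseteq> planes" "frontier D \<subseteq> \<Union>H"
    using assms unfolding flat_domain_def by blast
  have "negligible P" if "P \<in> H" for P
  proof -
    have "P \<in> planes" using that H by blast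
    then have "P \<noteq> {}" using plane_chart_in by blast
    then obtain x where "x \<in> P" by blast
    obtain n where n: "norm n = 1" "P = {y. n \<bullet> (y - x) = 0}"
      using plane_as_hyperplane[OF \<open>P \<in> planes\<close> \<open>x \<in> P\<close>] by metis
    then have "P = {y. n \<bullet> y = n \<bullet> x}" "n \<noteq> 0" by (auto simp: inner_diff_right)
    then show ?thesis using negligible_hyperplane by metis
  qed
  then have "negligible (\<Union>H)" using H(1) by (intro negligible_Union) auto
  then have "negligible (frontier D)" using H(3) negligible_subset by blast
  then show ?thesis
    using emeasure_lborel_eq_0_if_negligible[of "frontier D"] by (auto intro!: null_setsI)
qed

locale admissible_scheme =
  fixes d :: "('i, 'b) scheme"
  assumes adm: "admissible d"
begin

lemmas adm_parts = adm[unfolded admissible_def]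

lemma adm_domain: "admissible_domain d" and adm_data: "admissible_data d" and adm_time: "admissible_time d"
  and adm_cells: "admissible_cells d" and adm_faces: "admissible_faces d" and adm_values: "admissible_values d"
  using adm_parts by blast+

lemma flat_dom: "flat_domain (dom d)" and flat_phase: "flat_domain (phase_dom d m)"
  and dom_polyhedral: "polyhedral_in UNIV (dom d)" and dom_ne: "dom d \<noteq> {}"
proof -
  have *: "D \<noteq> {} \<and> polyhedral_in UNIV D" if "D \<in> {dom d, phase_dom d Solid, phase_dom d Gas}" for D
    using adm_domain that unfolding admissible_domain_def by blast
  show "polyhedral_in UNIV (dom d)" "dom d \<noteq> {}" "flat_domain (dom d)"
    using *[of "dom d"] flat_domain_polyhedral by auto
  show "flat_domain (phase_dom d m)"
    using * flat_domain_polyhedral by (cases m) auto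
qed

lemma closure_dom: "closure (dom d) = closure (phase_dom d Solid) \<union> closure (phase_dom d Gas)"
  and phases_disjoint: "phase_dom d Solid \<inter> phase_dom d Gas = {}"
  and frontier_solid: "frontier (phase_dom d Solid) = frontier (dom d) \<union> frontier (phase_dom d Gas)"
  and frontiers_disjoint: "frontier (dom d) \<inter> frontier (phase_dom d Gas) = {}"
  using adm_domain unfolding admissible_domain_def by blast+

lemma flat_cavity: "flat_domain (open_cavity d)"
  unfolding open_cavity_def
  by (intro flat_domain_exterior_part flat_dom polyhedral_convex_hull_polytope dom_polyhedral)

lemma finite_cells: "finite (cells d)" and cell_subset: "i \<in> cells d \<Longrightarrow> cell d i \<subseteq> dom d"
  and cells_disjoint: "i \<in> cells d \<Longrightarrow> j \<in> cells d \<Longrightarrow> i \<noteq> j \<Longrightarrow> cell d i \<inter> cell d j = {}"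
  and cells_ne: "cells d \<noteq> {}"
proof -
  have p: "partition_up_to_frontiers (cells d) (cell d) (dom d)"
    using adm_cells unfolding admissible_cells_def by blast
  then show "finite (cells d)" "i \<in> cells d \<Longrightarrow> cell d i \<subseteq> dom d"
    "i \<in> cells d \<Longrightarrow> j \<in> cells d \<Longrightarrow> i \<noteq> j \<Longrightarrow> cell d i \<inter> cell d j = {}"
    unfolding partition_up_to_frontiers_def disjoint_family_on_def by blast+
  show "cells d \<noteq> {}"
    using p dom_ne unfolding partition_up_to_frontiers_def by auto
qed

lemma flat_cell: "i \<in> cells d \<Longrightarrow> flat_domain (cell d i)"
  and cell_ne: "i \<in> cells d \<Longrightarrow> cell d i \<noteq> {}"
  using adm_cells flat_domain_polyhedral unfolding admissible_cells_def by blast+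

lemma reg_interface:
  "i \<in> cells d \<Longrightarrow> reg_frontier (phase_cell d Solid i) \<inter> interface d = reg_frontier (phase_cell d Gas i) \<inter> interface d"
  using adm_cells unfolding admissible_cells_def by blast

lemma flat_phase_cell: "i \<in> cells d \<Longrightarrow> flat_domain (phase_cell d m i)"
  unfolding phase_cell_def by (intro flat_domain_Int flat_cell flat_phase)

lemma flat_open: "flat_domain D \<Longrightarrow> open D" and flat_regular: "flat_domain D \<Longrightarrow> interior (closure D) = D"
  by (simp_all add: flat_domain_def)

lemma frontier_disj: "open D \<Longrightarrow> x \<in> frontier D \<Longrightarrow> x \<notin> D"
  by (simp add: frontier_def interior_open)

lemma phase_cell_subset: "phase_cell d m i \<subseteq> cell d i" "phase_cell d m i \<subseteq> phase_dom d m"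
  by (auto simp: phase_cell_def)

text \<open>A point of a cell outside the frontiers of both phases lies in one of the phases,
  because the phase closures cover the domain; these frontiers are null sets.\<close>

lemma vol_cell:
  assumes i: "i \<in> cells d"
  shows "vol (cell d i) = (\<Sum>m\<in>{Solid, Gas}. vol (phase_cell d m i))" "0 < vol (cell d i)"
proof -
  let ?S = "phase_cell d Solid i" and ?G = "phase_cell d Gas i"
  have op: "open (cell d i)" "open ?S" "open ?G" using flat_open flat_cell flat_phase_cell i by auto
  have bd: "bounded (cell d i)" "bounded ?S" "bounded ?G" using flat_cell flat_phase_cell i by (auto simp: flat_domain_def)
  have fin: "emeasure lborel (cell d i) \<noteq> \<infinity>" "emeasure lborel ?S \<noteq> \<infinity>" "emeasure lborel ?G \<noteq> \<infinity>"
    using emeasure_bounded_finite[OF bd(1)] emeasure_bounded_finite[OF bd(2)] emeasure_bounded_finite[OF bd(3)]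
    by auto
  let ?N = "frontier (phase_dom d Solid) \<union> frontier (phase_dom d Gas)"
  have N: "?N \<in> null_sets lborel"
    using flat_domain_negligible_frontier[OF flat_phase] by (intro null_sets.Un) auto
  have "vol (cell d i) = vol (?S \<union> ?G)"
  proof (rule measure_eq_AE)
    have "x \<in> ?S \<union> ?G" if "x \<in> cell d i" "x \<notin> ?N" for x
    proof -
      have "x \<in> closure (dom d)" using that cell_subset[OF i] closure_subset by blast
      then consider "x \<in> closure (phase_dom d Solid)" | "x \<in> closure (phase_dom d Gas)"
        unfolding closure_dom by blast
      then show ?thesis
        using that interior_subset by cases (auto simp: phase_cell_def frontier_def)
    qed
    then show "AE x in lborel. (x \<in> cell d i) = (x \<in> ?S \<union> ?G)"
      using phase_cell_subset(1) by (intro AE_I'[OF N]) auto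
  qed (use op in auto)
  also have "\<dots> = vol ?S + vol ?G"
    using op fin phases_disjoint by (intro measure_Union) (auto simp: phase_cell_def)
  finally show "vol (cell d i) = (\<Sum>m\<in>{Solid, Gas}. vol (phase_cell d m i))" by simp
  obtain x where "x \<in> cell d i" using cell_ne[OF i] by blast
  then obtain r where r: "r > 0" "ball x r \<subseteq> cell d i" using openE[OF op(1)] by metis
  have "0 < vol (ball x r)" using content_ball_gt_0_iff[of x r] r(1) by simp
  also have "\<dots> \<le> vol (cell d i)"
    using r op fin by (intro measure_mono_fmeasurable) (auto simp: fmeasurable_def less_top)
  finally show "0 < vol (cell d i)" .
qed

lemma Gamma_Omega_frontier_dom: "Gamma_Omega d \<subseteq> frontier (dom d)"
  and Gamma_Omega_frontier_cavity: "Gamma_Omega d \<subseteq> frontier (open_cavity d)"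
proof -
  have op: "open (dom d)" "open (open_cavity d)" using flat_open flat_dom flat_cavity by auto
  have disj: "dom d \<inter> open_cavity d = {}" unfolding open_cavity_def using closure_subset by blast
  have "x \<notin> dom d" if "x \<in> closure (open_cavity d)" for x
    using that open_Int_closure_eq_empty[OF op(1), of "open_cavity d"] disj by blast
  then show "Gamma_Omega d \<subseteq> frontier (dom d)"
    using op by (auto simp: Gamma_Omega_def frontier_def interior_open)
  have "x \<notin> open_cavity d" if "x \<in> closure (dom d)" for x
    using that unfolding open_cavity_def by blast
  then show "Gamma_Omega d \<subseteq> frontier (open_cavity d)"
    using op by (auto simp: Gamma_Omega_def frontier_def interior_open)
qed

lemma Gamma_Omega_borel: "Gamma_Omega d \<in> sets borel" and Gamma_ph_borel: "Gamma_ph d \<in> sets borel"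
  and interface_borel: "interface d \<in> sets borel"
  by (auto simp: Gamma_Omega_def Gamma_ph_def interface_def)

lemma
  shows finite_Omega: "finite (I_Omega d)" and finite_Sigma: "finite (I_Sigma d)"
    and faces_disjoint: "disjoint_family_on (face d) (I_Omega d)" "disjoint_family_on (face d) (I_Sigma d)"
    and face_Omega: "\<And>\<alpha>. \<alpha> \<in> I_Omega d \<Longrightarrow> face d \<alpha> \<subseteq> Gamma_Omega d"
    and face_Sigma: "\<And>\<alpha>. \<alpha> \<in> I_Sigma d \<Longrightarrow> face d \<alpha> \<subseteq> interface d"
    and cover_Omega: "Gamma_Omega d \<subseteq> (\<Union>\<alpha>\<in>I_Omega d. closure (face d \<alpha>))"
    and cover_Sigma: "interface d \<subseteq> (\<Union>\<alpha>\<in>I_Sigma d. closure (face d \<alpha>))"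
    and I_disjoint: "I_Omega d \<inter> I_Sigma d = {}" and ph_index: "ph_index d \<notin> I_Omega d" "ph_index d \<notin> I_Sigma d"
  using adm_faces unfolding admissible_faces_def partition_up_to_frontiers_def by blast+

lemma face_plane:
  assumes "\<alpha> \<in> I_Omega d \<union> I_Sigma d"
  shows "face d \<alpha> \<in> sets borel" "closure (face d \<alpha>) - face d \<alpha> \<in> null_sets surface_measure" "0 < area (face d \<alpha>)"
    "emeasure surface_measure (face d \<alpha>) < \<infinity>"
proof -
  have "face d \<alpha> \<noteq> {}" "\<exists>P\<in>planes. polyhedral_in P (face d \<alpha>)"
    using adm_faces assms unfolding admissible_faces_def by blast+
  then obtain P where P: "P \<in> planes" "polyhedral_in P (face d \<alpha>)" by blast
  note * = polyhedral_in_plane[OF P]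
  show "face d \<alpha> \<in> sets borel" "closure (face d \<alpha>) - face d \<alpha> \<in> null_sets surface_measure" "0 < area (face d \<alpha>)"
    using * \<open>face d \<alpha> \<noteq> {}\<close> by auto
  show "emeasure surface_measure (face d \<alpha>) < \<infinity>"
    using P(1) * by (intro surface_bounded_finite[of "{P}"]) auto
qed

section \<open>Cells and faces along the boundary, up to null sets\<close>

lemma AE_covered:
  assumes "finite J" "J \<subseteq> I_Omega d \<union> I_Sigma d" "S \<subseteq> (\<Union>\<alpha>\<in>J. closure (face d \<alpha>))"
  shows "AE x in surface_measure. x \<in> S \<longrightarrow> (\<exists>\<alpha>\<in>J. x \<in> face d \<alpha>)"
proof (rule AE_I')
  show "(\<Union>\<alpha>\<in>J. closure (face d \<alpha>) - face d \<alpha>) \<in> null_sets surface_measure"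
    using assms(1,2) face_plane(2) by (intro null_sets_UN' countable_finite) auto
qed (use assms(3) in auto)

lemma cell_of_Omega:
  assumes "\<alpha> \<in> I_Omega d"
  shows "cell_of_Omega d \<alpha> \<in> cells d" "face d \<alpha> \<subseteq> frontier (cell d (cell_of_Omega d \<alpha>))"
proof -
  have "\<exists>!i. attached_Omega d \<alpha> i" using adm_faces assms unfolding admissible_faces_def by blast
  from theI'[OF this] have "attached_Omega d \<alpha> (cell_of_Omega d \<alpha>)" unfolding cell_of_Omega_def .
  then show "cell_of_Omega d \<alpha> \<in> cells d" "face d \<alpha> \<subseteq> frontier (cell d (cell_of_Omega d \<alpha>))"
    unfolding attached_Omega_def by auto
qed

lemma cell_of_Sigma:
  assumes "\<alpha> \<in> I_Sigma d"
  shows "cell_of_Sigma d \<alpha> \<in> cells d" "face d \<alpha> \<subseteq> frontier (phase_cell d Solid (cell_of_Sigma d \<alpha>))"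
proof -
  have "\<exists>!i. attached_Sigma d \<alpha> i" using adm_faces assms unfolding admissible_faces_def by blast
  from theI'[OF this] have "attached_Sigma d \<alpha> (cell_of_Sigma d \<alpha>)" unfolding cell_of_Sigma_def .
  then show "cell_of_Sigma d \<alpha> \<in> cells d" "face d \<alpha> \<subseteq> frontier (phase_cell d Solid (cell_of_Sigma d \<alpha>))"
    unfolding attached_Sigma_def by auto
qed

text \<open>Almost every common frontier point has normals from both sides, hence opposite half
  balls. In combination with regularity of a larger set this shows that such a point cannot lie on
  the frontier of that set.\<close>

lemma AE_two_frontiers:
  assumes "flat_domain D" "flat_domain E" "D \<inter> E = {}"
  shows "AE x in surface_measure. x \<in> frontier D \<longrightarrow> x \<in> frontier E \<longrightarrow> x \<in> interior (closure (D \<union> E))"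
  using AE_flat_domain_normal[OF assms(1)] AE_flat_domain_normal[OF assms(2)]
proof eventually_elim
  case (elim x)
  show ?case
  proof (intro impI)
    assume "x \<in> frontier D" "x \<in> frontier E"
    then obtain n m where "outer_unit_normal D x n" "outer_unit_normal E x m"
      using elim by blast
    then show "x \<in> interior (closure (D \<union> E))" by (rule opposite_half_balls[OF _ _ assms(3)])
  qed
qed

lemma AE_cells_frontier:
  assumes "i \<in> cells d" "j \<in> cells d" "i \<noteq> j"
  shows "AE x in surface_measure. x \<in> Gamma_Omega d \<longrightarrow> x \<in> frontier (cell d i) \<longrightarrow> x \<notin> frontier (cell d j)"
  using AE_two_frontiers[OF flat_cell[OF assms(1)] flat_cell[OF assms(2)] cells_disjoint[OF assms]]
proof eventually_elim
  case (elim x)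
  have "interior (closure (cell d i \<union> cell d j)) \<subseteq> interior (closure (dom d))"
    using cell_subset assms by (intro interior_mono closure_mono) auto
  then have "interior (closure (cell d i \<union> cell d j)) \<subseteq> dom d" using flat_regular[OF flat_dom] by simp
  moreover have "x \<notin> dom d" if "x \<in> Gamma_Omega d"
    using that Gamma_Omega_frontier_dom frontier_disj[OF flat_open[OF flat_dom]] by blast
  ultimately show ?case using elim by blast
qed

lemma AE_solid_cells_frontier:
  assumes "i \<in> cells d" "j \<in> cells d" "i \<noteq> j"
  shows "AE x in surface_measure. x \<in> interface d \<longrightarrow> x \<in> frontier (phase_cell d Solid i) \<longrightarrow>
    x \<notin> frontier (phase_cell d Solid j)"
proof -
  have "phase_cell d Solid i \<inter> phase_cell d Solid j = {}"
    using cells_disjoint[OF assms] by (auto simp: phase_cell_def)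
  from AE_two_frontiers[OF flat_phase_cell[OF assms(1)] flat_phase_cell[OF assms(2)] this]
  show ?thesis
  proof eventually_elim
    case (elim x)
    have "interior (closure (phase_cell d Solid i \<union> phase_cell d Solid j)) \<subseteq> interior (closure (phase_dom d Solid))"
      using phase_cell_subset(2) by (intro interior_mono closure_mono) auto
    then have "interior (closure (phase_cell d Solid i \<union> phase_cell d Solid j)) \<subseteq> phase_dom d Solid"
      using flat_regular[OF flat_phase] by simp
    moreover have "x \<notin> phase_dom d Solid" if "x \<in> interface d"
      using that frontier_solid frontier_disj[OF flat_open[OF flat_phase], of x Solid] unfolding interface_def by blast
    ultimately show ?case using elim by blast
  qed
qed

text \<open>Two cells share almost no part of \<open>Gamma_Omega\<close>, so positive area singles
  out the attached cell. Hence all elements of \<open>J_Omega d i\<close> carry the temperature of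
  cell \<open>i\<close>.\<close>

lemma J_Omega_eq:
  assumes i: "i \<in> cells d"
  shows "J_Omega d i = {\<alpha> \<in> I_Omega d. cell_of_Omega d \<alpha> = i}"
proof -
  have "area (face d \<alpha> \<inter> frontier (cell d i)) \<noteq> 0 \<longleftrightarrow> cell_of_Omega d \<alpha> = i" if \<alpha>: "\<alpha> \<in> I_Omega d" for \<alpha>
  proof
    assume "cell_of_Omega d \<alpha> = i"
    then have "face d \<alpha> \<inter> frontier (cell d i) = face d \<alpha>" using cell_of_Omega(2)[OF \<alpha>] by blast
    then show "area (face d \<alpha> \<inter> frontier (cell d i)) \<noteq> 0" using face_plane(3)[of \<alpha>] \<alpha> by simp
  next
    assume ne0: "area (face d \<alpha> \<inter> frontier (cell d i)) \<noteq> 0"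
    show "cell_of_Omega d \<alpha> = i"
    proof (rule ccontr)
      assume ne: "cell_of_Omega d \<alpha> \<noteq> i"
      have "AE x in surface_measure. x \<notin> face d \<alpha> \<inter> frontier (cell d i)"
        using AE_cells_frontier[OF cell_of_Omega(1)[OF \<alpha>] i ne]
        by eventually_elim (use face_Omega[OF \<alpha>] cell_of_Omega(2)[OF \<alpha>] in blast)
      moreover have "face d \<alpha> \<inter> frontier (cell d i) \<in> sets borel"
        using face_plane(1)[of \<alpha>] \<alpha> by auto
      ultimately show False using ne0 area_eq_0_if_AE by blast
    qed
  qed
  then show ?thesis unfolding J_Omega_def by blast
qed

lemma J_Sigma_eq:
  assumes i: "i \<in> cells d"
  shows "J_Sigma d i = {\<alpha> \<in> I_Sigma d. cell_of_Sigma d \<alpha> = i}"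
proof -
  have "area (face d \<alpha> \<inter> frontier (phase_cell d Solid i)) \<noteq> 0 \<longleftrightarrow> cell_of_Sigma d \<alpha> = i" if \<alpha>: "\<alpha> \<in> I_Sigma d" for \<alpha>
  proof
    assume "cell_of_Sigma d \<alpha> = i"
    then have "face d \<alpha> \<inter> frontier (phase_cell d Solid i) = face d \<alpha>" using cell_of_Sigma(2)[OF \<alpha>] by blast
    then show "area (face d \<alpha> \<inter> frontier (phase_cell d Solid i)) \<noteq> 0" using face_plane(3)[of \<alpha>] \<alpha> by simp
  next
    assume ne0: "area (face d \<alpha> \<inter> frontier (phase_cell d Solid i)) \<noteq> 0"
    show "cell_of_Sigma d \<alpha> = i"
    proof (rule ccontr)
      assume ne: "cell_of_Sigma d \<alpha> \<noteq> i"
      have "AE x in surface_measure. x \<notin> face d \<alpha> \<inter> frontier (phase_cell d Solid i)"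
        using AE_solid_cells_frontier[OF cell_of_Sigma(1)[OF \<alpha>] i ne]
        by eventually_elim (use face_Sigma[OF \<alpha>] cell_of_Sigma(2)[OF \<alpha>] in blast)
      moreover have "face d \<alpha> \<inter> frontier (phase_cell d Solid i) \<in> sets borel"
        using face_plane(1)[of \<alpha>] \<alpha> by auto
      ultimately show False using ne0 area_eq_0_if_AE by blast
    qed
  qed
  then show ?thesis unfolding J_Sigma_def by blast
qed

text \<open>Near the outer boundary there is no gas.\<close>

lemma frontier_solid_cell_outer:
  assumes i: "i \<in> cells d" and x: "x \<in> frontier (dom d)"
  shows "x \<in> frontier (phase_cell d Solid i) \<longleftrightarrow> x \<in> frontier (cell d i)"
proof -
  have opG: "open (phase_dom d Gas)" "open (dom d)" using flat_open flat_phase flat_dom by auto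
  have "phase_dom d Gas \<subseteq> interior (closure (dom d))"
    using opG(1) closure_dom closure_subset by (intro interior_maximal) auto
  then have "phase_dom d Gas \<subseteq> dom d" using flat_regular[OF flat_dom] by simp
  then have "x \<notin> phase_dom d Gas" using frontier_disj[OF opG(2) x] by blast
  moreover have "x \<notin> frontier (phase_dom d Gas)" using frontiers_disjoint x by blast
  ultimately have "x \<in> - closure (phase_dom d Gas)" using opG(1) by (simp add: frontier_def interior_open)
  then obtain r where r: "r > 0" "ball x r \<subseteq> - closure (phase_dom d Gas)"
    using openE[of "- closure (phase_dom d Gas)" x] by (auto simp: open_Compl)
  have "cell d i \<inter> ball x r \<subseteq> closure (phase_dom d Solid)"
    using r(2) cell_subset[OF i] closure_dom closure_subset[of "dom d"] by blast
  then have "cell d i \<inter> ball x r \<subseteq> interior (closure (phase_dom d Solid))"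
    using flat_open[OF flat_cell[OF i]] by (intro interior_maximal) auto
  then have "cell d i \<inter> ball x r \<subseteq> phase_dom d Solid" using flat_regular[OF flat_phase] by simp
  then have eq: "cell d i \<inter> ball x r = phase_cell d Solid i \<inter> ball x r"
    by (auto simp: phase_cell_def)
  have loc: "x \<in> closure D \<longleftrightarrow> x \<in> closure (D \<inter> ball x r)" "x \<in> interior D \<longleftrightarrow> x \<in> interior (D \<inter> ball x r)" for D
  proof -
    show "x \<in> closure D \<longleftrightarrow> x \<in> closure (D \<inter> ball x r)"
    proof
      assume "x \<in> closure D"
      then show "x \<in> closure (D \<inter> ball x r)"
        using open_Int_closure_subset[OF open_ball, of x r D] r(1) by (auto simp: Int_commute)
    qed (meson closure_mono inf_le1 subsetD)
    show "x \<in> interior D \<longleftrightarrow> x \<in> interior (D \<inter> ball x r)" using r(1) by simp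
  qed
  show ?thesis
    unfolding frontier_def Diff_iff loc[of "phase_cell d Solid i"] loc[of "cell d i"] eq ..
qed

lemma sum_area_Omega:
  assumes i: "i \<in> cells d"
  shows "(\<Sum>\<alpha>\<in>J_Omega d i. area (face d \<alpha>)) = area (frontier (phase_cell d Solid i) \<inter> Gamma_Omega d)"
proof (rule sum_area_AE)
  let ?J = "J_Omega d i"
  have J: "?J = {\<alpha> \<in> I_Omega d. cell_of_Omega d \<alpha> = i}" using J_Omega_eq[OF i] .
  show "finite ?J" unfolding J using finite_Omega by simp
  show "face d \<alpha> \<in> sets borel" "emeasure surface_measure (face d \<alpha>) < \<infinity>" if "\<alpha> \<in> ?J" for \<alpha>
    using that face_plane[of \<alpha>] unfolding J by auto
  show "disjoint_family_on (face d) ?J"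
    using faces_disjoint(1) unfolding J by (auto simp: disjoint_family_on_def)
  show "frontier (phase_cell d Solid i) \<inter> Gamma_Omega d \<in> sets borel"
    using Gamma_Omega_borel by auto
  have fr: "x \<in> frontier (phase_cell d Solid i) \<longleftrightarrow> x \<in> frontier (cell d i)" if "x \<in> Gamma_Omega d" for x
    using frontier_solid_cell_outer[OF i] that Gamma_Omega_frontier_dom by blast
  have "AE x in surface_measure. \<forall>j\<in>cells d - {i}. x \<in> Gamma_Omega d \<longrightarrow> x \<in> frontier (cell d i) \<longrightarrow> x \<notin> frontier (cell d j)"
    using finite_cells AE_cells_frontier[OF i] by (intro AE_finite_allI) auto
  moreover have "AE x in surface_measure. x \<in> Gamma_Omega d \<longrightarrow> (\<exists>\<alpha>\<in>I_Omega d. x \<in> face d \<alpha>)"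
    by (intro AE_covered finite_Omega cover_Omega) simp
  ultimately show "AE x in surface_measure. x \<in> frontier (phase_cell d Solid i) \<inter> Gamma_Omega d \<longleftrightarrow> (\<exists>\<alpha>\<in>?J. x \<in> face d \<alpha>)"
  proof eventually_elim
    case (elim x)
    show ?case
    proof
      assume x: "x \<in> frontier (phase_cell d Solid i) \<inter> Gamma_Omega d"
      then obtain \<alpha> where \<alpha>: "\<alpha> \<in> I_Omega d" "x \<in> face d \<alpha>" using elim by blast
      have "x \<in> frontier (cell d (cell_of_Omega d \<alpha>))" using cell_of_Omega(2)[OF \<alpha>(1)] \<alpha>(2) by blast
      then have "cell_of_Omega d \<alpha> = i"
        using elim(1) x fr cell_of_Omega(1)[OF \<alpha>(1)] by blast
      then show "\<exists>\<alpha>\<in>?J. x \<in> face d \<alpha>" unfolding J using \<alpha> by blast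
    next
      assume "\<exists>\<alpha>\<in>?J. x \<in> face d \<alpha>"
      then obtain \<alpha> where \<alpha>: "\<alpha> \<in> I_Omega d" "cell_of_Omega d \<alpha> = i" "x \<in> face d \<alpha>" unfolding J by blast
      then have "x \<in> Gamma_Omega d" "x \<in> frontier (cell d i)"
        using face_Omega[OF \<alpha>(1)] cell_of_Omega(2)[OF \<alpha>(1)] by blast+
      then show "x \<in> frontier (phase_cell d Solid i) \<inter> Gamma_Omega d" using fr by blast
    qed
  qed
qed

text \<open>A point of the open cell \<open>i\<close> that lies on a face attached to cell
  \<open>j\<close> is a limit of cell \<open>j\<close>, so \<open>j = i\<close>. Conversely a
  regular point of a face of the solid part is, by the matching condition on regular frontiers, also
  a frontier point of the gas part; the two half balls fill a neighbourhood, and regularity puts the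
  point into the cell.\<close>

lemma sum_area_Sigma:
  assumes i: "i \<in> cells d"
  shows "(\<Sum>\<alpha>\<in>J_Sigma d i. area (face d \<alpha>)) = area (cell d i \<inter> interface d)"
proof (rule sum_area_AE)
  let ?J = "J_Sigma d i"
  have J: "?J = {\<alpha> \<in> I_Sigma d. cell_of_Sigma d \<alpha> = i}" using J_Sigma_eq[OF i] .
  have opn: "open (cell d i)" using flat_open[OF flat_cell[OF i]] .
  show "finite ?J" unfolding J using finite_Sigma by simp
  show "face d \<alpha> \<in> sets borel" "emeasure surface_measure (face d \<alpha>) < \<infinity>" if "\<alpha> \<in> ?J" for \<alpha>
    using that face_plane[of \<alpha>] unfolding J by auto
  show "disjoint_family_on (face d) ?J"
    using faces_disjoint(2) unfolding J by (auto simp: disjoint_family_on_def)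
  show "cell d i \<inter> interface d \<in> sets borel"
    using interface_borel opn by auto
  have disj: "phase_cell d Solid i \<inter> phase_cell d Gas i = {}"
    using phases_disjoint by (auto simp: phase_cell_def)
  have "AE x in surface_measure. x \<in> interface d \<longrightarrow> (\<exists>\<alpha>\<in>I_Sigma d. x \<in> face d \<alpha>)"
    by (intro AE_covered finite_Sigma cover_Sigma) simp
  moreover have "AE x in surface_measure. x \<in> frontier (phase_cell d Solid i) \<longrightarrow> x \<in> reg_frontier (phase_cell d Solid i)"
    using AE_flat_domain_normal[OF flat_phase_cell[OF i]] by eventually_elim (use reg_frontierI in blast)
  moreover have "AE x in surface_measure. x \<in> frontier (phase_cell d Solid i) \<longrightarrow> x \<in> frontier (phase_cell d Gas i) \<longrightarrow>
      x \<in> interior (closure (phase_cell d Solid i \<union> phase_cell d Gas i))"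
    by (rule AE_two_frontiers[OF flat_phase_cell[OF i] flat_phase_cell[OF i] disj])
  ultimately show "AE x in surface_measure. x \<in> cell d i \<inter> interface d \<longleftrightarrow> (\<exists>\<alpha>\<in>?J. x \<in> face d \<alpha>)"
  proof eventually_elim
    case (elim x)
    show ?case
    proof
      assume x: "x \<in> cell d i \<inter> interface d"
      then obtain \<alpha> where \<alpha>: "\<alpha> \<in> I_Sigma d" "x \<in> face d \<alpha>" using elim by blast
      let ?j = "cell_of_Sigma d \<alpha>"
      have "x \<in> closure (phase_cell d Solid ?j)"
        using cell_of_Sigma(2)[OF \<alpha>(1)] \<alpha>(2) by (auto simp: frontier_def)
      then have "x \<in> closure (cell d ?j)" using closure_mono[OF phase_cell_subset(1)] by blast
      then have "cell d i \<inter> cell d ?j \<noteq> {}"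
        using x open_Int_closure_eq_empty[OF opn, of "cell d ?j"] by blast
      then have "?j = i" using cells_disjoint[OF i cell_of_Sigma(1)[OF \<alpha>(1)]] by blast
      then show "\<exists>\<alpha>\<in>?J. x \<in> face d \<alpha>" unfolding J using \<alpha> by blast
    next
      assume "\<exists>\<alpha>\<in>?J. x \<in> face d \<alpha>"
      then obtain \<alpha> where \<alpha>: "\<alpha> \<in> I_Sigma d" "cell_of_Sigma d \<alpha> = i" "x \<in> face d \<alpha>" unfolding J by blast
      then have x: "x \<in> interface d" "x \<in> frontier (phase_cell d Solid i)"
        using face_Sigma[OF \<alpha>(1)] cell_of_Sigma(2)[OF \<alpha>(1)] by blast+
      then have "x \<in> reg_frontier (phase_cell d Gas i)"
        using elim(2) reg_interface[OF i] by blast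
      then have "x \<in> frontier (phase_cell d Gas i)" by (simp add: reg_frontier_def)
      then have "x \<in> interior (closure (phase_cell d Solid i \<union> phase_cell d Gas i))"
        using elim(3) x by blast
      moreover have "interior (closure (phase_cell d Solid i \<union> phase_cell d Gas i)) \<subseteq> interior (closure (cell d i))"
        using phase_cell_subset(1) by (intro interior_mono closure_mono) auto
      ultimately have "x \<in> cell d i" using flat_regular[OF flat_cell[OF i]] by blast
      then show "x \<in> cell d i \<inter> interface d" using x by blast
    qed
  qed
qed

section \<open>Row sums of the discrete view coefficients\<close>

lemma view_coeff_nonneg: "0 \<le> view_coeff d \<alpha> \<beta>"
  unfolding view_coeff_def by (rule view_factor_nonneg)

lemma view_coeff_sum_Sigma:
  assumes \<alpha>: "\<alpha> \<in> I_Sigma d"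
  shows "(\<Sum>\<beta>\<in>I_Sigma d. view_coeff d \<alpha> \<beta>) = area (face d \<alpha>)"
proof -
  have elem: "element d \<beta> = face d \<beta>" if "\<beta> \<in> I_Sigma d" for \<beta>
    using that ph_index unfolding element_def by auto
  have "(\<Sum>\<beta>\<in>I_Sigma d. view_coeff d \<alpha> \<beta>) = (\<Sum>\<beta>\<in>I_Sigma d. view_factor (phase_dom d Gas) (face d \<alpha>) (face d \<beta>))"
    using \<alpha> by (intro sum.cong refl) (simp add: view_coeff_def elem)
  also have "\<dots> = area (face d \<alpha>)"
  proof (rule view_factor_sum[OF flat_phase finite_Sigma \<alpha>])
    show "face d \<beta> \<subseteq> frontier (phase_dom d Gas)" if "\<beta> \<in> I_Sigma d" for \<beta>
      using face_Sigma[OF that] unfolding interface_def .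
    show "face d \<beta> \<in> sets borel" if "\<beta> \<in> I_Sigma d" for \<beta>
      using face_plane(1) that by blast
    have "AE x in surface_measure. x \<in> interface d \<longrightarrow> (\<exists>\<alpha>\<in>I_Sigma d. x \<in> face d \<alpha>)"
      by (intro AE_covered finite_Sigma cover_Sigma) simp
    then show "AE y in surface_measure. y \<in> frontier (phase_dom d Gas) \<longrightarrow> (\<exists>!\<beta>. \<beta> \<in> I_Sigma d \<and> y \<in> face d \<beta>)"
      unfolding interface_def
    proof eventually_elim
      case (elim y)
      then show ?case using faces_disjoint(2) unfolding disjoint_family_on_def by blast
    qed
  qed
  finally show ?thesis .
qed

lemma Gamma_ph_subset: "Gamma_ph d \<subseteq> frontier (open_cavity d)"
  by (simp add: Gamma_ph_def)

lemma frontier_cavity: "frontier (open_cavity d) \<subseteq> Gamma_Omega d \<union> Gamma_ph d"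
proof
  fix x assume x: "x \<in> frontier (open_cavity d)"
  let ?C = "convex hull (closure (dom d))"
  have "compact (closure (dom d))" using flat_dom by (simp add: flat_domain_def)
  then have "closed ?C" by (simp add: compact_convex_hull compact_imp_closed)
  moreover have "open_cavity d \<subseteq> ?C" unfolding open_cavity_def using interior_subset by blast
  ultimately have "closure (open_cavity d) \<subseteq> ?C" by (rule closure_minimal[rotated])
  then have xC: "x \<in> ?C" using x by (auto simp: frontier_def)
  have "x \<notin> open_cavity d" using frontier_disj[OF flat_open[OF flat_cavity] x] .
  then consider "x \<notin> interior ?C" | "x \<in> closure (dom d)" unfolding open_cavity_def by blast
  then show "x \<in> Gamma_Omega d \<union> Gamma_ph d"
  proof cases
    case 1
    then have "x \<in> frontier ?C" using xC closure_subset[of ?C] by (auto simp: frontier_def)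
    then show ?thesis using x by (simp add: Gamma_ph_def)
  next
    case 2
    then show ?thesis using x by (simp add: Gamma_Omega_def frontier_def)
  qed
qed

text \<open>At almost every point of \<open>Gamma_Omega\<close> the domain and the cavity fill a
  neighbourhood inside the convex hull, so the point is not on the frontier of the hull.\<close>

lemma AE_Gamma_disjoint: "AE x in surface_measure. x \<in> Gamma_Omega d \<longrightarrow> x \<notin> Gamma_ph d"
proof -
  have "dom d \<inter> open_cavity d = {}" unfolding open_cavity_def using closure_subset by blast
  from AE_two_frontiers[OF flat_dom flat_cavity this] show ?thesis
  proof eventually_elim
    case (elim x)
    let ?C = "convex hull (closure (dom d))"
    have "compact (closure (dom d))" using flat_dom by (simp add: flat_domain_def)
    then have "closed ?C" by (simp add: compact_convex_hull compact_imp_closed)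
    moreover have "dom d \<union> open_cavity d \<subseteq> ?C"
      unfolding open_cavity_def using interior_subset[of ?C] closure_subset[of "dom d"] hull_subset[of "closure (dom d)" convex] by blast
    ultimately have "closure (dom d \<union> open_cavity d) \<subseteq> ?C" by (rule closure_minimal[rotated])
    then have "interior (closure (dom d \<union> open_cavity d)) \<subseteq> interior ?C" by (rule interior_mono)
    moreover have "x \<notin> interior ?C" if "x \<in> Gamma_ph d" using that by (simp add: Gamma_ph_def frontier_def)
    ultimately show ?case
      using elim Gamma_Omega_frontier_dom Gamma_Omega_frontier_cavity by blast
  qed
qed

lemma view_coeff_sum_Omega:
  assumes \<alpha>: "\<alpha> \<in> I_Omega d"
  shows "(\<Sum>\<beta>\<in>I_Omega d. view_coeff d \<alpha> \<beta>) + view_coeff d \<alpha> (ph_index d) = area (face d \<alpha>)"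
proof -
  let ?K = "insert (ph_index d) (I_Omega d)"
  have elem: "element d \<beta> = face d \<beta>" if "\<beta> \<in> I_Omega d" for \<beta>
    using that ph_index unfolding element_def by auto
  have ph: "element d (ph_index d) = Gamma_ph d" by (simp add: element_def)
  \<comment> \<open>This decides the case distinction in \<open>view_coeff\<close> in favour of the
    cavity.\<close>
  have "\<alpha> \<notin> I_Sigma d" using \<alpha> I_disjoint by blast
  then have "(\<Sum>\<beta>\<in>I_Omega d. view_coeff d \<alpha> \<beta>) + view_coeff d \<alpha> (ph_index d)
      = (\<Sum>\<beta>\<in>?K. view_factor (open_cavity d) (element d \<alpha>) (element d \<beta>))"
    using finite_Omega ph_index by (simp add: view_coeff_def)
  also have "\<dots> = area (element d \<alpha>)"
  proof (rule view_factor_sum[OF flat_cavity])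
    show "finite ?K" "\<alpha> \<in> ?K" using finite_Omega \<alpha> by auto
    show "element d \<beta> \<subseteq> frontier (open_cavity d)" if "\<beta> \<in> ?K" for \<beta>
      using that ph elem face_Omega Gamma_Omega_frontier_cavity Gamma_ph_subset by (metis insertE subset_trans)
    show "element d \<beta> \<in> sets borel" if "\<beta> \<in> ?K" for \<beta>
      using that ph elem face_plane(1) Gamma_ph_borel by (metis UnI1 insertE)
    have "AE x in surface_measure. x \<in> Gamma_Omega d \<longrightarrow> (\<exists>\<alpha>\<in>I_Omega d. x \<in> face d \<alpha>)"
      by (intro AE_covered finite_Omega cover_Omega) simp
    then show "AE y in surface_measure. y \<in> frontier (open_cavity d) \<longrightarrow> (\<exists>!\<beta>. \<beta> \<in> ?K \<and> y \<in> element d \<beta>)"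
      using AE_Gamma_disjoint
    proof eventually_elim
      case (elim y)
      show ?case
      proof
        assume "y \<in> frontier (open_cavity d)"
        then consider "y \<in> Gamma_Omega d" "y \<notin> Gamma_ph d" | "y \<notin> Gamma_Omega d" "y \<in> Gamma_ph d"
          using frontier_cavity elim by blast
        then show "\<exists>!\<beta>. \<beta> \<in> ?K \<and> y \<in> element d \<beta>"
        proof cases
          case 1
          then obtain \<beta> where \<beta>: "\<beta> \<in> I_Omega d" "y \<in> face d \<beta>" using elim by blast
          show ?thesis
          proof (rule ex1I[of _ \<beta>])
            show "\<beta> \<in> ?K \<and> y \<in> element d \<beta>" using \<beta> elem by simp
            fix \<gamma> assume \<gamma>: "\<gamma> \<in> ?K \<and> y \<in> element d \<gamma>"
            then have "\<gamma> \<in> I_Omega d" using 1 ph by auto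
            moreover have "y \<in> face d \<gamma>" using \<gamma> elem[OF calculation] by simp
            ultimately show "\<gamma> = \<beta>"
              using \<beta> faces_disjoint(1) unfolding disjoint_family_on_def by blast
          qed
        next
          case 2
          show ?thesis
          proof (rule ex1I[of _ "ph_index d"])
            show "ph_index d \<in> ?K \<and> y \<in> element d (ph_index d)" using 2 ph by simp
            fix \<gamma> assume \<gamma>: "\<gamma> \<in> ?K \<and> y \<in> element d \<gamma>"
            show "\<gamma> = ph_index d"
            proof (rule ccontr)
              assume "\<gamma> \<noteq> ph_index d"
              then have "\<gamma> \<in> I_Omega d" using \<gamma> by blast
              then have "y \<in> Gamma_Omega d" using \<gamma> elem face_Omega by blast
              then show False using 2 by blast
            qed
          qed
        qed
      qed
    qed
  qed
  also have "\<dots> = area (face d \<alpha>)" using elem[OF \<alpha>] by simp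
  finally show ?thesis .
qed

end

section \<open>Finite systems of equations\<close>

text \<open>Banach's iteration carried out by hand, since only the coordinates in \<open>I\<close>
  are controlled and the functions do not form a metric space under the maximum over
  \<open>I\<close>. A common bound \<open>e\<close> of the coordinate differences replaces that
  maximum.\<close>

lemma finite_sup_contraction_fixpoint:
  fixes T :: "('i \<Rightarrow> real) \<Rightarrow> 'i \<Rightarrow> real" and S :: "real set"
  assumes I: "finite I" and S: "closed S" "S \<noteq> {}" and q: "0 \<le> q" "q < 1"
    and maps: "\<And>u i. (\<forall>j\<in>I. u j \<in> S) \<Longrightarrow> i \<in> I \<Longrightarrow> T u i \<in> S"
    and contr: "\<And>u w e i. (\<forall>j\<in>I. u j \<in> S) \<Longrightarrow> (\<forall>j\<in>I. w j \<in> S) \<Longrightarrow>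
      (\<forall>j\<in>I. \<bar>u j - w j\<bar> \<le> e) \<Longrightarrow> i \<in> I \<Longrightarrow> \<bar>T u i - T w i\<bar> \<le> q * e"
  shows "\<exists>u. (\<forall>i\<in>I. u i \<in> S) \<and> (\<forall>i\<in>I. T u i = u i)"
proof -
  obtain s0 where s0: "s0 \<in> S" using S by auto
  define x where "x n = (T ^^ n) (\<lambda>_. s0)" for n
  have xS: "\<forall>i\<in>I. x n i \<in> S" for n
    by (induction n) (use s0 maps in \<open>auto simp: x_def\<close>)
  have xSuc: "x (Suc n) = T (x n)" for n by (simp add: x_def)
  define D where "D = (\<Sum>i\<in>I. \<bar>x 1 i - x 0 i\<bar>)"
  have step: "\<forall>i\<in>I. \<bar>x (Suc n) i - x n i\<bar> \<le> q ^ n * D" for n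
  proof (induction n)
    case 0
    then show ?case
      using I by (auto simp: D_def intro: member_le_sum)
  next
    case (Suc n)
    then show ?case
      using contr[OF xS[of "Suc n"] xS[of n] Suc] by (simp add: xSuc[of "Suc n"] xSuc[of n] mult.assoc)
  qed
  have "\<exists>l. (\<lambda>n. x n i) \<longlonglongrightarrow> l" if "i \<in> I" for i
  proof -
    have "summable (\<lambda>n. q ^ n * D)"
      using q by (intro summable_mult2 summable_geometric) simp
    then have "summable (\<lambda>n. x (Suc n) i - x n i)"
      by (rule summable_comparison_test') (use step that in auto)
    then have "convergent (\<lambda>n. \<Sum>k<n. x (Suc k) i - x k i)"
      by (simp add: summable_iff_convergent)
    then have "convergent (\<lambda>n. x n i - x 0 i)"
      using sum_lessThan_telescope[of "\<lambda>k. x k i"] by simp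
    then show ?thesis
      by (metis convergent_diff_const_right_iff convergent_def)
  qed
  then obtain l where l: "\<And>i. i \<in> I \<Longrightarrow> (\<lambda>n. x n i) \<longlonglongrightarrow> l i" by metis
  have lS: "\<forall>i\<in>I. l i \<in> S"
  proof
    fix i assume i: "i \<in> I"
    show "l i \<in> S"
      by (rule closed_sequentially[OF S(1) _ l[OF i]]) (use xS i in blast)
  qed
  have "T l i = l i" if i: "i \<in> I" for i
  proof (rule ccontr)
    assume "T l i \<noteq> l i"
    \<comment> \<open>With a quarter of the gap as tolerance, \<open>T l i\<close> and
      \<open>l i\<close> are both that close to the same iterate, hence at most half the gap
      apart.\<close>
    then have e: "\<bar>T l i - l i\<bar> / 4 > 0" (is "?e > 0") by simp
    have "eventually (\<lambda>n. \<bar>x n j - l j\<bar> < ?e) sequentially" if "j \<in> I" for j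
      using tendstoD[OF l[OF that] e] by (simp add: dist_real_def)
    then have "eventually (\<lambda>n. \<forall>j\<in>I. \<bar>x n j - l j\<bar> < ?e) sequentially"
      using I by (simp add: eventually_ball_finite_distrib)
    then obtain n where n: "\<And>m. m \<ge> n \<Longrightarrow> \<forall>j\<in>I. \<bar>x m j - l j\<bar> < ?e"
      by (auto simp: eventually_sequentially)
    have "\<bar>x (Suc n) i - T l i\<bar> \<le> q * ?e"
      unfolding xSuc using n[of n] by (intro contr[OF xS lS _ i]) (auto intro: less_imp_le)
    also have "\<dots> \<le> ?e" using q e by (simp add: mult_left_le_one_le)
    finally have "\<bar>x (Suc n) i - T l i\<bar> \<le> ?e" .
    moreover have "\<bar>x (Suc n) i - l i\<bar> < ?e" using bspec[OF n[of "Suc n"] i] by simp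
    moreover have "\<bar>T l i - l i\<bar> \<le> \<bar>x (Suc n) i - T l i\<bar> + \<bar>x (Suc n) i - l i\<bar>"
      by linarith
    moreover have False if "p \<le> a / 4" "q < a / 4" "a \<le> p + q" "0 < a / 4" for p q a :: real
      using that by linarith
    ultimately show False using e by blast
  qed
  with lS show ?thesis by blast
qed

text \<open>Supplies the contraction factor: finitely many quotients below 1 have a maximum below
  1.\<close>

lemma ball_finite_less_uniform:
  fixes f g :: "'a \<Rightarrow> real"
  assumes "finite I" "\<And>i. i \<in> I \<Longrightarrow> 0 \<le> f i" "\<And>i. i \<in> I \<Longrightarrow> f i < g i"
  shows "\<exists>q. 0 \<le> q \<and> q < 1 \<and> (\<forall>i\<in>I. f i \<le> q * g i)"
proof (cases "I = {}")
  case False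
  let ?q = "Max ((\<lambda>i. f i / g i) ` I)"
  have q: "f i / g i \<le> ?q" if "i \<in> I" for i
    using assms(1) that by simp
  have pos: "g i > 0" if "i \<in> I" for i
    using assms that by (meson le_less_trans)
  have "?q \<in> (\<lambda>i. f i / g i) ` I"
    using False assms(1) by (intro Max_in) auto
  then obtain k where k: "k \<in> I" "?q = f k / g k" by auto
  have "0 \<le> ?q" "?q < 1"
    unfolding k(2) using assms(2,3)[OF k(1)] pos[OF k(1)] by simp_all
  moreover have "f i \<le> ?q * g i" if "i \<in> I" for i
    using q[OF that] pos[OF that] by (simp add: pos_divide_le_eq)
  ultimately show ?thesis
    by blast
qed (auto intro: exI[of _ 0])

section \<open>Diagonally dominant linear systems\<close>

lemma ex_min_on_finite:
  fixes f :: "'a \<Rightarrow> real"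
  assumes "finite I" "i \<in> I"
  obtains k where "k \<in> I" "\<And>j. j \<in> I \<Longrightarrow> f k \<le> f j"
  using assms by (metis arg_min_least empty_iff arg_min_if_finite(1))

text \<open>At an index \<open>k\<close> where \<open>x\<close> is minimal, replacing every
  \<open>x \<beta>\<close> by \<open>x k\<close> lowers the sum, so \<open>x k\<close> times the
  positive surplus of row \<open>k\<close> is nonnegative. This is the discrete maximum principle
  behind all radiosity estimates.\<close>

lemma dominant_nonneg:
  fixes a :: "'b \<Rightarrow> real"
  assumes J: "finite J"
    and b: "\<And>\<alpha> \<beta>. \<alpha> \<in> J \<Longrightarrow> \<beta> \<in> J \<Longrightarrow> 0 \<le> b \<alpha> \<beta>" "\<And>\<alpha>. \<alpha> \<in> J \<Longrightarrow> (\<Sum>\<beta>\<in>J. b \<alpha> \<beta>) < a \<alpha>"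
    and x: "\<And>\<alpha>. \<alpha> \<in> J \<Longrightarrow> 0 \<le> a \<alpha> * x \<alpha> - (\<Sum>\<beta>\<in>J. b \<alpha> \<beta> * x \<beta>)"
    and "\<alpha> \<in> J"
  shows "0 \<le> x \<alpha>"
proof -
  obtain k where k: "k \<in> J" "\<And>j. j \<in> J \<Longrightarrow> x k \<le> x j"
    using ex_min_on_finite[OF J \<open>\<alpha> \<in> J\<close>] by metis
  have "(\<Sum>\<beta>\<in>J. b k \<beta>) * x k \<le> (\<Sum>\<beta>\<in>J. b k \<beta> * x \<beta>)"
    unfolding sum_distrib_right using k b by (intro sum_mono) (simp add: mult_left_mono)
  then have "0 \<le> x k * (a k - (\<Sum>\<beta>\<in>J. b k \<beta>))"
    using x[OF k(1)] by (simp add: algebra_simps)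
  then have "0 \<le> x k"
    using b(2)[OF k(1)] by (simp add: zero_le_mult_iff)
  then show ?thesis using k \<open>\<alpha> \<in> J\<close> by force
qed

text \<open>Division by the diagonal turns the system into a fixed point equation that is
  contractive in the maximum distance.\<close>

lemma dominant_solvable:
  fixes a :: "'b \<Rightarrow> real"
  assumes J: "finite J"
    and b: "\<And>\<alpha> \<beta>. \<alpha> \<in> J \<Longrightarrow> \<beta> \<in> J \<Longrightarrow> 0 \<le> b \<alpha> \<beta>" "\<And>\<alpha>. \<alpha> \<in> J \<Longrightarrow> (\<Sum>\<beta>\<in>J. b \<alpha> \<beta>) < a \<alpha>"
  shows "\<exists>x. \<forall>\<alpha>\<in>J. a \<alpha> * x \<alpha> - (\<Sum>\<beta>\<in>J. b \<alpha> \<beta> * x \<beta>) = r \<alpha>"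
proof -
  have a: "a \<alpha> > 0" if "\<alpha> \<in> J" for \<alpha>
    using sum_nonneg[of J "b \<alpha>"] b that by force
  obtain q where q: "0 \<le> q" "q < 1" "\<forall>\<alpha>\<in>J. (\<Sum>\<beta>\<in>J. b \<alpha> \<beta>) \<le> q * a \<alpha>"
    using ball_finite_less_uniform[OF J, of "\<lambda>\<alpha>. \<Sum>\<beta>\<in>J. b \<alpha> \<beta>" a] b by (auto simp: sum_nonneg)
  define T where "T x \<alpha> = (r \<alpha> + (\<Sum>\<beta>\<in>J. b \<alpha> \<beta> * x \<beta>)) / a \<alpha>" for x \<alpha>
  have contr: "\<bar>T x \<alpha> - T y \<alpha>\<bar> \<le> q * e"
    if "\<forall>j\<in>J. \<bar>x j - y j\<bar> \<le> e" "\<alpha> \<in> J" for x y e \<alpha>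
  proof -
    have "e \<ge> 0" using that by (meson abs_ge_zero order_trans)
    have "T x \<alpha> - T y \<alpha> = (\<Sum>\<beta>\<in>J. b \<alpha> \<beta> * (x \<beta> - y \<beta>)) / a \<alpha>"
      by (simp add: T_def diff_divide_distrib[symmetric] sum_subtractf[symmetric] algebra_simps)
    moreover have "\<bar>\<Sum>\<beta>\<in>J. b \<alpha> \<beta> * (x \<beta> - y \<beta>)\<bar> \<le> (\<Sum>\<beta>\<in>J. b \<alpha> \<beta> * e)"
      using that b by (intro order_trans[OF sum_abs] sum_mono) (auto simp: abs_mult intro!: mult_left_mono)
    moreover have "(\<Sum>\<beta>\<in>J. b \<alpha> \<beta> * e) \<le> q * a \<alpha> * e"
      unfolding sum_distrib_right[symmetric] using q that \<open>e \<ge> 0\<close> by (intro mult_right_mono) auto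
    ultimately show ?thesis
      using a[OF that(2)] by (simp add: abs_divide pos_divide_le_eq mult_ac)
  qed
  obtain x where "\<forall>i\<in>J. T x i = x i"
    using finite_sup_contraction_fixpoint[OF J closed_UNIV _ q(1,2), of T] contr by auto
  then have "\<forall>\<alpha>\<in>J. a \<alpha> * x \<alpha> = r \<alpha> + (\<Sum>\<beta>\<in>J. b \<alpha> \<beta> * x \<beta>)"
    using a unfolding T_def by (metis less_irrefl nonzero_eq_divide_eq mult.commute)
  then show ?thesis by (intro exI[of _ x]) simp
qed

text \<open>Shows that the \<open>THE\<close> in \<open>matrix_inv_on\<close> denotes something: a
  right inverse is solved for column by column, injectivity of \<open>A\<close> makes it a left
  inverse, and it is unique among the matrices that vanish outside \<open>J\<close>.\<close>

lemma matrix_inv_on_solves: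
  fixes A :: "'b \<Rightarrow> 'b \<Rightarrow> real" and r :: "'b \<Rightarrow> real"
  assumes J: "finite J"
    and A: "\<And>\<alpha> \<beta>. \<alpha> \<in> J \<Longrightarrow> \<beta> \<in> J \<Longrightarrow> A \<alpha> \<beta> = (if \<alpha> = \<beta> then a \<alpha> else 0) - b \<alpha> \<beta>"
    and b: "\<And>\<alpha> \<beta>. \<alpha> \<in> J \<Longrightarrow> \<beta> \<in> J \<Longrightarrow> 0 \<le> b \<alpha> \<beta>" "\<And>\<alpha>. \<alpha> \<in> J \<Longrightarrow> (\<Sum>\<beta>\<in>J. b \<alpha> \<beta>) < a \<alpha>"
    and "\<alpha> \<in> J"
  defines "x \<equiv> \<lambda>\<gamma>. \<Sum>\<beta>\<in>J. matrix_inv_on J A \<gamma> \<beta> * r \<beta>"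
  shows "a \<alpha> * x \<alpha> - (\<Sum>\<beta>\<in>J. b \<alpha> \<beta> * x \<beta>) = r \<alpha>"
proof -
  have Amul: "(\<Sum>\<gamma>\<in>J. A \<alpha> \<gamma> * y \<gamma>) = a \<alpha> * y \<alpha> - (\<Sum>\<beta>\<in>J. b \<alpha> \<beta> * y \<beta>)" if "\<alpha> \<in> J" for \<alpha> y
  proof -
    have "(\<Sum>\<gamma>\<in>J. A \<alpha> \<gamma> * y \<gamma>) = (\<Sum>\<gamma>\<in>J. (if \<alpha> = \<gamma> then a \<alpha> * y \<gamma> else 0) - b \<alpha> \<gamma> * y \<gamma>)"
      using that by (intro sum.cong) (auto simp: A left_diff_distrib)
    then show ?thesis using J that by (simp add: sum_subtractf)
  qed
  have inj: "y \<alpha> = z \<alpha>"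
    if eq: "\<forall>\<alpha>\<in>J. (\<Sum>\<gamma>\<in>J. A \<alpha> \<gamma> * y \<gamma>) = (\<Sum>\<gamma>\<in>J. A \<alpha> \<gamma> * z \<gamma>)" and "\<alpha> \<in> J" for y z \<alpha>
  proof -
    have *: "0 \<le> y' \<alpha> - z' \<alpha>"
      if "\<forall>\<alpha>\<in>J. (\<Sum>\<gamma>\<in>J. A \<alpha> \<gamma> * y' \<gamma>) = (\<Sum>\<gamma>\<in>J. A \<alpha> \<gamma> * z' \<gamma>)" for y' z'
    proof (rule dominant_nonneg[OF J b(1) b(2), where x = "\<lambda>\<gamma>. y' \<gamma> - z' \<gamma>"])
      fix \<alpha> assume "\<alpha> \<in> J"
      then have "a \<alpha> * y' \<alpha> - (\<Sum>\<beta>\<in>J. b \<alpha> \<beta> * y' \<beta>) = a \<alpha> * z' \<alpha> - (\<Sum>\<beta>\<in>J. b \<alpha> \<beta> * z' \<beta>)"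
        using that Amul[of \<alpha> y'] Amul[of \<alpha> z'] by simp
      then show "0 \<le> a \<alpha> * (y' \<alpha> - z' \<alpha>) - (\<Sum>\<beta>\<in>J. b \<alpha> \<beta> * (y' \<beta> - z' \<beta>))"
        by (simp add: right_diff_distrib sum_subtractf)
    qed (use \<open>\<alpha> \<in> J\<close> in auto)
    from *[of y z] *[of z y] eq show "y \<alpha> = z \<alpha>" by simp
  qed
  let ?P = "\<lambda>B. (\<forall>\<alpha> \<beta>. \<alpha> \<notin> J \<or> \<beta> \<notin> J \<longrightarrow> B \<alpha> \<beta> = 0) \<and>
     (\<forall>\<alpha>\<in>J. \<forall>\<beta>\<in>J. (\<Sum>\<gamma>\<in>J. A \<alpha> \<gamma> * B \<gamma> \<beta>) = (if \<alpha> = \<beta> then 1 else 0)) \<and>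
     (\<forall>\<alpha>\<in>J. \<forall>\<beta>\<in>J. (\<Sum>\<gamma>\<in>J. B \<alpha> \<gamma> * A \<gamma> \<beta>) = (if \<alpha> = \<beta> then 1 else 0))"
  have "\<exists>x. \<forall>\<alpha>\<in>J. (\<Sum>\<gamma>\<in>J. A \<alpha> \<gamma> * x \<gamma>) = (if \<alpha> = \<beta> then 1 else 0)" for \<beta>
  proof -
    have "\<exists>x. \<forall>\<alpha>\<in>J. a \<alpha> * x \<alpha> - (\<Sum>\<gamma>\<in>J. b \<alpha> \<gamma> * x \<gamma>) = (if \<alpha> = \<beta> then 1 else 0)"
      using dominant_solvable[where a = a and b = b and J = J and r = "\<lambda>\<alpha>. if \<alpha> = \<beta> then 1 else 0"] J b by blast
    then obtain x where x: "\<forall>\<alpha>\<in>J. a \<alpha> * x \<alpha> - (\<Sum>\<gamma>\<in>J. b \<alpha> \<gamma> * x \<gamma>) = (if \<alpha> = \<beta> then 1 else 0)"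
      by blast
    have "\<forall>\<alpha>\<in>J. (\<Sum>\<gamma>\<in>J. A \<alpha> \<gamma> * x \<gamma>) = (if \<alpha> = \<beta> then 1 else 0)"
      by (intro ballI) (simp only: Amul bspec[OF x])
    then show ?thesis by (rule exI[where x = x])
  qed
  then have "\<forall>\<beta>. \<exists>x. \<forall>\<alpha>\<in>J. (\<Sum>\<gamma>\<in>J. A \<alpha> \<gamma> * x \<gamma>) = (if \<alpha> = \<beta> then 1 else 0)"
    by (rule allI)
  from choice[OF this] obtain X where
    "\<forall>\<beta>. \<forall>\<alpha>\<in>J. (\<Sum>\<gamma>\<in>J. A \<alpha> \<gamma> * X \<beta> \<gamma>) = (if \<alpha> = \<beta> then 1 else 0)" ..
  then have X: "\<And>\<alpha> \<beta>. \<alpha> \<in> J \<Longrightarrow> (\<Sum>\<gamma>\<in>J. A \<alpha> \<gamma> * X \<beta> \<gamma>) = (if \<alpha> = \<beta> then 1 else 0)"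
    by blast
  define B where "B \<alpha> \<beta> = (if \<alpha> \<in> J \<and> \<beta> \<in> J then X \<beta> \<alpha> else 0)" for \<alpha> \<beta>
  have AB: "(\<Sum>\<gamma>\<in>J. A \<alpha> \<gamma> * B \<gamma> \<beta>) = (if \<alpha> = \<beta> then 1 else 0)" if "\<alpha> \<in> J" "\<beta> \<in> J" for \<alpha> \<beta>
    using X[OF that(1), of \<beta>] that by (simp add: B_def)
  have "(\<Sum>\<gamma>\<in>J. B \<alpha> \<gamma> * A \<gamma> \<beta>) = (if \<alpha> = \<beta> then 1 else 0)" if "\<alpha> \<in> J" "\<beta> \<in> J" for \<alpha> \<beta>
  \<comment> \<open>\<open>A * (B * A) = (A * B) * A = A\<close>, so column by column
    \<open>B * A\<close> and the identity have the same image under the injective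
    \<open>A\<close>.\<close>
  proof (rule inj[OF _ \<open>\<alpha> \<in> J\<close>, of "\<lambda>\<alpha>. \<Sum>\<gamma>\<in>J. B \<alpha> \<gamma> * A \<gamma> \<beta>" "\<lambda>\<alpha>. if \<alpha> = \<beta> then 1 else 0"])
    show "\<forall>\<alpha>\<in>J. (\<Sum>\<gamma>\<in>J. A \<alpha> \<gamma> * (\<Sum>\<delta>\<in>J. B \<gamma> \<delta> * A \<delta> \<beta>)) = (\<Sum>\<gamma>\<in>J. A \<alpha> \<gamma> * (if \<gamma> = \<beta> then 1 else 0))"
    proof
      fix \<alpha> assume "\<alpha> \<in> J"
      have "(\<Sum>\<gamma>\<in>J. A \<alpha> \<gamma> * (\<Sum>\<delta>\<in>J. B \<gamma> \<delta> * A \<delta> \<beta>)) = (\<Sum>\<delta>\<in>J. (\<Sum>\<gamma>\<in>J. A \<alpha> \<gamma> * B \<gamma> \<delta>) * A \<delta> \<beta>)"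
        unfolding sum_distrib_left sum_distrib_right by (subst sum.swap) (simp add: mult.assoc)
      also have "\<dots> = (\<Sum>\<delta>\<in>J. if \<alpha> = \<delta> then A \<delta> \<beta> else 0)"
        using AB \<open>\<alpha> \<in> J\<close> by (intro sum.cong refl) simp
      also have "\<dots> = (\<Sum>\<gamma>\<in>J. A \<alpha> \<gamma> * (if \<gamma> = \<beta> then 1 else 0))"
        using J \<open>\<alpha> \<in> J\<close> \<open>\<beta> \<in> J\<close> by (simp add: if_distrib cong: if_cong)
      finally show "(\<Sum>\<gamma>\<in>J. A \<alpha> \<gamma> * (\<Sum>\<delta>\<in>J. B \<gamma> \<delta> * A \<delta> \<beta>)) = (\<Sum>\<gamma>\<in>J. A \<alpha> \<gamma> * (if \<gamma> = \<beta> then 1 else 0))" .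
    qed
  qed
  with AB have PB: "?P B" by (auto simp: B_def)
  have uniq: "C = B" if "?P C" for C
  proof (intro ext)
    fix \<alpha> \<beta>
    show "C \<alpha> \<beta> = B \<alpha> \<beta>"
    proof (cases "\<alpha> \<in> J \<and> \<beta> \<in> J")
      case True
      then show ?thesis
        using AB that by (intro inj[of "\<lambda>\<gamma>. C \<gamma> \<beta>" "\<lambda>\<gamma>. B \<gamma> \<beta>" \<alpha>]) simp_all
    next
      case False
      then have "C \<alpha> \<beta> = 0" "B \<alpha> \<beta> = 0" using that PB by blast+
      then show ?thesis by simp
    qed
  qed
  have inv: "matrix_inv_on J A = B"
    unfolding matrix_inv_on_def by (rule the_equality[where P = ?P, OF PB uniq])
  have "(\<Sum>\<gamma>\<in>J. A \<alpha> \<gamma> * x \<gamma>) = (\<Sum>\<gamma>\<in>J. \<Sum>\<beta>\<in>J. A \<alpha> \<gamma> * B \<gamma> \<beta> * r \<beta>)"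
    unfolding x_def inv sum_distrib_left by (simp only: mult.assoc)
  also have "\<dots> = (\<Sum>\<beta>\<in>J. \<Sum>\<gamma>\<in>J. A \<alpha> \<gamma> * B \<gamma> \<beta> * r \<beta>)"
    by (rule sum.swap)
  also have "\<dots> = (\<Sum>\<beta>\<in>J. (\<Sum>\<gamma>\<in>J. A \<alpha> \<gamma> * B \<gamma> \<beta>) * r \<beta>)"
    by (simp only: sum_distrib_right)
  also have "\<dots> = (\<Sum>\<beta>\<in>J. if \<alpha> = \<beta> then r \<beta> else 0)"
    using AB \<open>\<alpha> \<in> J\<close> by (intro sum.cong refl) simp
  also have "\<dots> = r \<alpha>" using J \<open>\<alpha> \<in> J\<close> by simp
  finally show ?thesis using Amul[OF \<open>\<alpha> \<in> J\<close>] by simp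
qed

section \<open>Monotone nonlinear systems with nonnegative coupling\<close>

lemma nonlinear_system_unique:
  fixes h :: "'i \<Rightarrow> ('i \<Rightarrow> real) \<Rightarrow> real \<Rightarrow> real"
  assumes I: "finite I"
    and c: "\<And>i j. i \<in> I \<Longrightarrow> j \<in> I \<Longrightarrow> 0 \<le> c i j"
    and mono: "\<And>i u s t. i \<in> I \<Longrightarrow> \<forall>j\<in>I. u j \<in> {lo..hi} \<Longrightarrow> lo \<le> t \<Longrightarrow> t \<le> s \<Longrightarrow> s \<le> hi \<Longrightarrow>
       \<mu> i * (s - t) \<le> h i u s - h i u t"
    and lip: "\<And>i u w s e. i \<in> I \<Longrightarrow> \<forall>j\<in>I. u j \<in> {lo..hi} \<Longrightarrow> \<forall>j\<in>I. w j \<in> {lo..hi} \<Longrightarrow>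
       \<forall>j\<in>I. \<bar>u j - w j\<bar> \<le> e \<Longrightarrow> s \<in> {lo..hi} \<Longrightarrow> h i w s - h i u s \<le> \<gamma> i * e"
    and \<mu>: "\<And>i. i \<in> I \<Longrightarrow> \<gamma> i < \<mu> i"
    and u: "\<forall>j\<in>I. u j \<in> {lo..hi}" "\<forall>i\<in>I. h i u (u i) - (\<Sum>j\<in>I. c i j * (u j - u i)) = 0"
    and w: "\<forall>j\<in>I. w j \<in> {lo..hi}" "\<forall>i\<in>I. h i w (w i) - (\<Sum>j\<in>I. c i j * (w j - w i)) = 0"
    and "i \<in> I"
  shows "u i = w i"
proof -
  obtain k where k0: "k \<in> I" "\<And>j. j \<in> I \<Longrightarrow> - \<bar>u k - w k\<bar> \<le> - \<bar>u j - w j\<bar>"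
    using ex_min_on_finite[OF I \<open>i \<in> I\<close>, where f = "\<lambda>j. - \<bar>u j - w j\<bar>"] by metis
  have k: "k \<in> I" "\<And>j. j \<in> I \<Longrightarrow> \<bar>u j - w j\<bar> \<le> \<bar>u k - w k\<bar>"
    using k0 by simp_all
  have key: "\<not> w k < u k"
    if k: "k \<in> I" "\<And>j. j \<in> I \<Longrightarrow> \<bar>u j - w j\<bar> \<le> \<bar>u k - w k\<bar>"
      and u: "\<forall>j\<in>I. u j \<in> {lo..hi}" "\<forall>i\<in>I. h i u (u i) - (\<Sum>j\<in>I. c i j * (u j - u i)) = 0"
      and w: "\<forall>j\<in>I. w j \<in> {lo..hi}" "\<forall>i\<in>I. h i w (w i) - (\<Sum>j\<in>I. c i j * (w j - w i)) = 0"
    for u w k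
  proof
    \<comment> \<open>At \<open>k\<close> the difference of the solutions is largest, so
      \<open>u j - w j \<le> u k - w k\<close> for all \<open>j\<close> and the coupling terms can
      only pull the solutions together. What is left is \<open>\<mu> k\<close> against
      \<open>\<gamma> k\<close>.\<close>
    assume less: "w k < u k"
    have "(\<Sum>j\<in>I. c k j * (u j - u k)) \<le> (\<Sum>j\<in>I. c k j * (w j - w k))"
      using k c less by (intro sum_mono mult_left_mono) fastforce+
    moreover have "\<mu> k * (u k - w k) \<le> h k u (u k) - h k u (w k)"
      using u(1) w(1) k(1) less by (intro mono[OF k(1) u(1)]) auto
    moreover have "h k w (w k) - h k u (w k) \<le> \<gamma> k * (u k - w k)"
      using k less w(1) by (intro lip[OF k(1) u(1) w(1)]) auto
    moreover have "h k u (u k) - (\<Sum>j\<in>I. c k j * (u j - u k)) = 0"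
      "h k w (w k) - (\<Sum>j\<in>I. c k j * (w j - w k)) = 0"
      using u(2) w(2) k(1) by auto
    ultimately have "\<mu> k * (u k - w k) \<le> \<gamma> k * (u k - w k)" by linarith
    then show False using \<mu>[OF k(1)] less by simp
  qed
  have "\<not> w k < u k" using key[OF k u w] .
  moreover have "\<not> u k < w k" using key[OF k(1) _ w u] k(2) by (simp add: abs_minus_commute)
  ultimately show ?thesis using k(2)[OF \<open>i \<in> I\<close>] by simp
qed

text \<open>A nonlinear Jacobi iteration: the \<open>i\<close>-th equation is solved for the unknown in the last
  argument of \<open>h i u\<close>, with \<open>u\<close> frozen. This needs no upper Lipschitz bound on \<open>h i u\<close>.\<close>

lemma nonlinear_system_solvable:
  fixes h :: "'i \<Rightarrow> ('i \<Rightarrow> real) \<Rightarrow> real \<Rightarrow> real"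
  assumes I: "finite I" and "lo \<le> hi"
    and c: "\<And>i j. i \<in> I \<Longrightarrow> j \<in> I \<Longrightarrow> 0 \<le> c i j"
    and mono: "\<And>i u s t. i \<in> I \<Longrightarrow> \<forall>j\<in>I. u j \<in> {lo..hi} \<Longrightarrow> lo \<le> t \<Longrightarrow> t \<le> s \<Longrightarrow> s \<le> hi \<Longrightarrow>
       \<mu> i * (s - t) \<le> h i u s - h i u t"
    and cont: "\<And>i u. i \<in> I \<Longrightarrow> continuous_on {lo..hi} (h i u)"
    and lip: "\<And>i u w s e. i \<in> I \<Longrightarrow> \<forall>j\<in>I. u j \<in> {lo..hi} \<Longrightarrow> \<forall>j\<in>I. w j \<in> {lo..hi} \<Longrightarrow>
       \<forall>j\<in>I. \<bar>u j - w j\<bar> \<le> e \<Longrightarrow> s \<in> {lo..hi} \<Longrightarrow> h i w s - h i u s \<le> \<gamma> i * e"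
    and sign: "\<And>i u. i \<in> I \<Longrightarrow> \<forall>j\<in>I. u j \<in> {lo..hi} \<Longrightarrow> h i u lo \<le> 0 \<and> 0 \<le> h i u hi"
    and \<mu>: "\<And>i. i \<in> I \<Longrightarrow> 0 \<le> \<gamma> i" "\<And>i. i \<in> I \<Longrightarrow> \<gamma> i < \<mu> i"
  shows "\<exists>u. (\<forall>i\<in>I. u i \<in> {lo..hi}) \<and> (\<forall>i\<in>I. h i u (u i) - (\<Sum>j\<in>I. c i j * (u j - u i)) = 0)"
proof -
  define C where "C i = (\<Sum>j\<in>I. c i j)" for i
  have C0: "0 \<le> C i" if "i \<in> I" for i
    using c that by (simp add: C_def sum_nonneg)
  define rhs where "rhs u i = (\<Sum>j\<in>I. c i j * u j)" for u i
  have ex: "\<exists>s\<in>{lo..hi}. h i u s + C i * s = rhs u i" if u: "\<forall>j\<in>I. u j \<in> {lo..hi}" and i: "i \<in> I" for u i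
  proof -
    have "(\<Sum>j\<in>I. c i j * lo) \<le> (\<Sum>j\<in>I. c i j * u j)" "(\<Sum>j\<in>I. c i j * u j) \<le> (\<Sum>j\<in>I. c i j * hi)"
      using c i u by (auto intro!: sum_mono mult_left_mono)
    then have "h i u lo + C i * lo \<le> rhs u i" "rhs u i \<le> h i u hi + C i * hi"
      using sign[OF i u] by (auto simp: C_def rhs_def sum_distrib_right)
    moreover have "continuous_on {lo..hi} (\<lambda>s. h i u s + C i * s)"
      using cont[OF i, of u] by (intro continuous_intros)
    ultimately show ?thesis
      using IVT'[of "\<lambda>s. h i u s + C i * s" lo "rhs u i" hi] \<open>lo \<le> hi\<close> by auto
  qed
  define T where "T u i = (SOME s. s \<in> {lo..hi} \<and> h i u s + C i * s = rhs u i)" for u i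
  have T: "T u i \<in> {lo..hi} \<and> h i u (T u i) + C i * T u i = rhs u i"
    if "\<forall>j\<in>I. u j \<in> {lo..hi}" "i \<in> I" for u i
  proof -
    have "\<exists>s. s \<in> {lo..hi} \<and> h i u s + C i * s = rhs u i"
      using ex[OF that] by (simp only: Bex_def)
    from someI_ex[OF this] show ?thesis unfolding T_def .
  qed
  obtain q where q: "0 \<le> q" "q < 1" "\<forall>i\<in>I. C i + \<gamma> i \<le> q * (C i + \<mu> i)"
    using ball_finite_less_uniform[OF I, of "\<lambda>i. C i + \<gamma> i" "\<lambda>i. C i + \<mu> i"] C0 \<mu> by auto
  \<comment> \<open>The assumptions on \<open>h\<close> are one-sided; exchanging \<open>u\<close>
    and \<open>w\<close> yields the bound on the absolute value.\<close>
  have one_sided: "T u i - T w i \<le> q * e"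
    if u: "\<forall>j\<in>I. u j \<in> {lo..hi}" and w: "\<forall>j\<in>I. w j \<in> {lo..hi}"
      and e: "\<forall>j\<in>I. \<bar>u j - w j\<bar> \<le> e" and i: "i \<in> I" for u w e i
  proof (cases "T w i \<le> T u i")
    case True
    have e0: "e \<ge> 0" using e i by (meson abs_ge_zero order_trans)
    have pos: "0 < C i + \<mu> i" using C0[OF i] \<mu>[OF i] by auto
    have "rhs u i - rhs w i \<le> C i * e"
      unfolding C_def rhs_def sum_distrib_right sum_subtractf[symmetric] right_diff_distrib[symmetric]
      using c i e by (intro sum_mono mult_left_mono) fastforce+
    moreover have "h i w (T w i) - h i u (T w i) \<le> \<gamma> i * e"
      using T[OF w i] by (intro lip[OF i u w e]) simp
    moreover have "\<mu> i * (T u i - T w i) \<le> h i u (T u i) - h i u (T w i)"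
      using T[OF u i] T[OF w i] True by (intro mono[OF i u]) auto
    ultimately have "(C i + \<mu> i) * (T u i - T w i) \<le> (C i + \<gamma> i) * e"
      using T[OF u i] T[OF w i] by (simp add: algebra_simps)
    also have "\<dots> \<le> q * (C i + \<mu> i) * e"
      using q i e0 by (intro mult_right_mono) auto
    finally have "(C i + \<mu> i) * (T u i - T w i) \<le> (C i + \<mu> i) * (q * e)" by (simp add: mult_ac)
    then show ?thesis using pos by simp
  next
    case False
    have "e \<ge> 0" using e i by (meson abs_ge_zero order_trans)
    then have "0 \<le> q * e" using q by simp
    then show ?thesis using False by linarith
  qed
  have "\<exists>u. (\<forall>i\<in>I. u i \<in> {lo..hi}) \<and> (\<forall>i\<in>I. T u i = u i)"
  proof (rule finite_sup_contraction_fixpoint[OF I _ _ q(1,2)])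
    fix u w :: "'i \<Rightarrow> real" and e i
    assume *: "\<forall>j\<in>I. u j \<in> {lo..hi}" "\<forall>j\<in>I. w j \<in> {lo..hi}" "\<forall>j\<in>I. \<bar>u j - w j\<bar> \<le> e" "i \<in> I"
    show "\<bar>T u i - T w i\<bar> \<le> q * e"
      using one_sided[OF *] one_sided[OF *(2,1) _ *(4), of e] *(3) by (simp add: abs_minus_commute abs_le_iff)
  qed (use T \<open>lo \<le> hi\<close> in auto)
  then obtain u where u: "\<forall>i\<in>I. u i \<in> {lo..hi}" "\<forall>i\<in>I. T u i = u i" by blast
  have "h i u (u i) - (\<Sum>j\<in>I. c i j * (u j - u i)) = 0" if "i \<in> I" for i
  proof -
    have "(\<Sum>j\<in>I. c i j * (u j - u i)) = (\<Sum>j\<in>I. c i j * u j) - C i * u i"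
      by (simp add: C_def right_diff_distrib sum_subtractf sum_distrib_right)
    then show ?thesis using T[OF u(1) that] u(2) that by (simp add: rhs_def)
  qed
  with u show ?thesis by blast
qed

section \<open>The radiosity equation\<close>

text \<open>Here \<open>w\<close> stands for the fourth powers of the temperatures on the elements, \<open>\<tau>\<close> for that of the
  external temperature, and \<open>p\<close> for the view factors to the phantom closure, which vanish for the
  closed interface.\<close>

locale radiosity =
  fixes J :: "'b set" and a p :: "'b \<Rightarrow> real" and \<Lambda> :: "'b \<Rightarrow> 'b \<Rightarrow> real" and \<sigma> \<tau> :: real
  assumes J: "finite J" and a: "\<And>\<alpha>. \<alpha> \<in> J \<Longrightarrow> 0 < a \<alpha>" and p: "\<And>\<alpha>. \<alpha> \<in> J \<Longrightarrow> 0 \<le> p \<alpha>"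
    and \<Lambda>: "\<And>\<alpha> \<beta>. \<alpha> \<in> J \<Longrightarrow> \<beta> \<in> J \<Longrightarrow> 0 \<le> \<Lambda> \<alpha> \<beta>" "\<And>\<alpha>. \<alpha> \<in> J \<Longrightarrow> (\<Sum>\<beta>\<in>J. \<Lambda> \<alpha> \<beta>) + p \<alpha> = a \<alpha>"
    and \<sigma>: "0 < \<sigma>"
begin

text \<open>The rows of \<open>G R = E + E_ph\<close> for emissivities \<open>e\<close>, bundled
  with the range of \<open>e\<close> that makes the matrix strictly diagonally dominant.\<close>

definition solves :: "('b \<Rightarrow> real) \<Rightarrow> ('b \<Rightarrow> real) \<Rightarrow> ('b \<Rightarrow> real) \<Rightarrow> bool" where
  "solves e w R \<longleftrightarrow> (\<forall>\<alpha>\<in>J. 0 < e \<alpha> \<and> e \<alpha> \<le> 1 \<and>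
     a \<alpha> * R \<alpha> - (\<Sum>\<beta>\<in>J. (1 - e \<alpha>) * \<Lambda> \<alpha> \<beta> * R \<beta>)
       = \<sigma> * e \<alpha> * w \<alpha> * a \<alpha> + \<sigma> * (1 - e \<alpha>) * \<tau> * p \<alpha>)"

text \<open>The irradiation of an element; the \<open>V\<close>-terms of the scheme are the
  emissivity times this.\<close>

definition incident :: "('b \<Rightarrow> real) \<Rightarrow> 'b \<Rightarrow> real" where
  "incident R \<alpha> = (\<Sum>\<beta>\<in>J. R \<beta> * \<Lambda> \<alpha> \<beta>) + \<sigma> * \<tau> * p \<alpha>"

lemma row_sum_less:
  assumes "\<alpha> \<in> J" "0 < e" "e \<le> 1"
  shows "(\<Sum>\<beta>\<in>J. (1 - e) * \<Lambda> \<alpha> \<beta>) < a \<alpha>"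
proof -
  have "(\<Sum>\<beta>\<in>J. \<Lambda> \<alpha> \<beta>) \<le> a \<alpha>" using \<Lambda>(2)[OF assms(1)] p[OF assms(1)] by simp
  then have "(\<Sum>\<beta>\<in>J. (1 - e) * \<Lambda> \<alpha> \<beta>) \<le> (1 - e) * a \<alpha>"
    unfolding sum_distrib_left[symmetric] using assms by (intro mult_left_mono) auto
  also have "\<dots> < a \<alpha>" using a[OF assms(1)] assms(2) by (simp add: algebra_simps)
  finally show ?thesis .
qed

lemma nonneg_principle:
  assumes e: "\<And>\<alpha>. \<alpha> \<in> J \<Longrightarrow> 0 < e \<alpha> \<and> e \<alpha> \<le> 1"
    and x: "\<And>\<alpha>. \<alpha> \<in> J \<Longrightarrow> 0 \<le> a \<alpha> * x \<alpha> - (\<Sum>\<beta>\<in>J. (1 - e \<alpha>) * \<Lambda> \<alpha> \<beta> * x \<beta>)"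
    and "\<alpha> \<in> J"
  shows "0 \<le> x \<alpha>"
proof (rule dominant_nonneg[OF J _ _ x \<open>\<alpha> \<in> J\<close>])
  show "0 \<le> (1 - e \<alpha>) * \<Lambda> \<alpha> \<beta>" if "\<alpha> \<in> J" "\<beta> \<in> J" for \<alpha> \<beta>
    using e[OF that(1)] \<Lambda>(1)[OF that] by simp
  show "(\<Sum>\<beta>\<in>J. (1 - e \<alpha>) * \<Lambda> \<alpha> \<beta>) < a \<alpha>" if "\<alpha> \<in> J" for \<alpha>
    using row_sum_less[OF that] e[OF that] by blast
qed

text \<open>Here the row sums of the view factors enter: if all temperatures and, where
  \<open>p\<close> is nonzero, the external one agree, then the constant \<open>\<sigma>\<close>
  times their fourth power solves the radiosity equation. All bounds below compare with
  constants.\<close>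

lemma row_const:
  assumes "\<alpha> \<in> J"
  shows "a \<alpha> * c - (\<Sum>\<beta>\<in>J. (1 - e) * \<Lambda> \<alpha> \<beta> * c) = c * (e * a \<alpha> + (1 - e) * p \<alpha>)"
proof -
  have "(\<Sum>\<beta>\<in>J. (1 - e) * \<Lambda> \<alpha> \<beta> * c) = (1 - e) * (\<Sum>\<beta>\<in>J. \<Lambda> \<alpha> \<beta>) * c"
    by (simp add: sum_distrib_left sum_distrib_right)
  also have "(\<Sum>\<beta>\<in>J. \<Lambda> \<alpha> \<beta>) = a \<alpha> - p \<alpha>" using \<Lambda>(2)[OF assms] by simp
  finally show ?thesis by (simp add: algebra_simps)
qed

lemma row_diff:
  "a \<alpha> * (x \<alpha> - y \<alpha>) - (\<Sum>\<beta>\<in>J. c * \<Lambda> \<alpha> \<beta> * (x \<beta> - y \<beta>))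
    = (a \<alpha> * x \<alpha> - (\<Sum>\<beta>\<in>J. c * \<Lambda> \<alpha> \<beta> * x \<beta>)) - (a \<alpha> * y \<alpha> - (\<Sum>\<beta>\<in>J. c * \<Lambda> \<alpha> \<beta> * y \<beta>))"
  by (simp add: right_diff_distrib sum_subtractf)

text \<open>The difference of \<open>R\<close> and the constant \<open>\<sigma> * lo\<close> has a
  nonnegative right-hand side. The alternative \<open>p \<alpha> = 0\<close> covers elements that do
  not see the phantom closure, for which the external temperature is irrelevant.\<close>

lemma radiosity_lower:
  assumes s: "solves e w R" and lo: "\<And>\<alpha>. \<alpha> \<in> J \<Longrightarrow> lo \<le> w \<alpha>" "\<And>\<alpha>. \<alpha> \<in> J \<Longrightarrow> p \<alpha> = 0 \<or> lo \<le> \<tau>" and "\<alpha> \<in> J"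
  shows "\<sigma> * lo \<le> R \<alpha>"
proof -
  have "0 \<le> R \<alpha> - \<sigma> * lo"
  proof (rule nonneg_principle[where e = e and x = "\<lambda>\<alpha>. R \<alpha> - \<sigma> * lo"])
    fix \<alpha> assume \<alpha>: "\<alpha> \<in> J"
    note sa = bspec[OF s[unfolded solves_def] \<alpha>]
    show "0 < e \<alpha> \<and> e \<alpha> \<le> 1" using sa by blast
    have nn: "0 \<le> (w \<alpha> - lo) * a \<alpha>" "0 \<le> p \<alpha> * (\<tau> - lo)"
      using lo[OF \<alpha>] a[OF \<alpha>] p[OF \<alpha>] by auto
    have "0 \<le> \<sigma> * e \<alpha>" "0 \<le> \<sigma> * (1 - e \<alpha>)" using \<sigma> sa by simp_all
    then have "0 \<le> \<sigma> * e \<alpha> * ((w \<alpha> - lo) * a \<alpha>) + \<sigma> * (1 - e \<alpha>) * (p \<alpha> * (\<tau> - lo))"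
      by (intro add_nonneg_nonneg mult_nonneg_nonneg[OF _ nn(1)] mult_nonneg_nonneg[OF _ nn(2)])
    also have "\<dots> = \<sigma> * e \<alpha> * w \<alpha> * a \<alpha> + \<sigma> * (1 - e \<alpha>) * \<tau> * p \<alpha> - \<sigma> * lo * (e \<alpha> * a \<alpha> + (1 - e \<alpha>) * p \<alpha>)"
      by (simp add: algebra_simps)
    finally show "0 \<le> a \<alpha> * (R \<alpha> - \<sigma> * lo) - (\<Sum>\<beta>\<in>J. (1 - e \<alpha>) * \<Lambda> \<alpha> \<beta> * (R \<beta> - \<sigma> * lo))"
      unfolding row_diff[where x = R and y = "\<lambda>_. \<sigma> * lo"] row_const[OF \<alpha>] using sa by simp
  qed fact
  then show ?thesis by simp
qed

lemma radiosity_upper: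
  assumes s: "solves e w R" and hi: "\<And>\<alpha>. \<alpha> \<in> J \<Longrightarrow> w \<alpha> \<le> hi" "\<And>\<alpha>. \<alpha> \<in> J \<Longrightarrow> p \<alpha> = 0 \<or> \<tau> \<le> hi" and "\<alpha> \<in> J"
  shows "R \<alpha> \<le> \<sigma> * hi"
proof -
  have "0 \<le> \<sigma> * hi - R \<alpha>"
  proof (rule nonneg_principle[where e = e and x = "\<lambda>\<alpha>. \<sigma> * hi - R \<alpha>"])
    fix \<alpha> assume \<alpha>: "\<alpha> \<in> J"
    note sa = bspec[OF s[unfolded solves_def] \<alpha>]
    show "0 < e \<alpha> \<and> e \<alpha> \<le> 1" using sa by blast
    have nn: "0 \<le> (hi - w \<alpha>) * a \<alpha>" "0 \<le> p \<alpha> * (hi - \<tau>)"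
      using hi[OF \<alpha>] a[OF \<alpha>] p[OF \<alpha>] by auto
    have "0 \<le> \<sigma> * e \<alpha>" "0 \<le> \<sigma> * (1 - e \<alpha>)" using \<sigma> sa by simp_all
    then have "0 \<le> \<sigma> * e \<alpha> * ((hi - w \<alpha>) * a \<alpha>) + \<sigma> * (1 - e \<alpha>) * (p \<alpha> * (hi - \<tau>))"
      by (intro add_nonneg_nonneg mult_nonneg_nonneg[OF _ nn(1)] mult_nonneg_nonneg[OF _ nn(2)])
    also have "\<dots> = \<sigma> * hi * (e \<alpha> * a \<alpha> + (1 - e \<alpha>) * p \<alpha>) - (\<sigma> * e \<alpha> * w \<alpha> * a \<alpha> + \<sigma> * (1 - e \<alpha>) * \<tau> * p \<alpha>)"
      by (simp add: algebra_simps)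
    finally show "0 \<le> a \<alpha> * (\<sigma> * hi - R \<alpha>) - (\<Sum>\<beta>\<in>J. (1 - e \<alpha>) * \<Lambda> \<alpha> \<beta> * (\<sigma> * hi - R \<beta>))"
      unfolding row_diff[where x = "\<lambda>_. \<sigma> * hi" and y = R] row_const[OF \<alpha>] using sa by simp
  qed fact
  then show ?thesis by simp
qed

lemma sum_view_bound:
  assumes "\<alpha> \<in> J" "\<And>\<beta>. \<beta> \<in> J \<Longrightarrow> x \<beta> \<le> c"
  shows "(\<Sum>\<beta>\<in>J. x \<beta> * \<Lambda> \<alpha> \<beta>) \<le> c * (a \<alpha> - p \<alpha>)"
proof -
  have "(\<Sum>\<beta>\<in>J. x \<beta> * \<Lambda> \<alpha> \<beta>) \<le> (\<Sum>\<beta>\<in>J. c * \<Lambda> \<alpha> \<beta>)"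
    using assms \<Lambda>(1) by (intro sum_mono mult_right_mono) auto
  also have "\<dots> = c * (a \<alpha> - p \<alpha>)"
    using \<Lambda>(2)[OF assms(1)] by (simp add: sum_distrib_left[symmetric] eq_diff_eq)
  finally show ?thesis .
qed

lemma incident_lower:
  assumes s: "solves e w R" and lo: "\<And>\<alpha>. \<alpha> \<in> J \<Longrightarrow> lo \<le> w \<alpha>" "\<And>\<alpha>. \<alpha> \<in> J \<Longrightarrow> p \<alpha> = 0 \<or> lo \<le> \<tau>" and "\<alpha> \<in> J"
  shows "\<sigma> * lo * a \<alpha> \<le> incident R \<alpha>"
proof -
  have "- R \<beta> \<le> - (\<sigma> * lo)" if "\<beta> \<in> J" for \<beta>
    using radiosity_lower[OF s lo that] by simp
  from sum_view_bound[OF \<open>\<alpha> \<in> J\<close> this]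
  have "\<sigma> * lo * (a \<alpha> - p \<alpha>) \<le> (\<Sum>\<beta>\<in>J. R \<beta> * \<Lambda> \<alpha> \<beta>)" by (simp add: sum_negf)
  moreover have "\<sigma> * lo * p \<alpha> \<le> \<sigma> * \<tau> * p \<alpha>"
  proof (cases "p \<alpha> = 0")
    case False
    then have "lo \<le> \<tau>" using lo(2)[OF \<open>\<alpha> \<in> J\<close>] by simp
    then show ?thesis using p[OF \<open>\<alpha> \<in> J\<close>] \<sigma> by (intro mult_right_mono mult_left_mono) auto
  qed simp
  ultimately show ?thesis by (simp add: incident_def algebra_simps)
qed

lemma incident_upper:
  assumes s: "solves e w R" and hi: "\<And>\<alpha>. \<alpha> \<in> J \<Longrightarrow> w \<alpha> \<le> hi" "\<And>\<alpha>. \<alpha> \<in> J \<Longrightarrow> p \<alpha> = 0 \<or> \<tau> \<le> hi" and "\<alpha> \<in> J"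
  shows "incident R \<alpha> \<le> \<sigma> * hi * a \<alpha>"
proof -
  have "(\<Sum>\<beta>\<in>J. R \<beta> * \<Lambda> \<alpha> \<beta>) \<le> \<sigma> * hi * (a \<alpha> - p \<alpha>)"
    using radiosity_upper[OF s hi] by (intro sum_view_bound[OF \<open>\<alpha> \<in> J\<close>])
  moreover have "\<sigma> * \<tau> * p \<alpha> \<le> \<sigma> * hi * p \<alpha>"
  proof (cases "p \<alpha> = 0")
    case False
    then have "\<tau> \<le> hi" using hi(2)[OF \<open>\<alpha> \<in> J\<close>] by simp
    then show ?thesis using p[OF \<open>\<alpha> \<in> J\<close>] \<sigma> by (intro mult_right_mono mult_left_mono) auto
  qed simp
  ultimately show ?thesis by (simp add: incident_def algebra_simps)
qed

text \<open>\<open>R - R'\<close> solves the system with the matrix belonging to \<open>e\<close>;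
  its right-hand side combines \<open>e * (w - w')\<close> and \<open>e - e'\<close> times the gap
  between own emission and irradiation. This is at most \<open>K * e * a\<close>, hence at most the
  row value of the constant \<open>K\<close>. The factor 2 bounds that gap, as both parts are
  between 0 and \<open>\<sigma> * hi * a\<close>.\<close>

lemma radiosity_lipschitz:
  assumes s: "solves e w R" and s': "solves e' w' R'"
    and w: "\<And>\<alpha>. \<alpha> \<in> J \<Longrightarrow> 0 \<le> w' \<alpha> \<and> w' \<alpha> \<le> hi" and \<tau>: "0 \<le> \<tau>" "\<tau> \<le> hi"
    and dw: "\<And>\<alpha>. \<alpha> \<in> J \<Longrightarrow> \<bar>w \<alpha> - w' \<alpha>\<bar> \<le> dw" and de: "\<And>\<alpha>. \<alpha> \<in> J \<Longrightarrow> \<bar>e \<alpha> - e' \<alpha>\<bar> \<le> de"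
    and m: "0 < m" "\<And>\<alpha>. \<alpha> \<in> J \<Longrightarrow> m \<le> e \<alpha>"
    and "\<alpha> \<in> J"
  shows "R \<alpha> - R' \<alpha> \<le> \<sigma> * (dw + 2 * hi * de / m)"
proof -
  define K where "K = \<sigma> * (dw + 2 * hi * de / m)"
  have nn: "0 \<le> dw" "0 \<le> de" using dw[OF \<open>\<alpha> \<in> J\<close>] de[OF \<open>\<alpha> \<in> J\<close>] by auto
  have K: "0 \<le> K" unfolding K_def using \<sigma> \<tau> nn m by (intro mult_nonneg_nonneg add_nonneg_nonneg divide_nonneg_nonneg) auto
  have "0 \<le> K - (R \<alpha> - R' \<alpha>)"
  proof (rule nonneg_principle[where e = e and x = "\<lambda>\<alpha>. K - (R \<alpha> - R' \<alpha>)"])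
    fix \<alpha> assume \<alpha>: "\<alpha> \<in> J"
    note sa = bspec[OF s[unfolded solves_def] \<alpha>] and sa' = bspec[OF s'[unfolded solves_def] \<alpha>]
    show "0 < e \<alpha> \<and> e \<alpha> \<le> 1" using sa by blast
    have inc: "0 \<le> incident R' \<alpha>" "incident R' \<alpha> \<le> \<sigma> * hi * a \<alpha>"
      using incident_lower[OF s', of 0 \<alpha>] incident_upper[OF s', of hi \<alpha>] w \<tau> \<alpha> by auto
    \<comment> \<open>Both equations are brought to the same matrix; the correction is what turns
      into the irradiation term.\<close>
    have "(\<Sum>\<beta>\<in>J. (1 - e \<alpha>) * \<Lambda> \<alpha> \<beta> * R' \<beta>) = (\<Sum>\<beta>\<in>J. (1 - e' \<alpha>) * \<Lambda> \<alpha> \<beta> * R' \<beta>) - (e \<alpha> - e' \<alpha>) * (\<Sum>\<beta>\<in>J. R' \<beta> * \<Lambda> \<alpha> \<beta>)"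
      by (simp add: sum_distrib_left sum_subtractf[symmetric] algebra_simps)
    then have row: "a \<alpha> * (R \<alpha> - R' \<alpha>) - (\<Sum>\<beta>\<in>J. (1 - e \<alpha>) * \<Lambda> \<alpha> \<beta> * (R \<beta> - R' \<beta>))
        = \<sigma> * e \<alpha> * w \<alpha> * a \<alpha> - \<sigma> * e' \<alpha> * w' \<alpha> * a \<alpha> - (e \<alpha> - e' \<alpha>) * incident R' \<alpha>"
      unfolding row_diff incident_def using sa sa' by (simp add: algebra_simps)
    also have "\<dots> = \<sigma> * a \<alpha> * (e \<alpha> * (w \<alpha> - w' \<alpha>)) + (e \<alpha> - e' \<alpha>) * (\<sigma> * a \<alpha> * w' \<alpha> - incident R' \<alpha>)"
      by (simp add: algebra_simps)
    also have "\<dots> \<le> \<sigma> * a \<alpha> * (e \<alpha> * dw) + de * (2 * (\<sigma> * hi * a \<alpha>))"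
    proof (rule add_mono)
      have "w \<alpha> - w' \<alpha> \<le> dw" using dw[OF \<alpha>] by simp
      then show "\<sigma> * a \<alpha> * (e \<alpha> * (w \<alpha> - w' \<alpha>)) \<le> \<sigma> * a \<alpha> * (e \<alpha> * dw)"
        using \<sigma> a[OF \<alpha>] sa by (intro mult_left_mono) auto
      have "\<sigma> * a \<alpha> * w' \<alpha> \<le> \<sigma> * a \<alpha> * hi" "0 \<le> \<sigma> * a \<alpha> * w' \<alpha>"
        using w[OF \<alpha>] \<sigma> a[OF \<alpha>] by (auto intro!: mult_left_mono)
      then have "\<bar>\<sigma> * a \<alpha> * w' \<alpha> - incident R' \<alpha>\<bar> \<le> 2 * (\<sigma> * hi * a \<alpha>)"
        using inc by (simp add: abs_le_iff algebra_simps)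
      then have "\<bar>e \<alpha> - e' \<alpha>\<bar> * \<bar>\<sigma> * a \<alpha> * w' \<alpha> - incident R' \<alpha>\<bar> \<le> de * (2 * (\<sigma> * hi * a \<alpha>))"
        using de[OF \<alpha>] nn by (intro mult_mono) auto
      then show "(e \<alpha> - e' \<alpha>) * (\<sigma> * a \<alpha> * w' \<alpha> - incident R' \<alpha>) \<le> de * (2 * (\<sigma> * hi * a \<alpha>))"
        by (simp add: abs_mult[symmetric] abs_le_iff)
    qed
    also have "\<dots> \<le> \<sigma> * a \<alpha> * (e \<alpha> * dw) + \<sigma> * a \<alpha> * (e \<alpha> * (2 * hi * de / m))"
    proof -
      \<comment> \<open>The comparison function has the factor \<open>e \<alpha>\<close>, which this
        term lacks; inserting it costs the division by the minimal emissivity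
        \<open>m\<close>.\<close>
      have "2 * hi * de * 1 \<le> 2 * hi * de * (e \<alpha> / m)"
        using m(1) m(2)[OF \<alpha>] \<tau> nn by (intro mult_left_mono) auto
      then have "\<sigma> * a \<alpha> * (2 * hi * de) \<le> \<sigma> * a \<alpha> * (e \<alpha> * (2 * hi * de / m))"
        using \<sigma> a[OF \<alpha>] by (intro mult_left_mono) (auto simp: mult_ac)
      then show ?thesis by (simp add: mult_ac)
    qed
    also have "\<dots> = K * (e \<alpha> * a \<alpha>)" by (simp add: K_def algebra_simps)
    also have "\<dots> \<le> K * (e \<alpha> * a \<alpha> + (1 - e \<alpha>) * p \<alpha>)"
      using K sa p[OF \<alpha>] by (intro mult_left_mono) auto
    finally show "0 \<le> a \<alpha> * (K - (R \<alpha> - R' \<alpha>)) - (\<Sum>\<beta>\<in>J. (1 - e \<alpha>) * \<Lambda> \<alpha> \<beta> * (K - (R \<beta> - R' \<beta>)))"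
      unfolding row_diff[where x = "\<lambda>_. K" and y = "\<lambda>\<alpha>. R \<alpha> - R' \<alpha>"] row_const[OF \<alpha>] by simp
  qed fact
  then show ?thesis by (simp add: K_def)
qed

lemma incident_lipschitz:
  assumes "solves e w R" "solves e' w' R'"
    and "\<And>\<alpha>. \<alpha> \<in> J \<Longrightarrow> 0 \<le> w' \<alpha> \<and> w' \<alpha> \<le> hi" and "0 \<le> \<tau>" "\<tau> \<le> hi"
    and dw: "\<And>\<alpha>. \<alpha> \<in> J \<Longrightarrow> \<bar>w \<alpha> - w' \<alpha>\<bar> \<le> dw" and de: "\<And>\<alpha>. \<alpha> \<in> J \<Longrightarrow> \<bar>e \<alpha> - e' \<alpha>\<bar> \<le> de"
    and "0 < m" "\<And>\<alpha>. \<alpha> \<in> J \<Longrightarrow> m \<le> e \<alpha>"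
    and \<alpha>: "\<alpha> \<in> J"
  shows "incident R \<alpha> - incident R' \<alpha> \<le> \<sigma> * (dw + 2 * hi * de / m) * a \<alpha>"
proof -
  let ?K = "\<sigma> * (dw + 2 * hi * de / m)"
  have nn: "0 \<le> dw" "0 \<le> de" using dw[OF \<alpha>] de[OF \<alpha>] by auto
  have K: "0 \<le> ?K"
    using \<sigma> assms(4,5,8) nn by (intro mult_nonneg_nonneg add_nonneg_nonneg divide_nonneg_nonneg) auto
  have "incident R \<alpha> - incident R' \<alpha> = (\<Sum>\<beta>\<in>J. (R \<beta> - R' \<beta>) * \<Lambda> \<alpha> \<beta>)"
    by (simp add: incident_def left_diff_distrib sum_subtractf)
  also have "\<dots> \<le> ?K * (a \<alpha> - p \<alpha>)"
    by (rule sum_view_bound[OF \<alpha>]) (rule radiosity_lipschitz[OF assms(1-9)])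
  also have "\<dots> \<le> ?K * a \<alpha>" using K p[OF \<alpha>] by (intro mult_left_mono) auto
  finally show ?thesis .
qed

end

section \<open>The emissivity\<close>

lemma lip_const_bound:
  assumes "bdd_above (diff_quots e r)" "s \<in> {0..r}" "t \<in> {0..r}" "0 < r"
  shows "\<bar>e s - e t\<bar> \<le> lip_const e r * \<bar>s - t\<bar>"
proof (cases "s = t")
  case False
  then have "\<bar>e s - e t\<bar> / \<bar>s - t\<bar> \<in> diff_quots e r"
    using assms unfolding diff_quots_def by blast
  then have "\<bar>e s - e t\<bar> / \<bar>s - t\<bar> \<le> lip_const e r"
    using assms cSup_upper unfolding lip_const_def by simp
  then show ?thesis using False by (simp add: pos_divide_le_eq)
qed simp

lemma lip_const_nonneg:
  assumes "bdd_above (diff_quots e r)" "0 < r"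
  shows "0 \<le> lip_const e r"
proof -
  have "0 \<le> \<bar>e r - e 0\<bar>" by simp
  also have "\<dots> \<le> lip_const e r * \<bar>r - 0\<bar>" using assms by (intro lip_const_bound) auto
  finally show ?thesis using assms(2) by (simp add: zero_le_mult_iff)
qed

text \<open>\<open>Sup\<close> of a set of reals says something only if the set is bounded: every
  downward jump is at most the Lipschitz constant times the step, and the steps sum up to
  \<open>r\<close>.\<close>

lemma neg_var_nonneg:
  assumes bdd: "bdd_above (diff_quots e r)" and r: "0 < r"
  shows "0 \<le> neg_var e r"
proof -
  let ?S = "{(\<Sum>l=1..n. - min 0 (e (s l) - e (s (l - 1)))) | (n :: nat) (s :: nat \<Rightarrow> real).
            s 0 = 0 \<and> s n = r \<and> (\<forall>l<n. s l < s (Suc l))}"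
  have bound: "(\<Sum>l=1..n. - min 0 (e (s l) - e (s (l - 1)))) \<le> lip_const e r * r"
    if s: "s 0 = 0" "s n = r" "\<forall>l<n. s l < s (Suc l)" for n :: nat and s :: "nat \<Rightarrow> real"
  proof -
    have step: "s l \<le> s (Suc l)" if "l \<in> {0..<n}" for l using s(3) that by (simp add: less_imp_le)
    have mono: "s k \<le> s l" if "k \<le> l" "l \<le> n" for k l
      using that
    proof (induction l)
      case (Suc l)
      show ?case
      proof (cases "k = Suc l")
        case False
        then have "s k \<le> s l" using Suc by simp
        also have "s l \<le> s (Suc l)" using step[of l] Suc.prems by simp
        finally show ?thesis .
      qed simp
    qed simp
    have rng: "s l \<in> {0..r}" if "l \<le> n" for l using mono[of 0 l] mono[of l n] that s by simp
    have "(\<Sum>l=1..n. - min 0 (e (s l) - e (s (l - 1)))) \<le> (\<Sum>l=1..n. lip_const e r * (s l - s (l - 1)))"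
    proof (rule sum_mono)
      fix l assume l: "l \<in> {1..n}"
      have "- min 0 (e (s l) - e (s (l - 1))) \<le> \<bar>e (s l) - e (s (l - 1))\<bar>" by simp
      also have "\<dots> \<le> lip_const e r * \<bar>s l - s (l - 1)\<bar>"
        using l by (intro lip_const_bound bdd rng r) auto
      also have "\<bar>s l - s (l - 1)\<bar> = s l - s (l - 1)" using mono[of "l - 1" l] l by simp
      finally show "- min 0 (e (s l) - e (s (l - 1))) \<le> lip_const e r * (s l - s (l - 1))" .
    qed
    also have "\<dots> = lip_const e r * (\<Sum>l=1..n. s l - s (l - 1))" by (simp add: sum_distrib_left)
    also have "(\<Sum>l=1..n. s l - s (l - 1)) = s n - s 0"
      using sum_telescope''[of 0 n s] by simp
    finally show ?thesis using s by simp
  qed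
  have "bdd_above ?S" unfolding bdd_above_def using bound by blast
  \<comment> \<open>The partition with the single step from 0 to \<open>r\<close> gives a
    nonnegative member.\<close>
  moreover have "(\<Sum>l=1..(1::nat). - min 0 (e (real l * r) - e (real (l - 1) * r))) \<in> ?S"
    using r by (intro CollectI exI[of _ "1 :: nat"] exI[of _ "\<lambda>l. real l * r"]) auto
  then have "- min 0 (e r - e 0) \<in> ?S" by simp
  moreover have "0 \<le> - min 0 (e r - e 0)" by simp
  ultimately have "0 \<le> Sup ?S" by (meson cSup_upper order_trans)
  then show ?thesis using r by (simp add: neg_var_def)
qed

lemma power4_lipschitz:
  fixes s t r :: real
  assumes "s \<in> {0..r}" "t \<in> {0..r}"
  shows "\<bar>s ^ 4 - t ^ 4\<bar> \<le> 4 * r ^ 3 * \<bar>s - t\<bar>"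
proof -
  have "s ^ 4 - t ^ 4 = (s - t) * ((s + t) * (s\<^sup>2 + t\<^sup>2))"
    by (simp add: algebra_simps power2_eq_square power4_eq_xxxx)
  moreover have "(s + t) * (s\<^sup>2 + t\<^sup>2) \<le> (r + r) * (r\<^sup>2 + r\<^sup>2)"
    using assms by (intro mult_mono add_mono power_mono) auto
  moreover have "0 \<le> (s + t) * (s\<^sup>2 + t\<^sup>2)" using assms by simp
  ultimately have "\<bar>s ^ 4 - t ^ 4\<bar> \<le> \<bar>s - t\<bar> * ((r + r) * (r\<^sup>2 + r\<^sup>2))"
    by (simp add: abs_mult mult_left_mono)
  then show ?thesis by (simp add: algebra_simps power2_eq_square power3_eq_cube)
qed

section \<open>The scheme for one time step\<close>

context admissible_scheme
begin

abbreviation "\<sigma> \<equiv> stefan_boltzmann d"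
abbreviation "\<epsilon> \<equiv> emissivity d"
abbreviation "\<theta> \<equiv> theta_ext d"

lemma consts_pos: "0 < energy_const d" "0 < \<sigma>" "0 < \<theta>"
  and energy_cont: "continuous_on {0..} (energy d m)"
  and energy_mono: "0 \<le> s \<Longrightarrow> s \<le> t \<Longrightarrow> (t - s) * energy_const d + energy d m s \<le> energy d m t"
  and conductivity_nonneg: "0 \<le> conductivity d m"
  and \<epsilon>_range: "0 \<le> s \<Longrightarrow> 0 < \<epsilon> s" "0 \<le> s \<Longrightarrow> \<epsilon> s \<le> 1"
  using adm_data unfolding admissible_data_def by blast+

lemma \<epsilon>_bdd: "0 \<le> r \<Longrightarrow> bdd_above (diff_quots \<epsilon> r)"
  using adm_data unfolding admissible_data_def by (elim conjE) simp

lemma \<epsilon>_lipschitz: "0 < r \<Longrightarrow> s \<in> {0..r} \<Longrightarrow> t \<in> {0..r} \<Longrightarrow> \<bar>\<epsilon> s - \<epsilon> t\<bar> \<le> lip_const \<epsilon> r * \<bar>s - t\<bar>"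
  using lip_const_bound \<epsilon>_bdd by simp

lemma \<epsilon>_continuous:
  assumes "0 < r"
  shows "continuous_on {0..r} \<epsilon>"
proof -
  have "(lip_const \<epsilon> r)-lipschitz_on {0..r} \<epsilon>"
    using \<epsilon>_lipschitz[OF assms] lip_const_nonneg[OF \<epsilon>_bdd assms] assms
    by (intro lipschitz_onI) (auto simp: dist_real_def)
  then show ?thesis by (rule lipschitz_on_continuous_on)
qed

text \<open>Local Lipschitz continuity makes the emissivity continuous on a compact interval, so its
  infimum is attained and therefore positive.\<close>

lemma eps_min_bounds:
  assumes "0 < r"
  shows "0 < eps_min d r" "\<And>s. s \<in> {0..r} \<Longrightarrow> eps_min d r \<le> \<epsilon> s" "eps_min d r \<le> 1"
proof -
  have "compact (\<epsilon> ` {0..r})" by (intro compact_continuous_image \<epsilon>_continuous assms) simp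
  moreover have "\<epsilon> ` {0..r} \<noteq> {}" using assms by simp
  ultimately obtain s where s: "s \<in> {0..r}" "\<forall>y\<in>\<epsilon> ` {0..r}. \<epsilon> s \<le> y"
    using compact_attains_inf by blast
  then have eq: "eps_min d r = \<epsilon> s"
    unfolding eps_min_def by (intro cInf_eq_minimum) auto
  show "0 < eps_min d r" "eps_min d r \<le> 1" unfolding eq using \<epsilon>_range s by auto
  show "eps_min d r \<le> \<epsilon> t" if "t \<in> {0..r}" for t unfolding eq using s that by blast
qed

section \<open>Emission and absorption of a single cell\<close>

definition u\<Omega> :: "('i \<Rightarrow> real) \<Rightarrow> 'b \<Rightarrow> real" where
  "u\<Omega> u = (\<lambda>\<beta>\<in>I_Omega d. u (cell_of_Omega d \<beta>))"

definition u\<Sigma> :: "('i \<Rightarrow> real) \<Rightarrow> 'b \<Rightarrow> real" where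
  "u\<Sigma> u = (\<lambda>\<beta>\<in>I_Sigma d. u (cell_of_Sigma d \<beta>))"

lemma u\<Omega>_apply [simp]: "\<alpha> \<in> I_Omega d \<Longrightarrow> u\<Omega> u \<alpha> = u (cell_of_Omega d \<alpha>)"
  by (simp add: u\<Omega>_def)

lemma u\<Sigma>_apply [simp]: "\<alpha> \<in> I_Sigma d \<Longrightarrow> u\<Sigma> u \<alpha> = u (cell_of_Sigma d \<alpha>)"
  by (simp add: u\<Sigma>_def)

sublocale Om: radiosity "I_Omega d" "\<lambda>\<alpha>. area (face d \<alpha>)" "\<lambda>\<alpha>. view_coeff d \<alpha> (ph_index d)" "view_coeff d"
  "\<sigma>" "\<theta> ^ 4"
  by unfold_locales
    (use finite_Omega face_plane(3) view_coeff_nonneg view_coeff_sum_Omega consts_pos in auto)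

sublocale Si: radiosity "I_Sigma d" "\<lambda>\<alpha>. area (face d \<alpha>)" "\<lambda>_. 0" "view_coeff d" "\<sigma>" "\<theta> ^ 4"
  by unfold_locales
    (use finite_Sigma face_plane(3) view_coeff_nonneg view_coeff_sum_Sigma consts_pos in auto)

lemma R_Gamma_solves:
  assumes u: "\<And>\<alpha>. \<alpha> \<in> I_Omega d \<Longrightarrow> 0 \<le> u \<alpha>"
  shows "Om.solves (\<lambda>\<alpha>. \<epsilon> (u \<alpha>)) (\<lambda>\<alpha>. u \<alpha> ^ 4) (R_Gamma d u)"
  unfolding Om.solves_def
proof (intro ballI conjI)
  fix \<alpha> assume \<alpha>: "\<alpha> \<in> I_Omega d"
  show "0 < \<epsilon> (u \<alpha>)" "\<epsilon> (u \<alpha>) \<le> 1" using \<epsilon>_range u[OF \<alpha>] by auto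
  have "area (face d \<alpha>) * R_Gamma d u \<alpha> - (\<Sum>\<beta>\<in>I_Omega d. (1 - \<epsilon> (u \<alpha>)) * view_coeff d \<alpha> \<beta> * R_Gamma d u \<beta>)
      = rad_E d u \<alpha> + rad_E_ph d u \<alpha>"
    unfolding R_Gamma_def
  proof (rule matrix_inv_on_solves[OF finite_Omega _ _ _ \<alpha>])
    fix \<alpha> \<beta> assume \<alpha>: "\<alpha> \<in> I_Omega d"
    show "rad_G d u \<alpha> \<beta> = (if \<alpha> = \<beta> then area (face d \<alpha>) else 0) - (1 - \<epsilon> (u \<alpha>)) * view_coeff d \<alpha> \<beta>"
      by (simp add: rad_G_def)
    show "0 \<le> (1 - \<epsilon> (u \<alpha>)) * view_coeff d \<alpha> \<beta>" using \<epsilon>_range u[OF \<alpha>] view_coeff_nonneg by simp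
    show "(\<Sum>\<beta>\<in>I_Omega d. (1 - \<epsilon> (u \<alpha>)) * view_coeff d \<alpha> \<beta>) < area (face d \<alpha>)"
      using \<epsilon>_range u[OF \<alpha>] by (intro Om.row_sum_less \<alpha>) auto
  qed
  then show "area (face d \<alpha>) * R_Gamma d u \<alpha> - (\<Sum>\<beta>\<in>I_Omega d. (1 - \<epsilon> (u \<alpha>)) * view_coeff d \<alpha> \<beta> * R_Gamma d u \<beta>)
      = \<sigma> * \<epsilon> (u \<alpha>) * u \<alpha> ^ 4 * area (face d \<alpha>) + \<sigma> * (1 - \<epsilon> (u \<alpha>)) * \<theta> ^ 4 * view_coeff d \<alpha> (ph_index d)"
    by (simp add: rad_E_def rad_E_ph_def)
qed

lemma R_Sigma_solves:
  assumes u: "\<And>\<alpha>. \<alpha> \<in> I_Sigma d \<Longrightarrow> 0 \<le> u \<alpha>"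
  shows "Si.solves (\<lambda>\<alpha>. \<epsilon> (u \<alpha>)) (\<lambda>\<alpha>. u \<alpha> ^ 4) (R_Sigma d u)"
  unfolding Si.solves_def
proof (intro ballI conjI)
  fix \<alpha> assume \<alpha>: "\<alpha> \<in> I_Sigma d"
  show "0 < \<epsilon> (u \<alpha>)" "\<epsilon> (u \<alpha>) \<le> 1" using \<epsilon>_range u[OF \<alpha>] by auto
  have "area (face d \<alpha>) * R_Sigma d u \<alpha> - (\<Sum>\<beta>\<in>I_Sigma d. (1 - \<epsilon> (u \<alpha>)) * view_coeff d \<alpha> \<beta> * R_Sigma d u \<beta>)
      = rad_E d u \<alpha>"
    unfolding R_Sigma_def
  proof (rule matrix_inv_on_solves[OF finite_Sigma _ _ _ \<alpha>])
    fix \<alpha> \<beta> assume \<alpha>: "\<alpha> \<in> I_Sigma d"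
    show "rad_G d u \<alpha> \<beta> = (if \<alpha> = \<beta> then area (face d \<alpha>) else 0) - (1 - \<epsilon> (u \<alpha>)) * view_coeff d \<alpha> \<beta>"
      by (simp add: rad_G_def)
    show "0 \<le> (1 - \<epsilon> (u \<alpha>)) * view_coeff d \<alpha> \<beta>" using \<epsilon>_range u[OF \<alpha>] view_coeff_nonneg by simp
    show "(\<Sum>\<beta>\<in>I_Sigma d. (1 - \<epsilon> (u \<alpha>)) * view_coeff d \<alpha> \<beta>) < area (face d \<alpha>)"
      using \<epsilon>_range u[OF \<alpha>] by (intro Si.row_sum_less \<alpha>) auto
  qed
  then show "area (face d \<alpha>) * R_Sigma d u \<alpha> - (\<Sum>\<beta>\<in>I_Sigma d. (1 - \<epsilon> (u \<alpha>)) * view_coeff d \<alpha> \<beta> * R_Sigma d u \<beta>)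
      = \<sigma> * \<epsilon> (u \<alpha>) * u \<alpha> ^ 4 * area (face d \<alpha>) + \<sigma> * (1 - \<epsilon> (u \<alpha>)) * \<theta> ^ 4 * 0"
    by (simp add: rad_E_def)
qed

text \<open>The emissivity is split off the \<open>V\<close>-terms: in the Jacobi iteration it has to be evaluated at
  the unknown of the \<open>i\<close>-th equation, while the incident radiation is frozen. Freezing both would
  destroy the signs at the two bounds.\<close>

definition inc :: "'i \<Rightarrow> ('i \<Rightarrow> real) \<Rightarrow> real" where
  "inc i u = (\<Sum>\<alpha>\<in>J_Omega d i. Om.incident (R_Gamma d (u\<Omega> u)) \<alpha>) + (\<Sum>\<alpha>\<in>J_Sigma d i. Si.incident (R_Sigma d (u\<Sigma> u)) \<alpha>)"

definition surf :: "'i \<Rightarrow> real" where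
  "surf i = area (frontier (phase_cell d Solid i) \<inter> Gamma_Omega d) + area (cell d i \<inter> interface d)"

lemma surf_eq: "i \<in> cells d \<Longrightarrow> surf i = (\<Sum>\<alpha>\<in>J_Omega d i. area (face d \<alpha>)) + (\<Sum>\<alpha>\<in>J_Sigma d i. area (face d \<alpha>))"
  using sum_area_Omega sum_area_Sigma by (simp add: surf_def)

lemma J_subset: "J_Omega d i \<subseteq> I_Omega d" "J_Sigma d i \<subseteq> I_Sigma d"
  by (auto simp: J_Omega_def J_Sigma_def)

text \<open>All elements counted for cell \<open>i\<close> are attached to it and have temperature
  \<open>u i\<close>, so the emissivity is a common factor.\<close>

lemma V_sum:
  assumes "i \<in> cells d"
  shows "(\<Sum>\<alpha>\<in>J_Omega d i. V_Gamma d (u\<Omega> u) \<alpha>) + (\<Sum>\<alpha>\<in>J_Sigma d i. V_Sigma d (u\<Sigma> u) \<alpha>) = \<epsilon> (u i) * inc i u"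
proof -
  have "V_Gamma d (u\<Omega> u) \<alpha> = \<epsilon> (u i) * Om.incident (R_Gamma d (u\<Omega> u)) \<alpha>" if "\<alpha> \<in> J_Omega d i" for \<alpha>
    using that unfolding J_Omega_eq[OF assms] by (simp add: V_Gamma_def Om.incident_def algebra_simps)
  moreover have "V_Sigma d (u\<Sigma> u) \<alpha> = \<epsilon> (u i) * Si.incident (R_Sigma d (u\<Sigma> u)) \<alpha>" if "\<alpha> \<in> J_Sigma d i" for \<alpha>
    using that unfolding J_Sigma_eq[OF assms] by (simp add: V_Sigma_def Si.incident_def)
  ultimately show ?thesis by (simp add: inc_def sum_distrib_left distrib_left)
qed

lemma inc_lower:
  assumes i: "i \<in> cells d" and u: "\<And>j. j \<in> cells d \<Longrightarrow> lo \<le> u j" and lo: "0 \<le> lo" "lo \<le> \<theta>"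
  shows "\<sigma> * lo ^ 4 * surf i \<le> inc i u"
proof -
  have "lo ^ 4 \<le> \<theta> ^ 4" using lo by (intro power_mono)
  have "\<sigma> * lo ^ 4 * area (face d \<alpha>) \<le> Om.incident (R_Gamma d (u\<Omega> u)) \<alpha>" if "\<alpha> \<in> J_Omega d i" for \<alpha>
  proof (rule Om.incident_lower[OF R_Gamma_solves])
    show "0 \<le> u\<Omega> u \<alpha>" "lo ^ 4 \<le> u\<Omega> u \<alpha> ^ 4" if "\<alpha> \<in> I_Omega d" for \<alpha>
      using u[OF cell_of_Omega(1)[OF that]] lo that by (auto intro!: power_mono)
  qed (use that J_subset \<open>lo ^ 4 \<le> \<theta> ^ 4\<close> in auto)
  moreover have "\<sigma> * lo ^ 4 * area (face d \<alpha>) \<le> Si.incident (R_Sigma d (u\<Sigma> u)) \<alpha>" if "\<alpha> \<in> J_Sigma d i" for \<alpha>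
  proof (rule Si.incident_lower[OF R_Sigma_solves])
    show "0 \<le> u\<Sigma> u \<alpha>" "lo ^ 4 \<le> u\<Sigma> u \<alpha> ^ 4" if "\<alpha> \<in> I_Sigma d" for \<alpha>
      using u[OF cell_of_Sigma(1)[OF that]] lo that by (auto intro!: power_mono)
  qed (use that J_subset in auto)
  ultimately show ?thesis
    unfolding surf_eq[OF i] inc_def distrib_left sum_distrib_left by (intro add_mono sum_mono)
qed

lemma inc_upper:
  assumes i: "i \<in> cells d" and u: "\<And>j. j \<in> cells d \<Longrightarrow> 0 \<le> u j" "\<And>j. j \<in> cells d \<Longrightarrow> u j \<le> hi" and hi: "\<theta> \<le> hi"
  shows "inc i u \<le> \<sigma> * hi ^ 4 * surf i"
proof -
  have "\<theta> ^ 4 \<le> hi ^ 4" using hi consts_pos by (intro power_mono) auto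
  have "Om.incident (R_Gamma d (u\<Omega> u)) \<alpha> \<le> \<sigma> * hi ^ 4 * area (face d \<alpha>)" if "\<alpha> \<in> J_Omega d i" for \<alpha>
  proof (rule Om.incident_upper[OF R_Gamma_solves])
    show "0 \<le> u\<Omega> u \<alpha>" "u\<Omega> u \<alpha> ^ 4 \<le> hi ^ 4" if "\<alpha> \<in> I_Omega d" for \<alpha>
      using u[OF cell_of_Omega(1)[OF that]] that by (auto intro!: power_mono)
  qed (use that J_subset \<open>\<theta> ^ 4 \<le> hi ^ 4\<close> in auto)
  moreover have "Si.incident (R_Sigma d (u\<Sigma> u)) \<alpha> \<le> \<sigma> * hi ^ 4 * area (face d \<alpha>)" if "\<alpha> \<in> J_Sigma d i" for \<alpha>
  proof (rule Si.incident_upper[OF R_Sigma_solves])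
    show "0 \<le> u\<Sigma> u \<alpha>" "u\<Sigma> u \<alpha> ^ 4 \<le> hi ^ 4" if "\<alpha> \<in> I_Sigma d" for \<alpha>
      using u[OF cell_of_Sigma(1)[OF that]] that by (auto intro!: power_mono)
  qed (use that J_subset in auto)
  ultimately show ?thesis
    unfolding surf_eq[OF i] inc_def distrib_left sum_distrib_left by (intro add_mono sum_mono)
qed

text \<open>The Lipschitz bound for the irradiation with \<open>4 * r ^ 3\<close> for the fourth
  powers and \<open>lip_const \<epsilon> r\<close> for the emissivity, summed over the elements of
  the cell.\<close>

lemma inc_lipschitz:
  assumes i: "i \<in> cells d" and r: "\<theta> \<le> r"
    and u: "\<And>j. j \<in> cells d \<Longrightarrow> u j \<in> {0..r}" and w: "\<And>j. j \<in> cells d \<Longrightarrow> w j \<in> {0..r}"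
    and \<delta>: "\<And>j. j \<in> cells d \<Longrightarrow> \<bar>u j - w j\<bar> \<le> \<delta>"
  shows "inc i u - inc i w \<le> \<sigma> * (4 * r ^ 3 + 2 * r ^ 4 * lip_const \<epsilon> r / eps_min d r) * \<delta> * surf i"
proof -
  have r0: "0 < r" using r consts_pos by simp
  let ?L = "lip_const \<epsilon> r"
  let ?K = "\<sigma> * (4 * r ^ 3 * \<delta> + 2 * r ^ 4 * (?L * \<delta>) / eps_min d r)"
  have L0: "0 \<le> ?L" using lip_const_nonneg[OF \<epsilon>_bdd] r0 by simp
  have p4: "\<bar>u j ^ 4 - w j ^ 4\<bar> \<le> 4 * r ^ 3 * \<delta>" if "j \<in> cells d" for j
    by (rule order_trans[OF power4_lipschitz[OF u[OF that] w[OF that]] mult_left_mono[OF \<delta>[OF that]]])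
      (use r0 in simp)
  have le: "\<bar>\<epsilon> (u j) - \<epsilon> (w j)\<bar> \<le> ?L * \<delta>" if "j \<in> cells d" for j
    by (rule order_trans[OF \<epsilon>_lipschitz[OF r0 u[OF that] w[OF that]] mult_left_mono[OF \<delta>[OF that] L0]])
  have w4: "0 \<le> w j ^ 4 \<and> w j ^ 4 \<le> r ^ 4" if "j \<in> cells d" for j
    using w[OF that] by (auto intro!: power_mono)
  have \<theta>4: "0 \<le> \<theta> ^ 4" "\<theta> ^ 4 \<le> r ^ 4" using r consts_pos by (auto intro!: power_mono)
  have "Om.incident (R_Gamma d (u\<Omega> u)) \<alpha> - Om.incident (R_Gamma d (u\<Omega> w)) \<alpha> \<le> ?K * area (face d \<alpha>)"
    if "\<alpha> \<in> J_Omega d i" for \<alpha>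
  proof (rule Om.incident_lipschitz[OF R_Gamma_solves R_Gamma_solves _ \<theta>4 _ _ eps_min_bounds(1)[OF r0]])
    fix \<beta> assume \<beta>: "\<beta> \<in> I_Omega d"
    note c = cell_of_Omega(1)[OF \<beta>]
    show "0 \<le> u\<Omega> u \<beta>" "0 \<le> u\<Omega> w \<beta>" using u[OF c] w[OF c] \<beta> by auto
    show "0 \<le> u\<Omega> w \<beta> ^ 4 \<and> u\<Omega> w \<beta> ^ 4 \<le> r ^ 4" using w4[OF c] \<beta> by simp
    show "\<bar>u\<Omega> u \<beta> ^ 4 - u\<Omega> w \<beta> ^ 4\<bar> \<le> 4 * r ^ 3 * \<delta>" using p4[OF c] \<beta> by simp
    show "\<bar>\<epsilon> (u\<Omega> u \<beta>) - \<epsilon> (u\<Omega> w \<beta>)\<bar> \<le> ?L * \<delta>" using le[OF c] \<beta> by simp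
    show "eps_min d r \<le> \<epsilon> (u\<Omega> u \<beta>)" using eps_min_bounds(2)[OF r0 u[OF c]] \<beta> by simp
  qed (use that J_subset in auto)
  moreover have "Si.incident (R_Sigma d (u\<Sigma> u)) \<alpha> - Si.incident (R_Sigma d (u\<Sigma> w)) \<alpha> \<le> ?K * area (face d \<alpha>)"
    if "\<alpha> \<in> J_Sigma d i" for \<alpha>
  proof (rule Si.incident_lipschitz[OF R_Sigma_solves R_Sigma_solves _ \<theta>4 _ _ eps_min_bounds(1)[OF r0]])
    fix \<beta> assume \<beta>: "\<beta> \<in> I_Sigma d"
    note c = cell_of_Sigma(1)[OF \<beta>]
    show "0 \<le> u\<Sigma> u \<beta>" "0 \<le> u\<Sigma> w \<beta>" using u[OF c] w[OF c] \<beta> by auto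
    show "0 \<le> u\<Sigma> w \<beta> ^ 4 \<and> u\<Sigma> w \<beta> ^ 4 \<le> r ^ 4" using w4[OF c] \<beta> by simp
    show "\<bar>u\<Sigma> u \<beta> ^ 4 - u\<Sigma> w \<beta> ^ 4\<bar> \<le> 4 * r ^ 3 * \<delta>" using p4[OF c] \<beta> by simp
    show "\<bar>\<epsilon> (u\<Sigma> u \<beta>) - \<epsilon> (u\<Sigma> w \<beta>)\<bar> \<le> ?L * \<delta>" using le[OF c] \<beta> by simp
    show "eps_min d r \<le> \<epsilon> (u\<Sigma> u \<beta>)" using eps_min_bounds(2)[OF r0 u[OF c]] \<beta> by simp
  qed (use that J_subset in auto)
  ultimately have "inc i u - inc i w \<le> (\<Sum>\<alpha>\<in>J_Omega d i. ?K * area (face d \<alpha>)) + (\<Sum>\<alpha>\<in>J_Sigma d i. ?K * area (face d \<alpha>))"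
    unfolding inc_def add_diff_add sum_subtractf[symmetric] by (intro add_mono sum_mono)
  also have "\<dots> = ?K * surf i" unfolding surf_eq[OF i] distrib_left sum_distrib_left ..
  also have "?K * surf i = \<sigma> * (4 * r ^ 3 + 2 * r ^ 4 * ?L / eps_min d r) * \<delta> * surf i"
    by (simp add: algebra_simps)
  finally show ?thesis .
qed

end

section \<open>The equations of one time step\<close>

locale scheme_step = admissible_scheme d for d :: "('i, 'b) scheme" +
  fixes \<nu> :: nat and v :: "'i \<Rightarrow> real"
  assumes \<nu>: "\<nu> \<in> {1..time_steps d}" and v: "v \<in> cells d \<rightarrow>\<^sub>E {0..}"
begin

abbreviation "k \<equiv> time_len d \<nu>"
abbreviation "C \<equiv> energy_const d"
abbreviation "phases \<equiv> {Solid, Gas}"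

definition rest :: "'i \<Rightarrow> real" where
  "rest i = area (frontier (phase_cell d Solid i) \<inter> outer_rest d)"

definition src :: "'i \<Rightarrow> real" where
  "src i = (\<Sum>m\<in>phases. source_val d m \<nu> i * vol (phase_cell d m i))"

definition en :: "'i \<Rightarrow> real \<Rightarrow> real" where
  "en i s = inverse k * (\<Sum>m\<in>phases. (energy d m s - energy d m (v i)) * vol (phase_cell d m i))"

text \<open>Extended by 0 to non-neighbours, so that the conduction of both phases becomes one
  nonnegative coupling over all cells.\<close>

definition c :: "'i \<Rightarrow> 'i \<Rightarrow> real" where
  "c i j = (\<Sum>m\<in>phases. conductivity d m * (if j \<in> phase_nb d m i
     then area (frontier (phase_cell d m i) \<inter> frontier (phase_cell d m j)) / norm (node d i - node d j) else 0))"

definition h :: "'i \<Rightarrow> ('i \<Rightarrow> real) \<Rightarrow> real \<Rightarrow> real" where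
  "h i u s = en i s + \<sigma> * \<epsilon> s * s ^ 4 * surf i + \<sigma> * \<epsilon> s * (s ^ 4 - \<theta> ^ 4) * rest i - \<epsilon> s * inc i u - src i"

lemma k_pos: "0 < k"
proof -
  have "\<forall>n<time_steps d. time_pt d n < time_pt d (Suc n)"
    using adm_time unfolding admissible_time_def by blast
  moreover have "\<nu> - 1 < time_steps d" "Suc (\<nu> - 1) = \<nu>" using \<nu> by auto
  ultimately have "time_pt d (\<nu> - 1) < time_pt d \<nu>" by metis
  then show ?thesis by (simp add: time_len_def)
qed

lemma v_nonneg: "i \<in> cells d \<Longrightarrow> 0 \<le> v i"
  using v by (auto simp: PiE_def Pi_def)

lemma c_nonneg: "0 \<le> c i j"
  unfolding c_def using conductivity_nonneg by (intro sum_nonneg mult_nonneg_nonneg) auto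

lemma surf_nonneg: "0 \<le> surf i" and rest_nonneg: "0 \<le> rest i"
  by (simp_all add: surf_def rest_def)

lemma conduction_eq:
  assumes "i \<in> cells d"
  shows "(\<Sum>m\<in>phases. conductivity d m *
          (\<Sum>j\<in>phase_nb d m i. (u j - u i) / norm (node d i - node d j) *
             area (frontier (phase_cell d m i) \<inter> frontier (phase_cell d m j))))
    = (\<Sum>j\<in>cells d. c i j * (u j - u i))"
proof -
  let ?a = "\<lambda>m j. area (frontier (phase_cell d m i) \<inter> frontier (phase_cell d m j))"
  let ?n = "\<lambda>j. norm (node d i - node d j)"
  have inner: "(\<Sum>j\<in>phase_nb d m i. (u j - u i) / ?n j * ?a m j)
      = (\<Sum>j\<in>cells d. (if j \<in> phase_nb d m i then ?a m j / ?n j else 0) * (u j - u i))" for m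
  proof (rule sum.mono_neutral_cong_left[OF finite_cells])
    show "phase_nb d m i \<subseteq> cells d" by (auto simp: phase_nb_def phase_cells_def)
  qed auto
  have "(\<Sum>j\<in>cells d. c i j * (u j - u i))
      = (\<Sum>j\<in>cells d. \<Sum>m\<in>phases. conductivity d m * ((if j \<in> phase_nb d m i then ?a m j / ?n j else 0) * (u j - u i)))"
    unfolding c_def sum_distrib_right by (simp only: mult.assoc)
  also have "\<dots> = (\<Sum>m\<in>phases. \<Sum>j\<in>cells d. conductivity d m * ((if j \<in> phase_nb d m i then ?a m j / ?n j else 0) * (u j - u i)))"
    by (rule sum.swap)
  also have "\<dots> = (\<Sum>m\<in>phases. conductivity d m * (\<Sum>j\<in>phase_nb d m i. (u j - u i) / ?n j * ?a m j))"
    unfolding inner sum_distrib_left ..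
  finally show ?thesis by simp
qed

lemma scheme_op_eq:
  assumes i: "i \<in> cells d"
  shows "scheme_op d \<nu> i v u = h i u (u i) - (\<Sum>j\<in>cells d. c i j * (u j - u i))"
proof -
  have "scheme_op d \<nu> i v u = en i (u i) - (\<Sum>j\<in>cells d. c i j * (u j - u i))
      + \<sigma> * \<epsilon> (u i) * u i ^ 4 * area (frontier (phase_cell d Solid i) \<inter> Gamma_Omega d)
      + \<sigma> * \<epsilon> (u i) * (u i ^ 4 - \<theta> ^ 4) * rest i
      + \<sigma> * \<epsilon> (u i) * u i ^ 4 * area (cell d i \<inter> interface d)
      - ((\<Sum>\<alpha>\<in>J_Omega d i. V_Gamma d (u\<Omega> u) \<alpha>) + (\<Sum>\<alpha>\<in>J_Sigma d i. V_Sigma d (u\<Sigma> u) \<alpha>)) - src i"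
    unfolding scheme_op_def conduction_eq[OF i] en_def rest_def src_def u\<Omega>_def u\<Sigma>_def by simp
  also have "\<dots> = h i u (u i) - (\<Sum>j\<in>cells d. c i j * (u j - u i))"
    unfolding V_sum[OF i] h_def surf_def by (simp add: algebra_simps)
  finally show ?thesis .
qed

lemma en_v [simp]: "en i (v i) = 0"
  by (simp add: en_def)

text \<open>Both phases grow at least at the rate \<open>C\<close>, and their volumes add up to the
  volume of the cell.\<close>

lemma en_mono:
  assumes i: "i \<in> cells d" and st: "0 \<le> t" "t \<le> s"
  shows "C / k * (s - t) * vol (cell d i) \<le> en i s - en i t"
proof -
  have "(s - t) * C * vol (cell d i) = (\<Sum>m\<in>phases. (s - t) * C * vol (phase_cell d m i))"
    unfolding vol_cell(1)[OF i] sum_distrib_left ..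
  also have "\<dots> \<le> (\<Sum>m\<in>phases. (energy d m s - energy d m t) * vol (phase_cell d m i))"
    using energy_mono[OF st] by (intro sum_mono mult_right_mono) (auto simp: le_diff_eq)
  finally have "inverse k * ((s - t) * C * vol (cell d i))
      \<le> inverse k * (\<Sum>m\<in>phases. (energy d m s - energy d m t) * vol (phase_cell d m i))"
    using k_pos by (intro mult_left_mono) auto
  also have "\<dots> = en i s - en i t"
    unfolding en_def right_diff_distrib[symmetric] sum_subtractf[symmetric] by (simp add: left_diff_distrib)
  finally show ?thesis by (simp add: divide_inverse mult_ac)
qed

lemma source_nonneg:
  assumes "i \<in> cells d"
  shows "0 \<le> source_val d m \<nu> i * vol (phase_cell d m i)"
proof (cases "phase_cell d m i = {}")
  case False
  then have "i \<in> phase_cells d m" using assms by (simp add: phase_cells_def)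
  then have "0 \<le> ereal (source_val d m \<nu> i)"
    using adm_values \<nu> unfolding admissible_values_def Let_def by (meson order_trans)
  then show ?thesis by simp
qed simp

lemma src_nonneg: "i \<in> cells d \<Longrightarrow> 0 \<le> src i"
  unfolding src_def by (intro sum_nonneg source_nonneg)

lemma Max_ratio:
  assumes "i \<in> cells d"
  shows "f i \<le> Max ((\<lambda>i. f i / vol (cell d i)) ` cells d) * vol (cell d i)"
proof -
  have "f i / vol (cell d i) \<le> Max ((\<lambda>i. f i / vol (cell d i)) ` cells d)"
    using finite_cells assms by (intro Max_ge) auto
  then show ?thesis using vol_cell(2)[OF assms] by (simp add: pos_divide_le_eq)
qed

lemma B_f_eq: "B_f d \<nu> = Max ((\<lambda>i. src i / vol (cell d i)) ` cells d)"
  unfolding B_f_def src_def sum_divide_distrib by simp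

lemma src_le: "i \<in> cells d \<Longrightarrow> src i \<le> B_f d \<nu> * vol (cell d i)"
  unfolding B_f_eq by (rule Max_ratio)

lemma B_f_nonneg: "0 \<le> B_f d \<nu>"
proof -
  obtain i where i: "i \<in> cells d" using cells_ne by blast
  have "0 \<le> B_f d \<nu> * vol (cell d i)" using src_nonneg[OF i] src_le[OF i] by simp
  then show ?thesis using vol_cell(2)[OF i] by (simp add: zero_le_mult_iff)
qed

lemma Max_ratio_scaled:
  "i \<in> cells d \<Longrightarrow> \<sigma> * f i \<le> \<sigma> * Max ((\<lambda>i. f i / vol (cell d i)) ` cells d) * vol (cell d i)"
  unfolding mult.assoc using consts_pos(2) by (intro mult_left_mono Max_ratio) auto

lemma surf_le:
  assumes i: "i \<in> cells d"
  shows "\<sigma> * surf i \<le> (L_V_Gamma_Omega d + L_V_Sigma d) * vol (cell d i)"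
    and "\<sigma> * rest i \<le> L_V_rest d * vol (cell d i)"
  unfolding surf_def rest_def L_V_Gamma_Omega_def L_V_Sigma_def L_V_rest_def distrib_left distrib_right
  by (intro add_mono Max_ratio_scaled i)+

text \<open>Irradiation from temperatures up to \<open>s\<close> is at most the emission at
  \<open>s\<close>, and the exchange with the exterior is nonnegative, so only energy against source
  is left. It serves at a maximum of a solution and as the sign of \<open>h i u\<close> at
  \<open>hi\<close>.\<close>

lemma h_upper_sign:
  assumes i: "i \<in> cells d" and u: "\<And>j. j \<in> cells d \<Longrightarrow> 0 \<le> u j" "\<And>j. j \<in> cells d \<Longrightarrow> u j \<le> s"
    and s: "\<theta> \<le> s" "v i \<le> s"
  shows "(C / k * (s - v i) - B_f d \<nu>) * vol (cell d i) \<le> h i u s"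
proof -
  have s0: "0 \<le> s" using s consts_pos by simp
  have "C / k * (s - v i) * vol (cell d i) \<le> en i s"
    using en_mono[OF i v_nonneg[OF i] s(2)] by simp
  moreover have "src i \<le> B_f d \<nu> * vol (cell d i)" by (rule src_le[OF i])
  moreover have "\<epsilon> s * inc i u \<le> \<epsilon> s * (\<sigma> * s ^ 4 * surf i)"
    using \<epsilon>_range[OF s0] inc_upper[OF i u s(1)] by (intro mult_left_mono) auto
  moreover have "\<theta> ^ 4 \<le> s ^ 4" using s consts_pos by (intro power_mono) auto
  then have "0 \<le> \<sigma> * \<epsilon> s * (s ^ 4 - \<theta> ^ 4) * rest i"
    using consts_pos \<epsilon>_range[OF s0] rest_nonneg by (intro mult_nonneg_nonneg) auto
  ultimately show ?thesis unfolding h_def by (simp add: algebra_simps)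
qed

lemma h_lower_sign:
  assumes i: "i \<in> cells d" and u: "\<And>j. j \<in> cells d \<Longrightarrow> s \<le> u j"
    and s: "0 \<le> s" "s \<le> \<theta>" "s \<le> v i"
  shows "h i u s \<le> - (C / k * (v i - s) * vol (cell d i))"
proof -
  have "en i s \<le> - (C / k * (v i - s) * vol (cell d i))"
    using en_mono[OF i s(1,3)] by simp
  moreover have "0 \<le> src i" by (rule src_nonneg[OF i])
  moreover have "\<epsilon> s * (\<sigma> * s ^ 4 * surf i) \<le> \<epsilon> s * inc i u"
    using \<epsilon>_range[OF s(1)] inc_lower[OF i u s(1,2)] by (intro mult_left_mono) auto
  moreover have "s ^ 4 \<le> \<theta> ^ 4" using s by (intro power_mono) auto
  then have "0 \<le> \<sigma> * \<epsilon> s * (\<theta> ^ 4 - s ^ 4) * rest i"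
    using consts_pos \<epsilon>_range[OF s(1)] rest_nonneg by (intro mult_nonneg_nonneg) auto
  ultimately show ?thesis unfolding h_def by (simp add: algebra_simps)
qed

abbreviation "lo \<equiv> lower_bound d v"
abbreviation "hi \<equiv> upper_bound d \<nu> v"

lemma bounds:
  shows "0 \<le> lo" "lo \<le> \<theta>" "\<theta> \<le> hi" "lo \<le> hi" "0 < hi"
    and "\<And>i. i \<in> cells d \<Longrightarrow> lo \<le> v i" "\<And>i. i \<in> cells d \<Longrightarrow> v i + k / C * B_f d \<nu> \<le> hi"
    "\<And>i. i \<in> cells d \<Longrightarrow> v i \<le> hi"
proof -
  have "0 \<le> Min (v ` cells d)" using finite_cells cells_ne v_nonneg by (intro Min.boundedI) auto
  then show "0 \<le> lo" using consts_pos by (simp add: lower_bound_def)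
  show *: "lo \<le> \<theta>" "\<theta> \<le> hi" by (simp_all add: lower_bound_def upper_bound_def)
  then show "lo \<le> hi" by linarith
  show "0 < hi" using consts_pos * by linarith
  have "Min (v ` cells d) \<le> v i" "v i \<le> Max (v ` cells d)" if "i \<in> cells d" for i
    using finite_cells that by auto
  then show "lo \<le> v i" "v i + k / C * B_f d \<nu> \<le> hi" if "i \<in> cells d" for i
    using that by (auto simp: lower_bound_def upper_bound_def min.coboundedI2 max.coboundedI2)
  moreover have "0 \<le> k / C * B_f d \<nu>" using k_pos consts_pos B_f_nonneg by simp
  ultimately show "v i \<le> hi" if "i \<in> cells d" for i using that by fastforce
qed

text \<open>Origin of the second entry of \<open>upper_bound\<close>: above
  \<open>t + k / C * B\<close> the guaranteed growth of the energy outweighs a source density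
  \<open>B\<close>.\<close>

lemma excess_iff: "0 < C / k * (s - t) - B \<longleftrightarrow> t + k / C * B < s"
  and excess_iff': "0 \<le> C / k * (s - t) - B \<longleftrightarrow> t + k / C * B \<le> s"
  using k_pos consts_pos(1) by (simp_all add: field_simps)

lemma solution_bounds:
  assumes u: "\<And>j. j \<in> cells d \<Longrightarrow> 0 \<le> u j" and sol: "\<And>i. i \<in> cells d \<Longrightarrow> scheme_op d \<nu> i v u = 0"
    and "i \<in> cells d"
  shows "lo \<le> u i" "u i \<le> hi"
proof -
  obtain n where n: "n \<in> cells d" "\<And>j. j \<in> cells d \<Longrightarrow> u n \<le> u j"
    using ex_min_on_finite[OF finite_cells \<open>i \<in> cells d\<close>, where f = u] by metis
  obtain m where m: "m \<in> cells d" "\<And>j. j \<in> cells d \<Longrightarrow> - u m \<le> - u j"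
    using ex_min_on_finite[OF finite_cells \<open>i \<in> cells d\<close>, where f = "\<lambda>j. - u j"] by metis
  have "lo \<le> u n"
  proof (rule ccontr)
    assume "\<not> lo \<le> u n"
    then have less: "u n < v n" "u n \<le> \<theta>" using bounds(2) bounds(6)[OF n(1)] by linarith+
    have "h n u (u n) \<le> - (C / k * (v n - u n) * vol (cell d n))"
      using less n u by (intro h_lower_sign) auto
    moreover have "0 < C / k * (v n - u n) * vol (cell d n)"
      using less k_pos consts_pos vol_cell(2)[OF n(1)] by simp
    moreover have "0 \<le> (\<Sum>j\<in>cells d. c n j * (u j - u n))"
      using n c_nonneg by (intro sum_nonneg mult_nonneg_nonneg) auto
    ultimately show False using sol[OF n(1)] scheme_op_eq[OF n(1), of u] by linarith
  qed
  then show "lo \<le> u i" using n(2)[OF \<open>i \<in> cells d\<close>] by linarith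
  have "u m \<le> hi"
  proof (rule ccontr)
    assume "\<not> u m \<le> hi"
    then have less: "v m + k / C * B_f d \<nu> < u m" "\<theta> \<le> u m" "v m \<le> u m"
      using bounds(3) bounds(7,8)[OF m(1)] by linarith+
    have "(C / k * (u m - v m) - B_f d \<nu>) * vol (cell d m) \<le> h m u (u m)"
      using less m u by (intro h_upper_sign) auto
    moreover have "0 < (C / k * (u m - v m) - B_f d \<nu>) * vol (cell d m)"
      using less(1) vol_cell(2)[OF m(1)] by (intro mult_pos_pos excess_iff[THEN iffD2])
    moreover have "0 \<le> (\<Sum>j\<in>cells d. c m j * (u m - u j))"
      using m c_nonneg by (intro sum_nonneg mult_nonneg_nonneg) auto
    then have "(\<Sum>j\<in>cells d. c m j * (u j - u m)) \<le> 0"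
      by (simp add: right_diff_distrib sum_subtractf)
    ultimately show False using sol[OF m(1)] scheme_op_eq[OF m(1), of u] by linarith
  qed
  then show "u i \<le> hi" using m(2)[OF \<open>i \<in> cells d\<close>] by linarith
qed

section \<open>Slopes, Lipschitz constants and the smallness condition\<close>

abbreviation "L \<equiv> lip_const \<epsilon> hi"

text \<open>A lower bound for the slope of \<open>h i u\<close>. From the energy growth is
  subtracted, on the radiating surface, \<open>L * hi ^ 4\<close> once for the emission and once for
  the absorptivity in front of the irradiation; on the rest, once for the emission and
  \<open>L * \<theta> ^ 4\<close> for the external radiation.\<close>

definition \<mu> :: "'i \<Rightarrow> real" where
  "\<mu> i = C / k * vol (cell d i) - \<sigma> * surf i * (2 * (L * hi ^ 4)) - \<sigma> * rest i * (L * hi ^ 4 + L * \<theta> ^ 4)"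

definition \<gamma> :: "'i \<Rightarrow> real" where
  "\<gamma> i = \<sigma> * surf i * (4 * hi ^ 3 + 2 * hi ^ 4 * L / eps_min d hi)"

lemma L_nonneg: "0 \<le> L"
  using lip_const_nonneg[OF \<epsilon>_bdd] bounds(5) by simp

lemma \<gamma>_nonneg: "0 \<le> \<gamma> i"
  unfolding \<gamma>_def using consts_pos surf_nonneg L_nonneg eps_min_bounds(1)[OF bounds(5)] bounds(5)
  by (intro mult_nonneg_nonneg add_nonneg_nonneg divide_nonneg_nonneg) auto

lemma h_mono:
  assumes i: "i \<in> cells d" and u: "\<forall>j\<in>cells d. u j \<in> {lo..hi}" and st: "lo \<le> t" "t \<le> s" "s \<le> hi"
  shows "\<mu> i * (s - t) \<le> h i u s - h i u t"
proof -
  have rng: "s \<in> {0..hi}" "t \<in> {0..hi}" using st bounds(1) by auto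
  have \<epsilon>L: "\<bar>\<epsilon> s - \<epsilon> t\<bar> \<le> L * (s - t)"
    using \<epsilon>_lipschitz[OF bounds(5) rng] st by simp
  have u0: "0 \<le> u j" "u j \<le> hi" if "j \<in> cells d" for j using u that bounds(1) by force+
  have t4: "0 \<le> t ^ 4" "t ^ 4 \<le> hi ^ 4" using rng by (auto intro!: power_mono)
  have rad: "- (L * hi ^ 4 * (s - t)) \<le> \<epsilon> s * s ^ 4 - \<epsilon> t * t ^ 4"
  proof -
    \<comment> \<open>The first summand is nonnegative, so only the variation of the emissivity can
      lower the emission, at a rate of at most \<open>L * hi ^ 4\<close>.\<close>
    have "\<epsilon> s * s ^ 4 - \<epsilon> t * t ^ 4 = \<epsilon> s * (s ^ 4 - t ^ 4) + (\<epsilon> s - \<epsilon> t) * t ^ 4"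
      by (simp add: algebra_simps)
    moreover have "t ^ 4 \<le> s ^ 4" using st rng by (intro power_mono) auto
    then have "0 \<le> \<epsilon> s * (s ^ 4 - t ^ 4)" using \<epsilon>_range rng by (intro mult_nonneg_nonneg) (auto simp: less_imp_le)
    moreover have "\<bar>\<epsilon> s - \<epsilon> t\<bar> * \<bar>t ^ 4\<bar> \<le> L * (s - t) * hi ^ 4"
      using \<epsilon>L t4 st L_nonneg by (intro mult_mono) auto
    then have "\<bar>(\<epsilon> s - \<epsilon> t) * t ^ 4\<bar> \<le> L * hi ^ 4 * (s - t)" by (simp add: abs_mult mult_ac)
    ultimately show ?thesis by linarith
  qed
  have ext: "\<theta> ^ 4 * (\<epsilon> s - \<epsilon> t) \<le> L * \<theta> ^ 4 * (s - t)"
    using mult_left_mono[of "\<epsilon> s - \<epsilon> t" "L * (s - t)" "\<theta> ^ 4"] \<epsilon>L by (simp add: mult_ac)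
  have inc: "0 \<le> inc i u" "inc i u \<le> \<sigma> * hi ^ 4 * surf i"
    using inc_lower[OF i, of 0 u] inc_upper[OF i, of u hi] u0 bounds consts_pos by auto
  have T4: "(\<epsilon> s - \<epsilon> t) * inc i u \<le> L * (s - t) * (\<sigma> * hi ^ 4 * surf i)"
  proof -
    have "\<bar>\<epsilon> s - \<epsilon> t\<bar> * inc i u \<le> L * (s - t) * (\<sigma> * hi ^ 4 * surf i)"
      using \<epsilon>L inc st L_nonneg by (intro mult_mono) auto
    moreover have "(\<epsilon> s - \<epsilon> t) * inc i u \<le> \<bar>\<epsilon> s - \<epsilon> t\<bar> * inc i u"
      using inc by (intro mult_right_mono) auto
    ultimately show ?thesis by linarith
  qed
  have T1: "C / k * (s - t) * vol (cell d i) \<le> en i s - en i t"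
    using en_mono[OF i] st bounds(1) by simp
  have T2: "\<sigma> * surf i * (- (L * hi ^ 4 * (s - t))) \<le> \<sigma> * surf i * (\<epsilon> s * s ^ 4 - \<epsilon> t * t ^ 4)"
    using rad consts_pos surf_nonneg by (intro mult_left_mono mult_nonneg_nonneg) (auto simp: less_imp_le)
  have "- (L * hi ^ 4 * (s - t)) - L * \<theta> ^ 4 * (s - t) \<le> \<epsilon> s * s ^ 4 - \<epsilon> t * t ^ 4 - \<theta> ^ 4 * (\<epsilon> s - \<epsilon> t)"
    using rad ext by linarith
  then have T3: "\<sigma> * rest i * (- (L * hi ^ 4 * (s - t)) - L * \<theta> ^ 4 * (s - t))
      \<le> \<sigma> * rest i * (\<epsilon> s * s ^ 4 - \<epsilon> t * t ^ 4 - \<theta> ^ 4 * (\<epsilon> s - \<epsilon> t))"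
    using consts_pos rest_nonneg by (intro mult_left_mono mult_nonneg_nonneg) (auto simp: less_imp_le)
  have "h i u s - h i u t = (en i s - en i t) + \<sigma> * surf i * (\<epsilon> s * s ^ 4 - \<epsilon> t * t ^ 4)
      + \<sigma> * rest i * (\<epsilon> s * s ^ 4 - \<epsilon> t * t ^ 4 - \<theta> ^ 4 * (\<epsilon> s - \<epsilon> t)) - (\<epsilon> s - \<epsilon> t) * inc i u"
    unfolding h_def by (simp add: algebra_simps)
  moreover have "\<mu> i * (s - t) = C / k * (s - t) * vol (cell d i) + \<sigma> * surf i * (- (L * hi ^ 4 * (s - t)))
      + \<sigma> * rest i * (- (L * hi ^ 4 * (s - t)) - L * \<theta> ^ 4 * (s - t)) - L * (s - t) * (\<sigma> * hi ^ 4 * surf i)"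
    unfolding \<mu>_def by (simp add: algebra_simps)
  ultimately show ?thesis using T1 T2 T3 T4 by linarith
qed

text \<open>With \<open>s\<close> fixed, \<open>u\<close> enters \<open>h\<close> only through the
  irradiation, and its factor \<open>\<epsilon> s\<close> is at most 1.\<close>

lemma h_lipschitz:
  assumes i: "i \<in> cells d" and u: "\<forall>j\<in>cells d. u j \<in> {lo..hi}" and w: "\<forall>j\<in>cells d. w j \<in> {lo..hi}"
    and e: "\<forall>j\<in>cells d. \<bar>u j - w j\<bar> \<le> e" and s: "s \<in> {lo..hi}"
  shows "h i w s - h i u s \<le> \<gamma> i * e"
proof -
  have e0: "0 \<le> e" using e i by (meson abs_ge_zero order_trans)
  have s0: "0 \<le> s" using s bounds(1) by simp
  have "h i w s - h i u s = \<epsilon> s * (inc i u - inc i w)" unfolding h_def by (simp add: algebra_simps)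
  also have "\<dots> \<le> \<epsilon> s * (\<gamma> i * e)"
  proof (rule mult_left_mono)
    have "u j \<in> {0..hi}" "w j \<in> {0..hi}" if "j \<in> cells d" for j using u w that bounds(1) by force+
    then have "inc i u - inc i w \<le> \<sigma> * (4 * hi ^ 3 + 2 * hi ^ 4 * L / eps_min d hi) * e * surf i"
      using e by (intro inc_lipschitz[OF i bounds(3)]) auto
    then show "inc i u - inc i w \<le> \<gamma> i * e" by (simp add: \<gamma>_def mult_ac)
  qed (use \<epsilon>_range[OF s0] in simp)
  also have "\<dots> \<le> 1 * (\<gamma> i * e)"
    using \<epsilon>_range[OF s0] \<gamma>_nonneg e0 by (intro mult_right_mono) auto
  finally show ?thesis by simp
qed

lemma h_continuous:
  assumes i: "i \<in> cells d"
  shows "continuous_on {lo..hi} (h i u)"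
proof -
  have "continuous_on {lo..hi} \<epsilon>"
    by (rule continuous_on_subset[OF \<epsilon>_continuous[OF bounds(5)]]) (use bounds(1) in auto)
  moreover have "continuous_on {lo..hi} (energy d m)" for m
    by (rule continuous_on_subset[OF energy_cont]) (use bounds(1) in auto)
  ultimately show ?thesis
    unfolding h_def[abs_def] en_def[abs_def] by (intro continuous_intros)
qed

lemma h_sign:
  assumes i: "i \<in> cells d" and u: "\<forall>j\<in>cells d. u j \<in> {lo..hi}"
  shows "h i u lo \<le> 0 \<and> 0 \<le> h i u hi"
proof
  have u': "0 \<le> u j" "lo \<le> u j" "u j \<le> hi" if "j \<in> cells d" for j using u that bounds(1) by force+
  have "h i u lo \<le> - (C / k * (v i - lo) * vol (cell d i))"
    using u' bounds(1,2) bounds(6)[OF i] by (intro h_lower_sign[OF i]) auto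
  moreover have "0 \<le> C / k * (v i - lo) * vol (cell d i)"
    using bounds(6)[OF i] k_pos consts_pos vol_cell(2)[OF i] by simp
  ultimately show "h i u lo \<le> 0" by linarith
  have "(C / k * (hi - v i) - B_f d \<nu>) * vol (cell d i) \<le> h i u hi"
    using u' bounds(3) bounds(8)[OF i] by (intro h_upper_sign[OF i]) auto
  moreover have "0 \<le> (C / k * (hi - v i) - B_f d \<nu>) * vol (cell d i)"
    using bounds(7)[OF i] vol_cell(2)[OF i] by (intro mult_nonneg_nonneg excess_iff'[THEN iffD2]) auto
  ultimately show "0 \<le> h i u hi" by linarith
qed

text \<open>On the radiating surface the loss of emission is charged to \<open>l_g1\<close>, while
  the variation of the absorptivity (the summand 1 in the bracket of \<open>l_g2\<close>) and of the
  irradiation are charged to \<open>l_g2\<close>; on the rest the losses are charged to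
  \<open>l_g1\<close> and \<open>l_g3\<close>. The constants \<open>L_V\<close> convert areas into
  volumes, so the volume of the cell becomes a common factor.\<close>

lemma \<gamma>_less_\<mu>:
  assumes small: "k * ((L_V_Gamma_Omega d + L_V_rest d + L_V_Sigma d) * l_g1 d hi
       + (L_V_Gamma_Omega d + L_V_Sigma d) * l_g2 d hi + L_V_rest d * l_g3 d hi) < C"
    and i: "i \<in> cells d"
  shows "\<gamma> i < \<mu> i"
proof -
  define m where "m = eps_min d hi"
  have m: "0 < m" "m \<le> 1" using eps_min_bounds[OF bounds(5)] by (auto simp: m_def)
  have V: "0 < vol (cell d i)" by (rule vol_cell(2)[OF i])
  have "0 \<le> 4 * neg_var \<epsilon> hi * hi ^ 3"
    using neg_var_nonneg[OF \<epsilon>_bdd] bounds(5) by simp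
  then have l1: "L * hi ^ 4 \<le> l_g1 d hi" by (simp add: l_g1_def)
  have "1 \<le> inverse m" using m by (simp add: one_le_inverse_iff)
  then have "4 * hi ^ 3 * 1 \<le> 4 * hi ^ 3 * inverse m"
    using bounds(5) by (intro mult_left_mono) auto
  \<comment> \<open>\<open>hi\<close> is at least the external temperature, so the maximum in
    \<open>l_g2\<close> is its first entry.\<close>
  moreover have "max (hi ^ 4) (\<theta> ^ 4) = hi ^ 4"
    using bounds(3) consts_pos by (intro max_absorb1 power_mono) auto
  ultimately have l2: "4 * hi ^ 3 + 2 * hi ^ 4 * L / m + L * hi ^ 4 \<le> l_g2 d hi"
    unfolding l_g2_def m_def[symmetric] by (simp add: divide_inverse algebra_simps)
  have LH: "0 \<le> L * hi ^ 4" "0 \<le> L * \<theta> ^ 4" using L_nonneg by auto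
  have nn: "0 \<le> 4 * hi ^ 3 + 2 * hi ^ 4 * L / m"
    using bounds(5) L_nonneg m(1) by simp
  have S: "\<sigma> * surf i * (L * hi ^ 4 + (4 * hi ^ 3 + 2 * hi ^ 4 * L / m + L * hi ^ 4))
      \<le> (L_V_Gamma_Omega d + L_V_Sigma d) * vol (cell d i) * (l_g1 d hi + l_g2 d hi)"
  proof (rule mult_mono[OF surf_le(1)[OF i]])
    have "0 \<le> \<sigma> * surf i" using consts_pos surf_nonneg by simp
    then show "0 \<le> (L_V_Gamma_Omega d + L_V_Sigma d) * vol (cell d i)" using surf_le(1)[OF i] by linarith
  qed (use l1 l2 LH nn in linarith)+
  have Rr: "\<sigma> * rest i * (L * hi ^ 4 + L * \<theta> ^ 4) \<le> L_V_rest d * vol (cell d i) * (l_g1 d hi + l_g3 d hi)"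
  proof (rule mult_mono[OF surf_le(2)[OF i]])
    have "0 \<le> \<sigma> * rest i" using consts_pos rest_nonneg by simp
    then show "0 \<le> L_V_rest d * vol (cell d i)" using surf_le(2)[OF i] by linarith
    show "L * hi ^ 4 + L * \<theta> ^ 4 \<le> l_g1 d hi + l_g3 d hi" using l1 by (simp add: l_g3_def)
  qed (use LH in linarith)
  have "\<gamma> i + (C / k * vol (cell d i) - \<mu> i)
      = \<sigma> * surf i * (L * hi ^ 4 + (4 * hi ^ 3 + 2 * hi ^ 4 * L / m + L * hi ^ 4)) + \<sigma> * rest i * (L * hi ^ 4 + L * \<theta> ^ 4)"
    unfolding \<gamma>_def \<mu>_def m_def by (simp add: algebra_simps)
  also have "\<dots> \<le> ((L_V_Gamma_Omega d + L_V_rest d + L_V_Sigma d) * l_g1 d hi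
       + (L_V_Gamma_Omega d + L_V_Sigma d) * l_g2 d hi + L_V_rest d * l_g3 d hi) * vol (cell d i)"
    using S Rr by (simp add: algebra_simps)
  also have "\<dots> < C / k * vol (cell d i)"
    using small k_pos V by (intro mult_strict_right_mono) (simp_all add: pos_less_divide_eq mult.commute)
  finally show ?thesis by simp
qed

lemma solution_in_box:
  assumes u: "u \<in> cells d \<rightarrow>\<^sub>E {0..}" and sol: "\<forall>i\<in>cells d. scheme_op d \<nu> i v u = 0"
  shows "u \<in> cells d \<rightarrow>\<^sub>E {lo..hi}"
proof -
  have "0 \<le> u j" if "j \<in> cells d" for j using u that by (auto simp: PiE_def Pi_def)
  then have "u i \<in> {lo..hi}" if "i \<in> cells d" for i
    using solution_bounds[of u i] sol that by simp
  then show "u \<in> cells d \<rightarrow>\<^sub>E {lo..hi}" using u by (simp add: PiE_iff)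
qed

lemma unique_solution:
  assumes small: "k * ((L_V_Gamma_Omega d + L_V_rest d + L_V_Sigma d) * l_g1 d hi
       + (L_V_Gamma_Omega d + L_V_Sigma d) * l_g2 d hi + L_V_rest d * l_g3 d hi) < C"
  shows "\<exists>!u. u \<in> cells d \<rightarrow>\<^sub>E {lo..hi} \<and> (\<forall>i\<in>cells d. scheme_op d \<nu> i v u = 0)"
proof -
  obtain u where u: "\<forall>i\<in>cells d. u i \<in> {lo..hi}"
      "\<forall>i\<in>cells d. h i u (u i) - (\<Sum>j\<in>cells d. c i j * (u j - u i)) = 0"
    using nonlinear_system_solvable[of "cells d" lo hi c \<mu> h \<gamma>, OF finite_cells bounds(4) c_nonneg h_mono
        h_continuous h_lipschitz h_sign \<gamma>_nonneg \<gamma>_less_\<mu>[OF small]] by blast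
  \<comment> \<open>The solvability result says nothing outside \<open>cells d\<close>, whereas
    uniqueness among all functions needs the fixed value \<open>undefined\<close> there.\<close>
  define w where "w = restrict u (cells d)"
  have same: "h i w s = h i u s" if "i \<in> cells d" for i s
  proof -
    \<comment> \<open>The radiation terms read \<open>u\<close> only at cells to which an element is
      attached, so the restriction does not change \<open>h\<close>.\<close>
    have "u\<Omega> w = u\<Omega> u" "u\<Sigma> w = u\<Sigma> u"
      unfolding u\<Omega>_def u\<Sigma>_def w_def
      by (intro restrict_ext; simp add: cell_of_Omega(1) cell_of_Sigma(1))+
    then show ?thesis by (simp add: h_def inc_def)
  qed
  have w_sol: "scheme_op d \<nu> i v w = 0" if i: "i \<in> cells d" for i
  proof -
    have "(\<Sum>j\<in>cells d. c i j * (w j - w i)) = (\<Sum>j\<in>cells d. c i j * (u j - u i))"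
      using i by (intro sum.cong) (auto simp: w_def)
    moreover have "w i = u i" using i by (simp add: w_def)
    ultimately show ?thesis using u(2) i by (simp add: scheme_op_eq[OF i] same[OF i])
  qed
  show ?thesis
  proof (rule ex1I[of _ w])
    show "w \<in> cells d \<rightarrow>\<^sub>E {lo..hi} \<and> (\<forall>i\<in>cells d. scheme_op d \<nu> i v w = 0)"
      using u(1) w_sol by (auto simp: w_def)
    fix w' assume w': "w' \<in> cells d \<rightarrow>\<^sub>E {lo..hi} \<and> (\<forall>i\<in>cells d. scheme_op d \<nu> i v w' = 0)"
    have "w' i = w i" if "i \<in> cells d" for i
    proof (rule nonlinear_system_unique[of "cells d" c lo hi \<mu> h \<gamma>, OF finite_cells c_nonneg h_mono h_lipschitz \<gamma>_less_\<mu>[OF small]])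
      show "\<forall>j\<in>cells d. w' j \<in> {lo..hi}" using w' by (auto simp: PiE_iff)
      show "\<forall>j\<in>cells d. w j \<in> {lo..hi}" using u(1) by (simp add: w_def)
      show "\<forall>i\<in>cells d. h i w' (w' i) - (\<Sum>j\<in>cells d. c i j * (w' j - w' i)) = 0"
        using w' scheme_op_eq by simp
      show "\<forall>i\<in>cells d. h i w (w i) - (\<Sum>j\<in>cells d. c i j * (w j - w i)) = 0"
        using w_sol scheme_op_eq by simp
    qed (use that in auto)
    moreover have "w' \<in> extensional (cells d)" "w \<in> extensional (cells d)"
      using w' by (auto simp: PiE_def w_def)
    ultimately show "w' = w" by (meson extensionalityI)
  qed
qed

end

theorem theorem4p2:
  fixes d :: "('i, 'b) scheme" and \<nu> :: nat and v :: "'i \<Rightarrow> real"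
  assumes "admissible d"
    and "\<nu> \<in> {1..time_steps d}"
    and "v \<in> cells d \<rightarrow>\<^sub>E {0..}"
  shows
    "(\<forall>u \<in> cells d \<rightarrow>\<^sub>E {0..}. (\<forall>i\<in>cells d. scheme_op d \<nu> i v u = 0) \<longrightarrow>
        u \<in> cells d \<rightarrow>\<^sub>E {lower_bound d v..upper_bound d \<nu> v}) \<and>
     (time_len d \<nu> *
          ((L_V_Gamma_Omega d + L_V_rest d + L_V_Sigma d) * l_g1 d (upper_bound d \<nu> v)
           + (L_V_Gamma_Omega d + L_V_Sigma d) * l_g2 d (upper_bound d \<nu> v)
           + L_V_rest d * l_g3 d (upper_bound d \<nu> v))
        < energy_const d \<longrightarrow>
      (\<exists>!u. u \<in> cells d \<rightarrow>\<^sub>E {lower_bound d v..upper_bound d \<nu> v} \<and>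
         (\<forall>i\<in>cells d. scheme_op d \<nu> i v u = 0)))"
proof -
  have "scheme_step d \<nu> v"
    using assms by (simp add: scheme_step_def admissible_scheme_def scheme_step_axioms_def)
  then show ?thesis
    using scheme_step.solution_in_box[of d \<nu> v] scheme_step.unique_solution[of d \<nu> v] by blast
qed

end
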